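(* Let $(A(t),\mathrm{D}(A(t)))_{t\in\mathbb{R}}$ be the family of operators on $X=\mathrm{L}^1([0,1],\mathbb{C}^m)$ given by $$A(t)u=\big(c_1(t)u_1',\dots,c_m(t)u_m'\big),\qquad \mathrm{D}(A(t))=\{u\in \mathrm{W}^{1,1}([0,1],\mathbb{C}^m):\ u(1)=\mathbb{B}_C(t)u(0)\},$$ where $C(t)=\mathrm{diag}(c_1(t),\dots,c_m(t))$, $\mathbb{B}_C(t)=C(t)^{-1}\mathbb{B}C(t)$, $\mathbb{B}$ is the weighted (transposed) adjacency matrix of the line graph of the given metric graph, and there are constants $0<\underline{c}\le\overline{c}$ with $\underline{c}\le c_j(t)\le\overline{c}$ for all $j=1,\dots,m$ and $t\in\mathbb{R}$. Assume that $\mathrm{D}(A(t))=\mathrm{D}(A(0))$ for all $t\in\mathbb{R}$ and that each $c_j(\cdot)$ is continuously differentiable on $\mathbb{R}$. Then the non-autonomous network transport problem $$\begin{cases}\frac{\partial}{\partial t}u_j(x,t)=c_j(t)\frac{\partial}{\partial x}u_j(x,t), & x\in(0,1),\ t\ge s,\\ u_j(x,s)=f_j(x), & x\in(0,1),\\ \phi^-_{ij}c_j(t)u_j(1,t)=w_{ij}\sum_{k=1}^m\phi^+_{ik}c_k(t)u_k(0,t), & t\ge s,\end{cases}\qquad i=1,\dots,n,\ j=1,\dots,m,$$ is well-posed; that is, the associated non-autonomous abstract Cauchy problem $\dot u(t)=A(t)u(t)$ for $t\ge s$, $u(s)=f=(f_j)_{j=1}^m$, on $X$ is well-posed.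
   Context: Graph. $(\mathrm{V},\mathrm{E})$ is a simple, connected, directed, finite graph with vertices $\mathrm{v}_1,\dots,\mathrm{v}_n$ and edges $\mathrm{e}_1,\dots,\mathrm{e}_m$; each edge is parametrized by $[0,1]$ contrary to its orientation, so an edge $\mathrm{e}=(\mathrm{v}_i,\mathrm{v}_j)$ has endpoints $\mathrm{e}(1)=\mathrm{v}_i$ (tail) and $\mathrm{e}(0)=\mathrm{v}_j$ (head). The incidence matrices are $\phi^-_{ij}=1$ if $\mathrm{e}_j(1)=\mathrm{v}_i$ and $0$ otherwise; $\phi^+_{ij}=1$ if $\mathrm{e}_j(0)=\mathrm{v}_i$ and $0$ otherwise. Weights $0\le w_{ij}\le1$ ($1\le i\le n$, $1\le j\le m$) satisfy $\sum_{j=1}^m w_{ij}=1$ for every $i$, with $w_{ij}=0$ whenever $\phi^-_{ij}=0$. The $m\times m$ matrix $\mathbb{B}$ is defined by $\mathbb{B}_{ij}=w_{ki}$ if $\mathrm{e}_j(0)=\mathrm{v}_k=\mathrm{e}_i(1)$ for some $k$, and $\mathbb{B}_{ij}=0$ otherwise. It is column stochastic, and it is assumed to be irreducible. Space. $X=\mathrm{L}^1([0,1],\mathbb{C}^m)$ with $\|f\|_X=\sum_{j=1}^m\int_0^1|f_j(x)|\,dx$. Well-posedness. For linear operators $(A(t),\mathrm{D}(A(t)))$, $t\in\mathbb{R}$, on $X$, $s\in\mathbb{R}$ and $x\in \mathrm{D}(A(s))$, a (classical) solution of $\dot u(t)=A(t)u(t)$ $(t\ge s)$, $u(s)=x$ is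 a function $u=u(\cdot,s,x)\in \mathrm{C}^1([s,\infty),X)$ with $u(t)\in \mathrm{D}(A(t))$ satisfying the equation for all $t\ge s$ and $u(s)=x$. The problem is well-posed if there are subspaces $Y_s\subseteq \mathrm{D}(A(s))$, $s\in\mathbb{R}$, dense in $X$, such that for all $s\in\mathbb{R}$ and $x\in Y_s$ there is a unique solution $t\mapsto u(t,s,x)\in Y_t$; and in addition, whenever $s_n\to s$ and $Y_{s_n}\ni x_n\to x\in Y_s$, one has $\widetilde u(t,s_n,x_n)\to\widetilde u(t,s,x)$ uniformly for $t$ in compact intervals of $\mathbb{R}$, where $\widetilde u(t,s,x)=u(t,s,x)$ for $t\ge s$ and $\widetilde u(t,s,x)=x$ for $t<s$. *)

theory Defs
  imports "HOL-Analysis.Analysis" "Graph_Theory.Graph_Theory"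
begin

abbreviation unit_leb :: "real measure" where
  "unit_leb \<equiv> lebesgue_on {0..1}"

definition L1_rel :: "(real \<Rightarrow> complex^'e::finite) \<Rightarrow> (real \<Rightarrow> complex^'e) \<Rightarrow> bool" where
  "L1_rel f g \<longleftrightarrow> integrable unit_leb f \<and> integrable unit_leb g \<and> (AE x in unit_leb. f x = g x)"

text \<open>\<open>'e L1\<close> is \<open>L\<^sup>1([0,1], \<complex>\<^sup>m)\<close>, with \<open>'e\<close> the type of the \<open>m\<close> edges.\<close>

quotient_type (overloaded) 'e L1 = "real \<Rightarrow> complex^'e::finite" / partial: L1_rel
proof (rule part_equivpI)
  show "\<exists>f. L1_rel f f" by (rule exI[of _ "\<lambda>_. 0"]) (simp add: L1_rel_def)
  show "symp L1_rel" by (auto simp: symp_def L1_rel_def)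
  show "transp L1_rel" by (auto simp: transp_def L1_rel_def)
qed

lemma integrable_vec_nth:
  fixes f :: "real \<Rightarrow> complex^'e::finite"
  assumes "integrable M f"
  shows "integrable M (\<lambda>x. f x $ j)"
  by (rule integrable_bounded_linear[OF bounded_linear_vec_nth assms])

lemma integrable_vecI:
  fixes f :: "real \<Rightarrow> complex^'e::finite"
  assumes "\<And>j. integrable M (\<lambda>x. f x $ j)"
  shows "integrable M f"
proof -
  have bl: "bounded_linear (\<lambda>z. axis j z :: complex^'e)" for j
    unfolding linear_conv_bounded_linear[symmetric]
    by (rule linearI) (simp_all add: axis_def vec_eq_iff)
  have f_eq: "f = (\<lambda>x. \<Sum>j\<in>UNIV. axis j (f x $ j))"
    by (simp add: fun_eq_iff vec_eq_iff axis_def)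
  have "integrable M (\<lambda>x. \<Sum>j\<in>UNIV. axis j (f x $ j) :: complex^'e)"
    by (intro Bochner_Integration.integrable_sum integrable_bounded_linear[OF bl] assms)
  then show ?thesis by (rule iffD2[OF arg_cong[OF f_eq]])
qed

instantiation L1 :: (finite) real_normed_vector
begin

lift_definition zero_L1 :: "'a L1" is "\<lambda>_. 0" by (simp add: L1_rel_def)

lift_definition plus_L1 :: "'a L1 \<Rightarrow> 'a L1 \<Rightarrow> 'a L1" is "\<lambda>f g x. f x + g x"
  by (auto simp: L1_rel_def)

lift_definition minus_L1 :: "'a L1 \<Rightarrow> 'a L1 \<Rightarrow> 'a L1" is "\<lambda>f g x. f x - g x"
  by (auto simp: L1_rel_def)

lift_definition uminus_L1 :: "'a L1 \<Rightarrow> 'a L1" is "\<lambda>f x. - f x"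
  by (auto simp: L1_rel_def)

lift_definition scaleR_L1 :: "real \<Rightarrow> 'a L1 \<Rightarrow> 'a L1" is "\<lambda>r f x. r *\<^sub>R f x"
  by (auto simp: L1_rel_def)

lift_definition norm_L1 :: "'a L1 \<Rightarrow> real"
  is "\<lambda>f. \<Sum>j\<in>UNIV. \<integral>x. cmod (f x $ j) \<partial>unit_leb"
proof (rule sum.cong[OF refl])
  fix f g :: "real \<Rightarrow> complex^'a" and j
  assume "L1_rel f g"
  then have "integrable unit_leb (\<lambda>x. f x $ j)" "integrable unit_leb (\<lambda>x. g x $ j)"
    "AE x in unit_leb. f x = g x"
    by (auto simp: L1_rel_def intro: integrable_vec_nth)
  then show "(\<integral>x. cmod (f x $ j) \<partial>unit_leb) = (\<integral>x. cmod (g x $ j) \<partial>unit_leb)"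
    by (intro integral_cong_AE) (auto intro!: borel_measurable_norm borel_measurable_integrable)
qed

definition dist_L1 :: "'a L1 \<Rightarrow> 'a L1 \<Rightarrow> real" where "dist_L1 f g = norm (f - g)"

definition sgn_L1 :: "'a L1 \<Rightarrow> 'a L1" where "sgn_L1 f = inverse (norm f) *\<^sub>R f"

definition uniformity_L1 :: "('a L1 \<times> 'a L1) filter" where
  "uniformity_L1 = (INF e\<in>{0 <..}. principal {(x, y). dist x y < e})"

definition open_L1 :: "'a L1 set \<Rightarrow> bool" where
  "open_L1 U = (\<forall>x\<in>U. eventually (\<lambda>(x', y). x' = x \<longrightarrow> y \<in> U) uniformity)"

instance
proof
  fix f g h :: "'a L1" and r s :: real
  show "f + g + h = f + (g + h)" by transfer (auto simp: L1_rel_def algebra_simps)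
  show "f + g = g + f" by transfer (auto simp: L1_rel_def algebra_simps)
  show "0 + f = f" by transfer (auto simp: L1_rel_def)
  show "- f + f = 0" by transfer (auto simp: L1_rel_def)
  show "f - g = f + - g" by transfer (auto simp: L1_rel_def)
  show "r *\<^sub>R (f + g) = r *\<^sub>R f + r *\<^sub>R g" by transfer (auto simp: L1_rel_def algebra_simps)
  show "(r + s) *\<^sub>R f = r *\<^sub>R f + s *\<^sub>R f" by transfer (auto simp: L1_rel_def algebra_simps)
  show "r *\<^sub>R s *\<^sub>R f = (r * s) *\<^sub>R f" by transfer (auto simp: L1_rel_def)
  show "1 *\<^sub>R f = f" by transfer (auto simp: L1_rel_def)
  show "dist f g = norm (f - g)" by (rule dist_L1_def)
  show "sgn f = inverse (norm f) *\<^sub>R f" by (rule sgn_L1_def)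
  show "uniformity = (INF e\<in>{0 <..}. principal {(x :: 'a L1, y). dist x y < e})"
    by (rule uniformity_L1_def)
  show "open U = (\<forall>x\<in>U. eventually (\<lambda>(x', y). x' = x \<longrightarrow> y \<in> U) uniformity)" for U :: "'a L1 set"
    by (rule open_L1_def)
  show "norm (f + g) \<le> norm f + norm g"
  proof transfer
    fix f g :: "real \<Rightarrow> complex^'a"
    assume *: "L1_rel f f" "L1_rel g g"
    have "(\<integral>x. cmod ((f x + g x) $ j) \<partial>unit_leb)
        \<le> (\<integral>x. cmod (f x $ j) \<partial>unit_leb) + (\<integral>x. cmod (g x $ j) \<partial>unit_leb)" for j
    proof -
      have i: "integrable unit_leb (\<lambda>x. f x $ j)" "integrable unit_leb (\<lambda>x. g x $ j)"
        using * by (auto simp: L1_rel_def intro: integrable_vec_nth)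
      have "(\<integral>x. cmod ((f x + g x) $ j) \<partial>unit_leb)
          \<le> (\<integral>x. cmod (f x $ j) + cmod (g x $ j) \<partial>unit_leb)"
        using i by (intro integral_mono) (auto intro: norm_triangle_ineq)
      then show ?thesis using i by simp
    qed
    then show "(\<Sum>j\<in>UNIV. \<integral>x. cmod ((f x + g x) $ j) \<partial>unit_leb)
        \<le> (\<Sum>j\<in>UNIV. \<integral>x. cmod (f x $ j) \<partial>unit_leb) + (\<Sum>j\<in>UNIV. \<integral>x. cmod (g x $ j) \<partial>unit_leb)"
      by (simp add: sum_mono flip: sum.distrib)
  qed
  show "norm (r *\<^sub>R f) = \<bar>r\<bar> * norm f"
    by transfer (simp add: sum_distrib_left)
  show "norm f = 0 \<longleftrightarrow> f = 0"
  proof transfer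
    fix f :: "real \<Rightarrow> complex^'a"
    assume "L1_rel f f"
    then have f: "integrable unit_leb f" and i: "\<And>j. integrable unit_leb (\<lambda>x. f x $ j)"
      by (auto simp: L1_rel_def intro: integrable_vec_nth)
    have "(\<Sum>j\<in>UNIV. \<integral>x. cmod (f x $ j) \<partial>unit_leb) = 0
        \<longleftrightarrow> (\<forall>j. (\<integral>x. cmod (f x $ j) \<partial>unit_leb) = 0)"
      by (subst sum_nonneg_eq_0_iff) auto
    also have "\<dots> \<longleftrightarrow> (\<forall>j. AE x in unit_leb. f x $ j = 0)"
      using i by (subst integral_nonneg_eq_0_iff_AE) auto
    also have "\<dots> \<longleftrightarrow> (AE x in unit_leb. \<forall>j\<in>UNIV. f x $ j = 0)"
      by (subst AE_finite_all) auto
    also have "\<dots> \<longleftrightarrow> L1_rel f (\<lambda>_. 0)"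
      using f by (simp add: L1_rel_def vec_eq_iff)
    finally show "(\<Sum>j\<in>UNIV. \<integral>x. cmod (f x $ j) \<partial>unit_leb) = 0 \<longleftrightarrow> L1_rel f (\<lambda>_. 0)" .
  qed
qed

end

lift_definition comp_scale :: "('e \<Rightarrow> complex) \<Rightarrow> 'e::finite L1 \<Rightarrow> 'e L1"
  is "\<lambda>a f x. \<chi> j. a j * f x $ j"
  by (auto simp: L1_rel_def integrable_vec_nth intro!: integrable_vecI)

definition scaleC_L1 :: "complex \<Rightarrow> 'e::finite L1 \<Rightarrow> 'e L1" where
  "scaleC_L1 z = comp_scale (\<lambda>_. z)"

lemma L1_relI: "integrable unit_leb f \<Longrightarrow> f = g \<Longrightarrow> L1_rel f g"
  by (simp add: L1_rel_def)

lemma vector_space_scaleC_L1: "vector_space (scaleC_L1 :: complex \<Rightarrow> 'e::finite L1 \<Rightarrow> 'e L1)"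
proof
  fix a b :: complex and f g :: "'e L1"
  show "scaleC_L1 a (f + g) = scaleC_L1 a f + scaleC_L1 a g"
    unfolding scaleC_L1_def
    by (transfer, rule L1_relI, rule integrable_vecI)
       (simp_all add: L1_rel_def integrable_vec_nth fun_eq_iff vec_eq_iff ring_distribs)
  show "scaleC_L1 (a + b) f = scaleC_L1 a f + scaleC_L1 b f"
    unfolding scaleC_L1_def
    by (transfer, rule L1_relI, rule integrable_vecI)
       (simp_all add: L1_rel_def integrable_vec_nth fun_eq_iff vec_eq_iff ring_distribs)
  show "scaleC_L1 a (scaleC_L1 b f) = scaleC_L1 (a * b) f"
    unfolding scaleC_L1_def
    by (transfer, rule L1_relI, rule integrable_vecI)
       (simp_all add: L1_rel_def integrable_vec_nth fun_eq_iff vec_eq_iff ring_distribs)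
  show "scaleC_L1 1 f = f"
    unfolding scaleC_L1_def
    by (transfer, rule L1_relI, rule integrable_vecI)
       (simp_all add: L1_rel_def integrable_vec_nth fun_eq_iff vec_eq_iff ring_distribs)
qed

text \<open>\<open>represents v u\<close>: the function \<open>v\<close> belongs to the class \<open>u\<close>. Integrability of \<open>v\<close> on
  \<open>[0,1]\<close> is automatic, Lebesgue measure being complete.\<close>

lift_definition represents :: "(real \<Rightarrow> complex^'e) \<Rightarrow> 'e::finite L1 \<Rightarrow> bool"
  is "\<lambda>v f. AE x in unit_leb. v x = f x"
  by (auto simp: L1_rel_def)

text \<open>Test functions are continuously differentiable with compact support in the open interval
  \<open>(0,1)\<close>, a usual choice in dimension one (infinitely differentiable ones give the same space
  \<open>W\<^sup>1\<^sup>,\<^sup>1\<close>); \<open>\<phi>'\<close> is the derivative of \<open>\<phi>\<close>. Real-valued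
  ones suffice, as the weak formulation is complex linear in \<open>\<phi>\<close>.\<close>

definition test_function :: "(real \<Rightarrow> real) \<Rightarrow> (real \<Rightarrow> real) \<Rightarrow> bool" where
  "test_function \<phi> \<phi>' \<longleftrightarrow>
     (\<forall>x. (\<phi> has_real_derivative \<phi>' x) (at x)) \<and> continuous_on UNIV \<phi>' \<and>
     (\<exists>K. compact K \<and> K \<subseteq> {0<..<1} \<and> (\<forall>x. x \<notin> K \<longrightarrow> \<phi> x = 0))"

lift_definition has_weak_derivative :: "'e::finite L1 \<Rightarrow> 'e L1 \<Rightarrow> bool"
  is "\<lambda>u g. \<forall>\<phi> \<phi>'. test_function \<phi> \<phi>' \<longrightarrow>
        (\<integral>x. \<phi>' x *\<^sub>R u x \<partial>unit_leb) = - (\<integral>x. \<phi> x *\<^sub>R g x \<partial>unit_leb)"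
proof -
  fix u1 u2 g1 g2 :: "real \<Rightarrow> complex^'e"
  assume *: "L1_rel u1 u2" "L1_rel g1 g2"
  have eq: "(\<integral>x. h x *\<^sub>R p x \<partial>unit_leb) = (\<integral>x. h x *\<^sub>R q x \<partial>unit_leb)"
    if "L1_rel p q" "continuous_on UNIV h" for h :: "real \<Rightarrow> real" and p q :: "real \<Rightarrow> complex^'e"
  proof (rule integral_cong_AE)
    have "h \<in> borel_measurable borel" using that(2) by (rule borel_measurable_continuous_onI)
    then have h: "h \<in> borel_measurable unit_leb"
      by (intro measurable_restrict_space1 measurable_completion) simp
    show "(\<lambda>x. h x *\<^sub>R p x) \<in> borel_measurable unit_leb" "(\<lambda>x. h x *\<^sub>R q x) \<in> borel_measurable unit_leb"
      using that(1) by (auto simp: L1_rel_def intro!: borel_measurable_scaleR[OF h])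
    show "AE x in unit_leb. h x *\<^sub>R p x = h x *\<^sub>R q x"
      using that(1) by (auto simp: L1_rel_def)
  qed
  have t: "continuous_on UNIV \<phi>" "continuous_on UNIV \<phi>'" if "test_function \<phi> \<phi>'" for \<phi> \<phi>'
    using that unfolding test_function_def
    by (auto intro: continuous_at_imp_continuous_on DERIV_isCont)
  show "(\<forall>\<phi> \<phi>'. test_function \<phi> \<phi>' \<longrightarrow>
        (\<integral>x. \<phi>' x *\<^sub>R u1 x \<partial>unit_leb) = - (\<integral>x. \<phi> x *\<^sub>R g1 x \<partial>unit_leb)) =
      (\<forall>\<phi> \<phi>'. test_function \<phi> \<phi>' \<longrightarrow>
        (\<integral>x. \<phi>' x *\<^sub>R u2 x \<partial>unit_leb) = - (\<integral>x. \<phi> x *\<^sub>R g2 x \<partial>unit_leb))"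
    by (intro all_cong1 imp_cong refl) (simp add: eq[OF *(1)] eq[OF *(2)] t)
qed

definition W11 :: "'e::finite L1 set" where
  "W11 = {u. \<exists>g. has_weak_derivative u g}"

definition weak_derivative :: "'e::finite L1 \<Rightarrow> 'e L1" where
  "weak_derivative u = (THE g. has_weak_derivative u g)"

text \<open>Boundary values of \<open>u \<in> W\<^sup>1\<^sup>,\<^sup>1\<close> are those of its continuous representative on \<open>[0,1]\<close>.\<close>

definition has_boundary_values :: "'e::finite L1 \<Rightarrow> complex^'e \<Rightarrow> complex^'e \<Rightarrow> bool" where
  "has_boundary_values u u0 u1 \<longleftrightarrow>
     (\<exists>v. continuous_on {0..1} v \<and> represents v u \<and> v 0 = u0 \<and> v 1 = u1)"

text \<open>An operator family is given by a total function \<open>A t\<close> together with its domain \<open>D t\<close>; the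
  values of \<open>A t\<close> outside \<open>D t\<close> are never used.\<close>

definition classical_solution ::
  "(real \<Rightarrow> 'e::finite L1 \<Rightarrow> 'e L1) \<Rightarrow> (real \<Rightarrow> 'e L1 set) \<Rightarrow> real \<Rightarrow> 'e L1 \<Rightarrow> (real \<Rightarrow> 'e L1) \<Rightarrow> bool"
  where
  "classical_solution A D s x u \<longleftrightarrow>
     (\<exists>u'. continuous_on {s..} u' \<and>
        (\<forall>t\<ge>s. (u has_vector_derivative u' t) (at t within {s..}) \<and> u t \<in> D t \<and> u' t = A t (u t))) \<and>
     u s = x"

text \<open>\<open>U t s x\<close> plays the role of \<open>u(t,s,x)\<close>. A solution is only relevant on \<open>[s,\<infinity>)\<close>, so
  uniqueness is equality there.\<close>

definition well_posed ::
  "(real \<Rightarrow> 'e::finite L1 \<Rightarrow> 'e L1) \<Rightarrow> (real \<Rightarrow> 'e L1 set) \<Rightarrow> bool"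
  where
  "well_posed A D \<longleftrightarrow>
     (\<exists>Y U.
        (\<forall>s. module.subspace scaleC_L1 (Y s) \<and> Y s \<subseteq> D s \<and> closure (Y s) = UNIV) \<and>
        (\<forall>s. \<forall>x\<in>Y s.
           classical_solution A D s x (\<lambda>t. U t s x) \<and> (\<forall>t\<ge>s. U t s x \<in> Y t) \<and>
           (\<forall>v. classical_solution A D s x v \<longrightarrow> (\<forall>t\<ge>s. v t = U t s x))) \<and>
        (\<forall>s x \<sigma> \<xi>. x \<in> Y s \<and> (\<forall>n. \<xi> n \<in> Y (\<sigma> n)) \<and> \<sigma> \<longlonglongrightarrow> s \<and> \<xi> \<longlonglongrightarrow> x \<longrightarrow>
           (\<forall>a b. uniform_limit {a..b}
              (\<lambda>n t. if t \<ge> \<sigma> n then U t (\<sigma> n) (\<xi> n) else \<xi> n)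
              (\<lambda>t. if t \<ge> s then U t s x else x) sequentially)))"

text \<open>Edges are parametrized against their orientation: \<open>e(1)\<close> is the tail and \<open>e(0)\<close> the
  head of \<open>e\<close>. Matrices \<open>real^'e^'v\<close> have rows indexed by vertices and columns by edges.\<close>

definition incidence_minus :: "('v::finite, 'e::finite) pre_digraph \<Rightarrow> real^'e^'v" where
  "incidence_minus G = (\<chi> i j. if tail G j = i then 1 else 0)"

definition incidence_plus :: "('v::finite, 'e::finite) pre_digraph \<Rightarrow> real^'e^'v" where
  "incidence_plus G = (\<chi> i j. if head G j = i then 1 else 0)"

definition line_adjacency ::
  "('v::finite, 'e::finite) pre_digraph \<Rightarrow> real^'e^'v \<Rightarrow> real^'e^'e" where
  "line_adjacency G w = (\<chi> i j. if head G j = tail G i then w $ tail G i $ i else 0)"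

text \<open>Irreducible: no simultaneous permutation of rows and columns gives a block triangular form
  with nontrivial square diagonal blocks; \<open>S\<close> is the index set of one of the blocks.\<close>

definition irreducible_matrix :: "real^'e::finite^'e \<Rightarrow> bool" where
  "irreducible_matrix M \<longleftrightarrow>
     \<not> (\<exists>S. S \<noteq> {} \<and> S \<noteq> UNIV \<and> (\<forall>i. \<forall>j. i \<notin> S \<and> j \<in> S \<longrightarrow> M $ i $ j = 0))"

definition velocity_matrix :: "('e::finite \<Rightarrow> real \<Rightarrow> real) \<Rightarrow> real \<Rightarrow> real^'e^'e" where
  "velocity_matrix c t = (\<chi> i j. if i = j then c i t else 0)"

definition weighted_adjacency ::
  "('v::finite, 'e::finite) pre_digraph \<Rightarrow> real^'e^'v \<Rightarrow> ('e \<Rightarrow> real \<Rightarrow> real) \<Rightarrow> real \<Rightarrow> real^'e^'e"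
  where
  "weighted_adjacency G w c t =
     matrix_inv (velocity_matrix c t) ** line_adjacency G w ** velocity_matrix c t"

definition transport_op :: "('e::finite \<Rightarrow> real \<Rightarrow> real) \<Rightarrow> real \<Rightarrow> 'e L1 \<Rightarrow> 'e L1" where
  "transport_op c t u = comp_scale (\<lambda>j. complex_of_real (c j t)) (weak_derivative u)"

text \<open>\<open>transport_dom\<close> uses the boundary condition \<open>u(1) = B\<^sub>C(t) u(0)\<close>, whereas
  \<open>network_dom\<close> keeps the transmission conditions in terms of the incidence matrices:
  \<open>\<phi>\<^sup>-\<^sub>i\<^sub>j c\<^sub>j(t) u\<^sub>j(1,t) = w\<^sub>i\<^sub>j \<Sum>\<^sub>k \<phi>\<^sup>+\<^sub>i\<^sub>k c\<^sub>k(t) u\<^sub>k(0,t)\<close>.\<close>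

definition transport_dom ::
  "('v::finite, 'e::finite) pre_digraph \<Rightarrow> real^'e^'v \<Rightarrow> ('e \<Rightarrow> real \<Rightarrow> real) \<Rightarrow> real \<Rightarrow> 'e L1 set"
  where
  "transport_dom G w c t =
     {u \<in> W11. \<exists>u0 u1. has_boundary_values u u0 u1 \<and>
        u1 = map_matrix complex_of_real (weighted_adjacency G w c t) *v u0}"

definition network_dom ::
  "('v::finite, 'e::finite) pre_digraph \<Rightarrow> real^'e^'v \<Rightarrow> ('e \<Rightarrow> real \<Rightarrow> real) \<Rightarrow> real \<Rightarrow> 'e L1 set"
  where
  "network_dom G w c t =
     {u \<in> W11. \<exists>u0 u1. has_boundary_values u u0 u1 \<and>
        (\<forall>i j. complex_of_real (incidence_minus G $ i $ j * c j t) * u1 $ j =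
           complex_of_real (w $ i $ j) *
             (\<Sum>k\<in>UNIV. complex_of_real (incidence_plus G $ i $ k * c k t) * u0 $ k))}"

end

theory Submission
  imports Defs
begin

text \<open>Since the domain is constant, \<open>\<B>\<^sub>C(t)\<close> does not depend on \<open>t\<close>, so \<open>c\<^sub>i(t) / c\<^sub>i(0) = c\<^sub>j(t) / c\<^sub>j(0)\<close>
  whenever \<open>\<B>\<^sub>i\<^sub>j \<noteq> 0\<close>; by irreducibility all these ratios agree, that is \<open>c\<^sub>j(t) = \<gamma>(t) c\<^sub>j(0)\<close> and
  \<open>A(t) = \<gamma>(t) A(0)\<close>. Solutions are therefore time changes \<open>u(t) = S(\<Gamma>(t) - \<Gamma>(s)) f\<close>, with
  \<open>\<Gamma>' = \<gamma>\<close>, of solutions of the autonomous problem. For \<open>Y\<^sub>s\<close> one can take the classes of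
  \<open>C\<^sup>1\<close> functions \<open>f\<close> such that \<open>f\<close> and \<open>A(0) f\<close> both satisfy the boundary condition: on these the
  autonomous problem is solved along characteristics, \<open>u\<^sub>j(x,t) = P\<^sub>j(t + x / c\<^sub>j) / c\<^sub>j\<close>, where the flux
  \<open>P\<^sub>j\<close> at the head of the \<open>j\<close>-th edge satisfies the delay equation
  \<open>P\<^sub>j(t + 1 / c\<^sub>j) = \<Sum>\<^sub>k \<B>\<^sub>j\<^sub>k P\<^sub>k(t)\<close>. Column stochasticity of \<open>\<B>\<close> makes \<open>A(t)\<close> dissipative in
  \<open>L\<^sup>1\<close>, which gives uniqueness and continuous dependence.\<close>

section \<open>Contraction and representatives\<close>

text \<open>Existence and uniqueness live in different regularity classes. Solutions are constructed
  only from continuously differentiable data, but they have to be unique among all classical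
  solutions, whose values lie merely in \<open>W11\<close>. Dissipativity is therefore proved for
  weak derivatives: a continuous representative is shown to be an antiderivative of the weak
  derivative, and the latter is approximated in the mean by test functions. Mass enters an edge at
  its tail, \<open>x = 1\<close>, and leaves at its head, \<open>x = 0\<close>. Integrating along
  the edges leaves the boundary term \<open>sum_j c_j (|u_j(0)| - |u_j(1)|)\<close>; it is
  nonnegative because the entering fluxes are the matrix applied to the leaving ones and the columns
  sum to one. The second boundary condition on the data keeps the smooth class invariant: with the
  first one alone the fluxes would be continuous, but could have a kink at
  \<open>t = 1 / c_j\<close>, which later travels into the edges.\<close>

lemma norm_le_initial_if_dissipative:
  fixes w w' :: "real \<Rightarrow> 'a::real_normed_vector"
  assumes deriv: "\<And>t. t \<ge> s \<Longrightarrow> (w has_vector_derivative w' t) (at t within {s..})"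
    and diss: "\<And>t h. t \<ge> s \<Longrightarrow> h \<ge> 0 \<Longrightarrow> norm (w t) \<le> norm (w t - h *\<^sub>R w' t)"
    and "s \<le> b"
  shows "norm (w b) \<le> norm (w s)"
proof (cases "s = b")
  case False
  with \<open>s \<le> b\<close> have "s < b" by simp
  have cont: "continuous_on {s..} w"
    using deriv by (auto simp: continuous_on_eq_continuous_within intro: has_vector_derivative_continuous)
  \<comment> \<open>The norm need not be differentiable, so the comparison runs by contradiction
    with the penalised function \<psi>. At the earliest time t with \<psi> t at least \<psi> b, the
    backward point \<open>w (t - h)\<close> differs from \<open>w t - h *\<^sub>R w' t\<close> by at
    most \<open>\<epsilon> * h\<close>; dissipativity then gives \<psi> (t - h) \<ge> \<psi> t, so t
    was not the earliest.\<close>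
  have main: "norm (w b) - \<epsilon> * (b - s) \<le> norm (w s)" if "\<epsilon> > 0" for \<epsilon>
  proof (rule ccontr)
    define \<psi> where "\<psi> t = norm (w t) - \<epsilon> * (t - s)" for t
    assume "\<not> norm (w b) - \<epsilon> * (b - s) \<le> norm (w s)"
    then have less: "\<psi> s < \<psi> b" by (simp add: \<psi>_def)
    define S where "S = {t \<in> {s..b}. \<psi> b \<le> \<psi> t}"
    have "continuous_on {s..b} \<psi>"
      unfolding \<psi>_def by (intro continuous_intros continuous_on_subset[OF cont]) auto
    then have "closed ({s..b} \<inter> \<psi> -` {\<psi> b..})"
      by (intro continuous_closed_preimage) auto
    also have "{s..b} \<inter> \<psi> -` {\<psi> b..} = S"
      by (auto simp: S_def)
    finally have "closed S" .
    then have "compact ({s..b} \<inter> S)" by (intro compact_Int_closed) auto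
    also have "{s..b} \<inter> S = S" by (auto simp: S_def)
    finally have "compact S" .
    moreover have "b \<in> S" using \<open>s < b\<close> by (simp add: S_def)
    ultimately obtain t where t: "t \<in> S" and least: "\<And>r. r \<in> S \<Longrightarrow> t \<le> r"
      using compact_attains_inf[of S] by auto
    have ts: "s < t" "t \<le> b" "\<psi> b \<le> \<psi> t"
      using t less by (auto simp: S_def less_le)
    from deriv[of t] ts have "(w has_derivative (\<lambda>h. h *\<^sub>R w' t)) (at t within {s..})"
      by (simp add: has_vector_derivative_def)
    then have "\<forall>e>0. \<exists>d>0. \<forall>y\<in>{s..}. norm (y - t) < d \<longrightarrow>
        norm (w y - w t - (y - t) *\<^sub>R w' t) \<le> e * norm (y - t)"
      unfolding has_derivative_within_alt by blast
    with \<open>\<epsilon> > 0\<close> obtain d where "d > 0" and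
      d: "\<And>y. y \<in> {s..} \<Longrightarrow> norm (y - t) < d \<Longrightarrow>
            norm (w y - w t - (y - t) *\<^sub>R w' t) \<le> \<epsilon> * norm (y - t)"
      by blast
    define h where "h = min (d / 2) (t - s)"
    have h: "0 < h" "h < d" "h \<le> t - s" using \<open>d > 0\<close> ts by (auto simp: h_def)
    have est: "norm (w (t - h) - w t + h *\<^sub>R w' t) \<le> \<epsilon> * h"
      using d[of "t - h"] h by simp
    have "norm (w t) \<le> norm (w t - h *\<^sub>R w' t)" using diss[of t h] ts h by simp
    also have "\<dots> \<le> norm (w (t - h)) + norm (w (t - h) - w t + h *\<^sub>R w' t)"
      using norm_triangle_ineq4[of "w (t - h)" "w (t - h) - w t + h *\<^sub>R w' t"] by (simp add: algebra_simps)
    finally have "\<psi> t \<le> \<psi> (t - h)" using est by (simp add: \<psi>_def algebra_simps)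
    then have "t - h \<in> S" using ts h by (auto simp: S_def)
    from least[OF this] h show False by simp
  qed
  show ?thesis
  proof (rule field_le_epsilon)
    fix e :: real assume "e > 0"
    then show "norm (w b) \<le> norm (w s) + e"
      using main[of "e / (b - s)"] \<open>s < b\<close> by simp
  qed
qed simp

section \<open>Computing with classes through integrable representatives\<close>

lemma L1_rel_refl [simp]: "L1_rel v v \<longleftrightarrow> integrable unit_leb v"
  by (simp add: L1_rel_def)

lemma L1_cases:
  obtains v where "integrable unit_leb v" and "u = abs_L1 v"
  using Quotient_rep_reflp[OF Quotient_L1, of u] Quotient_abs_rep[OF Quotient_L1, of u]
  by (metis L1_rel_refl)

lemma represents_abs_L1:
  "integrable unit_leb f \<Longrightarrow> represents v (abs_L1 f) \<longleftrightarrow> (AE x in unit_leb. v x = f x)"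
  by (simp add: represents.abs_eq)

lemma abs_L1_eq_iff:
  assumes "integrable unit_leb f" "integrable unit_leb g"
  shows "abs_L1 f = abs_L1 g \<longleftrightarrow> (AE x in unit_leb. f x = g x)"
  using assms Quotient_rel[OF Quotient_L1, of f g] by (auto simp: L1_rel_def)

lemma norm_abs_L1:
  "integrable unit_leb f \<Longrightarrow> norm (abs_L1 f) = (\<Sum>j\<in>UNIV. \<integral>x. cmod (f x $ j) \<partial>unit_leb)"
  by (simp add: norm_L1.abs_eq)

lemma add_abs_L1:
  "integrable unit_leb f \<Longrightarrow> integrable unit_leb g \<Longrightarrow> abs_L1 f + abs_L1 g = abs_L1 (\<lambda>x. f x + g x)"
  by (simp add: plus_L1.abs_eq)

lemma diff_abs_L1:
  "integrable unit_leb f \<Longrightarrow> integrable unit_leb g \<Longrightarrow> abs_L1 f - abs_L1 g = abs_L1 (\<lambda>x. f x - g x)"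
  by (simp add: minus_L1.abs_eq)

lemma scaleR_abs_L1:
  "integrable unit_leb f \<Longrightarrow> r *\<^sub>R abs_L1 f = abs_L1 (\<lambda>x. r *\<^sub>R f x)"
  by (simp add: scaleR_L1.abs_eq)

lemma comp_scale_abs_L1:
  "integrable unit_leb f \<Longrightarrow> comp_scale a (abs_L1 f) = abs_L1 (\<lambda>x. \<chi> j. a j * f x $ j)"
  by (simp add: comp_scale.abs_eq)

lemma integrable_comp_scale:
  fixes f :: "real \<Rightarrow> complex^'e::finite"
  shows "integrable M f \<Longrightarrow> integrable M (\<lambda>x. \<chi> j. a j * f x $ j)"
  by (rule integrable_vecI) (simp add: integrable_vec_nth)

lemma has_weak_derivative_abs_L1:
  assumes "integrable unit_leb f" "integrable unit_leb g"
  shows "has_weak_derivative (abs_L1 f) (abs_L1 g) \<longleftrightarrow> (\<forall>\<phi> \<phi>'. test_function \<phi> \<phi>' \<longrightarrow>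
    (\<integral>x. \<phi>' x *\<^sub>R f x \<partial>unit_leb) = - (\<integral>x. \<phi> x *\<^sub>R g x \<partial>unit_leb))"
  using assms by (simp add: has_weak_derivative.abs_eq)

lemma integrable_unit_continuous:
  fixes f :: "real \<Rightarrow> 'b::euclidean_space"
  assumes "continuous_on {0..1} f"
  shows "integrable unit_leb f"
  by (intro absolutely_integrable_imp_integrable absolutely_integrable_continuous_real assms) simp

lemma integral_unit_leb:
  fixes f :: "real \<Rightarrow> 'b::euclidean_space"
  shows "integrable unit_leb f \<Longrightarrow> integral\<^sup>L unit_leb f = integral {0..1} f"
  by (rule lebesgue_integral_eq_integral) simp_all

lemma has_integral_unit_leb:
  fixes f :: "real \<Rightarrow> 'b::euclidean_space"
  shows "integrable unit_leb f \<Longrightarrow> (f has_integral (integral\<^sup>L unit_leb f)) {0..1}"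
  by (rule has_integral_integral_lebesgue_on) simp_all

lemma measurable_unit_continuous:
  fixes f :: "real \<Rightarrow> 'b::euclidean_space"
  shows "continuous_on {0..1} f \<Longrightarrow> f \<in> borel_measurable unit_leb"
  using integrable_unit_continuous by (rule borel_measurable_integrable)

text \<open>The norm of a class adds up component integrals, while \<open>norm (f x)\<close> is
  Euclidean and dominates each component; hence the factor counting the components.\<close>

lemma norm_abs_L1_le:
  fixes f :: "real \<Rightarrow> complex^'e::finite"
  assumes f: "integrable unit_leb f" and bound: "\<And>x. x \<in> {0..1} \<Longrightarrow> norm (f x) \<le> B"
  shows "norm (abs_L1 f) \<le> real CARD('e) * B"
proof -
  have "(\<integral>x. cmod (f x $ j) \<partial>unit_leb) \<le> B" for j
  proof -
    have "(\<integral>x. cmod (f x $ j) \<partial>unit_leb) \<le> (\<integral>x. B \<partial>unit_leb)"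
    proof (rule integral_mono)
      show "integrable unit_leb (\<lambda>x. cmod (f x $ j))"
        using f by (intro integrable_norm integrable_vec_nth)
      show "integrable unit_leb (\<lambda>x. B)" by (rule integrable_unit_continuous) auto
      show "cmod (f x $ j) \<le> B" if "x \<in> space unit_leb" for x
        using that by (intro order_trans[OF Finite_Cartesian_Product.norm_nth_le bound]) simp
    qed
    then show ?thesis by (simp add: measure_restrict_space)
  qed
  then show ?thesis
    using sum_mono[of UNIV "\<lambda>j. \<integral>x. cmod (f x $ j) \<partial>unit_leb" "\<lambda>_::'e. B"] by (simp add: norm_abs_L1[OF f])
qed

lemma norm_abs_L1_le_integral_norm:
  fixes f :: "real \<Rightarrow> complex^'e::finite"
  assumes f: "integrable unit_leb f"
  shows "norm (abs_L1 f) \<le> real CARD('e) * (\<integral>x. norm (f x) \<partial>unit_leb)"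
proof -
  have "(\<integral>x. cmod (f x $ j) \<partial>unit_leb) \<le> (\<integral>x. norm (f x) \<partial>unit_leb)" for j
    using f by (intro integral_mono integrable_norm integrable_vec_nth Finite_Cartesian_Product.norm_nth_le)
  then show ?thesis
    using sum_mono[of UNIV "\<lambda>j. \<integral>x. cmod (f x $ j) \<partial>unit_leb" "\<lambda>_::'e. \<integral>x. norm (f x) \<partial>unit_leb"]
    by (simp add: norm_abs_L1[OF f])
qed

section \<open>Density of test functions\<close>

text \<open>Squaring removes the kink of the positive part, which makes it a building block for
  continuously differentiable cutoffs.\<close>

lemma has_real_derivative_max_0_square:
  "((\<lambda>x::real. (max 0 x)\<^sup>2) has_real_derivative 2 * max 0 x) (at x)"
proof (cases x "0::real" rule: linorder_cases)
  case less
  show ?thesis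
    by (rule DERIV_cong_ev[THEN iffD1, of _ _ "\<lambda>_. 0", OF refl _ refl])
       (use less in \<open>auto intro!: eventually_mono[OF eventually_nhds_in_open[of "{..<0}" x]]\<close>)
next
  case greater
  have "((\<lambda>x::real. x\<^sup>2) has_real_derivative 2 * max 0 x) (at x)"
    using greater by (auto intro!: derivative_eq_intros)
  then show ?thesis
    by (rule DERIV_cong_ev[THEN iffD1, OF refl _ refl, rotated])
       (use greater in \<open>auto intro!: eventually_mono[OF eventually_nhds_in_open[of "{0<..}" x]]\<close>)
next
  case equal
  have "((\<lambda>h. (max 0 h)\<^sup>2 / h) \<longlongrightarrow> 0) (at (0::real))"
  proof (rule Lim_null_comparison)
    show "\<forall>\<^sub>F h in at 0. norm ((max 0 h)\<^sup>2 / h) \<le> \<bar>h\<bar>"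
      by (rule always_eventually) (auto simp: max_def power2_eq_square)
    show "((\<lambda>h. \<bar>h\<bar>) \<longlongrightarrow> 0) (at (0::real))" by (rule tendsto_eq_intros | simp)+
  qed
  with equal show ?thesis by (simp add: DERIV_def)
qed

text \<open>A transition from 0 to 1 across the unit interval that is exactly as smooth as
  \<open>test_function\<close> demands. The denominator never vanishes, since x and 1 - x are not
  both nonpositive.\<close>

definition smooth_step :: "real \<Rightarrow> real" where
  "smooth_step x = (max 0 x)\<^sup>2 / ((max 0 x)\<^sup>2 + (max 0 (1 - x))\<^sup>2)"

text \<open>The quotient rule after the cubic terms have cancelled; in this form nonnegativity and
  vanishing outside the open unit interval are visible.\<close>

definition smooth_step_deriv :: "real \<Rightarrow> real" where
  "smooth_step_deriv x = (2 * max 0 x * (max 0 (1 - x))\<^sup>2 + (max 0 x)\<^sup>2 * (2 * max 0 (1 - x)))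
     / ((max 0 x)\<^sup>2 + (max 0 (1 - x))\<^sup>2)\<^sup>2"

lemma smooth_step_denom_pos: "(max 0 x)\<^sup>2 + (max 0 (1 - x))\<^sup>2 > (0::real)"
  by (cases "x > 0") (auto simp: add_pos_nonneg add_nonneg_pos)

lemma smooth_step_denom_nonzero: "(max 0 x)\<^sup>2 + (max 0 (1 - x))\<^sup>2 \<noteq> (0::real)"
  by (rule less_imp_neq[OF smooth_step_denom_pos, symmetric])

lemma has_real_derivative_smooth_step [derivative_intros]:
  assumes "(g has_real_derivative D) (at x)"
  shows "((\<lambda>x. smooth_step (g x)) has_real_derivative smooth_step_deriv (g x) * D) (at x)"
proof -
  have eq: "((\<lambda>x. (max 0 x)\<^sup>2 + (max 0 (1 - x))\<^sup>2) has_real_derivative 2 * max 0 y - 2 * max 0 (1 - y)) (at y)"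
    for y :: real
    by (rule derivative_eq_intros has_real_derivative_max_0_square
          DERIV_chain2[OF has_real_derivative_max_0_square] refl | simp)+
  have "(smooth_step has_real_derivative smooth_step_deriv y) (at y)" for y
    unfolding smooth_step_def[abs_def]
    by (rule DERIV_cong[OF DERIV_divide[OF has_real_derivative_max_0_square eq]])
       (use smooth_step_denom_pos[of y] in \<open>auto simp: smooth_step_deriv_def power2_eq_square field_simps\<close>)
  from DERIV_chain2[OF this assms] show ?thesis .
qed

lemma continuous_on_smooth_step_deriv [continuous_intros]:
  assumes "continuous_on S g"
  shows "continuous_on S (\<lambda>x. smooth_step_deriv (g x))"
  unfolding smooth_step_deriv_def
  by (intro continuous_intros assms ballI power_not_zero smooth_step_denom_nonzero)

lemma continuous_on_smooth_step [continuous_intros]: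
  assumes "continuous_on S g"
  shows "continuous_on S (\<lambda>x. smooth_step (g x))"
  unfolding smooth_step_def
  by (intro continuous_intros assms ballI power_not_zero smooth_step_denom_nonzero)

lemma smooth_step_0: "x \<le> 0 \<Longrightarrow> smooth_step x = 0"
  and smooth_step_1: "x \<ge> 1 \<Longrightarrow> smooth_step x = 1"
  and smooth_step_nonneg: "0 \<le> smooth_step x"
  and smooth_step_le_1: "smooth_step x \<le> 1"
  and smooth_step_deriv_nonneg: "0 \<le> smooth_step_deriv x"
  and smooth_step_deriv_0: "x \<le> 0 \<or> x \<ge> 1 \<Longrightarrow> smooth_step_deriv x = 0"
  using smooth_step_denom_pos[of x] by (auto simp: smooth_step_def smooth_step_deriv_def)

section \<open>Approximation of vector-valued functions by test functions\<close>

definition vector_test_function :: "(real \<Rightarrow> 'b::real_normed_vector) \<Rightarrow> (real \<Rightarrow> 'b) \<Rightarrow> bool" where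
  "vector_test_function \<phi> \<phi>' \<longleftrightarrow>
     (\<forall>x. (\<phi> has_vector_derivative \<phi>' x) (at x)) \<and> continuous_on UNIV \<phi>' \<and>
     (\<exists>K. compact K \<and> K \<subseteq> {0<..<1} \<and> (\<forall>x. x \<notin> K \<longrightarrow> \<phi> x = 0))"

lemma test_function_iff_vector_test_function: "test_function = vector_test_function"
  by (auto simp: test_function_def vector_test_function_def fun_eq_iff
      has_real_derivative_iff_has_vector_derivative)

text \<open>The cutoff rises on \<open>{a..a + \<eta>}\<close> and falls on
  \<open>{b..b + \<eta>}\<close>, so its support lies in \<open>{a..b + \<eta>}\<close>. Its
  derivative is an approximate point evaluation at a minus one at b.\<close>

lemma test_function_cutoff:
  assumes "0 < a" "a \<le> b" "0 < \<eta>" "b + \<eta> < 1"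
  shows "test_function (\<lambda>x. smooth_step ((x - a) / \<eta>) - smooth_step ((x - b) / \<eta>))
    (\<lambda>x. smooth_step_deriv ((x - a) / \<eta>) / \<eta> - smooth_step_deriv ((x - b) / \<eta>) / \<eta>)"
  unfolding test_function_def
proof (intro conjI allI exI[of _ "{a..b + \<eta>}"] impI)
  fix x
  show "((\<lambda>x. smooth_step ((x - a) / \<eta>) - smooth_step ((x - b) / \<eta>)) has_real_derivative
     smooth_step_deriv ((x - a) / \<eta>) / \<eta> - smooth_step_deriv ((x - b) / \<eta>) / \<eta>) (at x)"
    using \<open>0 < \<eta>\<close> by (auto intro!: derivative_eq_intros)
  assume x: "x \<notin> {a..b + \<eta>}"
  show "smooth_step ((x - a) / \<eta>) - smooth_step ((x - b) / \<eta>) = 0"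
  proof (cases "x < a")
    case True
    with assms show ?thesis by (simp add: smooth_step_0 divide_nonpos_pos)
  next
    case False
    with x have "(x - a) / \<eta> \<ge> 1" "(x - b) / \<eta> \<ge> 1" using assms by (auto simp: field_simps)
    then show ?thesis by (simp add: smooth_step_1)
  qed
qed (use assms in \<open>auto intro!: continuous_intros\<close>)

lemma continuous_on_vector_test_function:
  "vector_test_function \<phi> \<phi>' \<Longrightarrow> continuous_on S \<phi>"
  by (auto simp: vector_test_function_def intro!: continuous_at_imp_continuous_on has_vector_derivative_continuous)

text \<open>A measurable function is almost everywhere a limit of continuous ones. Projecting these
  to the ball of radius N keeps the bound and the limit, replacing them by polynomials adds
  smoothness, and multiplying by cutoffs that tend to 1 adds compact support. The bound N + 1 allows
  for the polynomial error, which is at most 1.\<close>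

lemma bounded_measurable_approx_test_function:
  fixes f :: "real \<Rightarrow> 'b::euclidean_space"
  assumes f: "f \<in> borel_measurable unit_leb" and bound: "\<And>x. norm (f x) \<le> N"
  obtains \<phi> \<phi>' :: "nat \<Rightarrow> real \<Rightarrow> 'b"
  where "\<And>n. vector_test_function (\<phi> n) (\<phi>' n)"
    and "\<And>n x. x \<in> {0..1} \<Longrightarrow> norm (\<phi> n x) \<le> N + 1"
    and "AE x in unit_leb. (\<lambda>n. \<phi> n x) \<longlonglongrightarrow> f x"
proof -
  have N: "N \<ge> 0" using bound[of 0] norm_ge_zero[of "f 0"] by linarith
  let ?P = "closest_point (cball (0::'b) N)"
  have ball: "convex (cball (0::'b) N)" "closed (cball (0::'b) N)" "cball (0::'b) N \<noteq> {}"
    using N by auto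
  from f have "f measurable_on {0..1}"
    by (subst measurable_on_iff_borel_measurable) auto
  then obtain Z g where Z: "negligible Z" and g: "\<And>n. continuous_on UNIV (g n)"
    and lim: "\<And>x. x \<notin> Z \<Longrightarrow> (\<lambda>n. g n x) \<longlonglongrightarrow> (if x \<in> {0..1} then f x else 0)"
    unfolding measurable_on_def by auto
  have h: "continuous_on UNIV (\<lambda>x. ?P (g n x))" for n
    using continuous_on_compose2[OF continuous_on_closest_point[OF ball, of UNIV] g] by auto
  have "\<exists>q. polynomial_function q \<and> (\<forall>x\<in>{0..1}. norm (?P (g n x) - q x) < inverse (Suc n))" for n
    by (rule Stone_Weierstrass_polynomial_function)
       (auto intro: continuous_on_subset[OF h])
  then obtain q where q: "\<And>n. polynomial_function (q n)"
    and q_approx: "\<And>n x. x \<in> {0..1} \<Longrightarrow> norm (?P (g n x) - q n x) < inverse (Suc n)"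
    by metis
  have "\<exists>q'. polynomial_function q' \<and> (\<forall>x. (q n has_vector_derivative q' x) (at x))" for n
    using has_vector_derivative_polynomial_function[OF q[of n]] by metis
  then obtain q' where q': "\<And>n. polynomial_function (q' n)"
    and dq: "\<And>n x. (q n has_vector_derivative q' n x) (at x)" by metis
  \<comment> \<open>The shift by 4 gives \<eta> n \<le> 1/4, so the ramp rising on
    \<open>{\<eta> n..2 * \<eta> n}\<close> ends before the one falling on
    \<open>{1 - 2 * \<eta> n..1 - \<eta> n}\<close> begins, and the cutoff equals 1 in
    between.\<close>
  define \<eta> where "\<eta> n = inverse (real (n + 4))" for n
  have \<eta>: "0 < \<eta> n" "\<eta> n \<le> 1/4" for n by (auto simp: \<eta>_def field_simps)
  define \<kappa> where "\<kappa> n x = smooth_step ((x - \<eta> n) / \<eta> n) - smooth_step ((x - (1 - 2 * \<eta> n)) / \<eta> n)" for n x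
  define \<kappa>' where "\<kappa>' n x = smooth_step_deriv ((x - \<eta> n) / \<eta> n) / \<eta> n
      - smooth_step_deriv ((x - (1 - 2 * \<eta> n)) / \<eta> n) / \<eta> n" for n x
  have \<kappa>: "test_function (\<kappa> n) (\<kappa>' n)" for n
    unfolding \<kappa>_def[abs_def] \<kappa>'_def[abs_def]
    using \<eta>[of n] by (intro test_function_cutoff) auto
  have \<kappa>_bound: "\<bar>\<kappa> n x\<bar> \<le> 1" for n x
    using smooth_step_nonneg[of "(x - \<eta> n) / \<eta> n"] smooth_step_le_1[of "(x - \<eta> n) / \<eta> n"]
      smooth_step_nonneg[of "(x - (1 - 2 * \<eta> n)) / \<eta> n"] smooth_step_le_1[of "(x - (1 - 2 * \<eta> n)) / \<eta> n"]
    by (auto simp: \<kappa>_def)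
  have \<eta>_lim: "\<eta> \<longlonglongrightarrow> 0"
    unfolding \<eta>_def using LIMSEQ_ignore_initial_segment[OF lim_inverse_n, of 4] by simp
  have \<kappa>_lim: "(\<lambda>n. \<kappa> n x) \<longlonglongrightarrow> 1" if "x \<in> {0<..<1}" for x
  proof -
    have "\<forall>\<^sub>F n in sequentially. \<eta> n < min (x / 2) ((1 - x) / 2)"
      using that by (intro order_tendstoD[OF \<eta>_lim]) auto
    then have "\<forall>\<^sub>F n in sequentially. \<kappa> n x = 1"
    proof eventually_elim
      case (elim n)
      then have "(x - \<eta> n) / \<eta> n \<ge> 1" "(x - (1 - 2 * \<eta> n)) / \<eta> n \<le> 0"
        using \<eta>[of n] by (auto simp: field_simps)
      then show ?case by (simp add: \<kappa>_def smooth_step_0 smooth_step_1)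
    qed
    then show ?thesis by (rule tendsto_eventually)
  qed
  show ?thesis
  proof (rule that[of "\<lambda>n x. \<kappa> n x *\<^sub>R q n x" "\<lambda>n x. \<kappa> n x *\<^sub>R q' n x + \<kappa>' n x *\<^sub>R q n x"])
    fix n
    from \<kappa>[of n] obtain K where K: "compact K" "K \<subseteq> {0<..<1}" "\<And>x. x \<notin> K \<Longrightarrow> \<kappa> n x = 0"
      by (auto simp: test_function_def)
    have cont: "continuous_on UNIV (\<kappa> n)" "continuous_on UNIV (\<kappa>' n)"
      using \<kappa>[of n] continuous_on_vector_test_function[of "\<kappa> n" "\<kappa>' n" UNIV]
      by (auto simp: test_function_iff_vector_test_function vector_test_function_def)
    show "vector_test_function (\<lambda>x. \<kappa> n x *\<^sub>R q n x) (\<lambda>x. \<kappa> n x *\<^sub>R q' n x + \<kappa>' n x *\<^sub>R q n x)"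
      unfolding vector_test_function_def
    proof (intro conjI allI exI[of _ K] impI)
      show "((\<lambda>x. \<kappa> n x *\<^sub>R q n x) has_vector_derivative \<kappa> n x *\<^sub>R q' n x + \<kappa>' n x *\<^sub>R q n x) (at x)" for x
        using \<kappa>[of n] dq[of n x] by (intro has_vector_derivative_scaleR) (auto simp: test_function_def)
    next
      show "continuous_on UNIV (\<lambda>x. \<kappa> n x *\<^sub>R q' n x + \<kappa>' n x *\<^sub>R q n x)"
        by (intro continuous_intros cont continuous_on_polymonial_function q q')
    qed (use K in auto)
  next
    fix n and x :: real assume x: "x \<in> {0..1}"
    have "norm (?P (g n x)) \<le> N"
      using closest_point_in_set[OF ball(2,3), of "g n x"] by simp
    moreover have "norm (q n x) \<le> norm (?P (g n x)) + norm (?P (g n x) - q n x)"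
      using norm_triangle_ineq4[of "?P (g n x)" "?P (g n x) - q n x"] by simp
    moreover have "inverse (real (Suc n)) \<le> 1" by (simp add: field_simps)
    ultimately have "norm (q n x) \<le> N + 1" using q_approx[OF x, of n] by linarith
    moreover have "\<bar>\<kappa> n x\<bar> * norm (q n x) \<le> 1 * norm (q n x)"
      by (rule mult_right_mono[OF \<kappa>_bound]) simp
    ultimately show "norm (\<kappa> n x *\<^sub>R q n x) \<le> N + 1" by simp
  next
    \<comment> \<open>The end points join the exceptional set because every cutoff vanishes
      there.\<close>
    have "negligible (Z \<union> {0, 1})" using Z by (intro negligible_Un) auto
    then have "AE x in lebesgue. x \<notin> Z \<union> {0, 1}"
      using AE_not_in negligible_iff_null_sets by blast
    then have "AE x in lebesgue. x \<in> {0..1} \<longrightarrow> (\<lambda>n. \<kappa> n x *\<^sub>R q n x) \<longlonglongrightarrow> f x"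
    proof eventually_elim
      case (elim x)
      show ?case
      proof
        assume x: "x \<in> {0..1}"
        have "(\<lambda>n. ?P (g n x)) \<longlonglongrightarrow> ?P (f x)"
          using continuous_on_closest_point[OF ball, of UNIV] lim[of x] elim x
          by (intro isCont_tendsto_compose[of _ ?P]) (auto simp: continuous_on_eq_continuous_at)
        also have "?P (f x) = f x" by (rule closest_point_self) (simp add: bound)
        finally have *: "(\<lambda>n. ?P (g n x)) \<longlonglongrightarrow> f x" .
        have "(\<lambda>n. ?P (g n x) - q n x) \<longlonglongrightarrow> 0"
          by (rule Lim_null_comparison[OF _ LIMSEQ_inverse_real_of_nat])
             (use q_approx[OF x] in \<open>auto intro!: always_eventually less_imp_le\<close>)
        from tendsto_diff[OF * this] have "(\<lambda>n. q n x) \<longlonglongrightarrow> f x" by simp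
        then have "(\<lambda>n. \<kappa> n x *\<^sub>R q n x) \<longlonglongrightarrow> 1 *\<^sub>R f x"
          using elim x by (intro tendsto_scaleR \<kappa>_lim) auto
        then show "(\<lambda>n. \<kappa> n x *\<^sub>R q n x) \<longlonglongrightarrow> f x" by simp
      qed
    qed
    then show "AE x in unit_leb. (\<lambda>n. \<kappa> n x *\<^sub>R q n x) \<longlonglongrightarrow> f x"
      by (subst AE_restrict_space_iff) auto
  qed
qed

text \<open>Truncating the values to a large ball changes f little in the mean, by dominated
  convergence; the truncated function is bounded, so its pointwise approximation by uniformly
  bounded test functions is also an approximation in the mean.\<close>

lemma integrable_approx_test_function:
  fixes f :: "real \<Rightarrow> 'b::euclidean_space"
  assumes f: "integrable unit_leb f" and "\<epsilon> > 0"
  obtains \<phi> \<phi>' where "vector_test_function \<phi> \<phi>'" "(\<integral>x. norm (f x - \<phi> x) \<partial>unit_leb) < \<epsilon>"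
proof -
  let ?P = "\<lambda>n. closest_point (cball (0::'b) (real n))"
  have ball: "convex (cball (0::'b) (real n))" "closed (cball (0::'b) (real n))" "cball (0::'b) (real n) \<noteq> {}" for n
    by auto
  have meas: "(\<lambda>x. ?P n (f x)) \<in> borel_measurable unit_leb" for n
    using borel_measurable_integrable[OF f]
      borel_measurable_continuous_onI[OF continuous_on_closest_point[OF ball, of UNIV n]]
    by (rule measurable_compose)
  have norm_P: "norm (?P n z) \<le> norm z" for n z
    using closest_point_lipschitz[OF ball, of n z 0] closest_point_self[of 0 "cball (0::'b) (real n)"] by simp
  have "(\<lambda>n. \<integral>x. norm (f x - ?P n (f x)) \<partial>unit_leb) \<longlonglongrightarrow> (\<integral>x. 0 \<partial>unit_leb)"
  proof (rule integral_dominated_convergence[where w = "\<lambda>x. 2 * norm (f x)"])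
    show "AE x in unit_leb. (\<lambda>n. norm (f x - ?P n (f x))) \<longlonglongrightarrow> 0"
    proof (rule AE_I2)
      fix x
      obtain m :: nat where m: "norm (f x) \<le> real m" using real_arch_simple by blast
      have "\<forall>\<^sub>F n in sequentially. norm (f x - ?P n (f x)) = 0"
        using eventually_ge_at_top[of m]
      proof eventually_elim
        case (elim n)
        with m have "f x \<in> cball 0 (real n)" by simp
        then show ?case by (simp add: closest_point_self)
      qed
      then show "(\<lambda>n. norm (f x - ?P n (f x))) \<longlonglongrightarrow> 0" by (rule tendsto_eventually)
    qed
    show "AE x in unit_leb. norm (norm (f x - ?P n (f x))) \<le> 2 * norm (f x)" for n
    proof (rule AE_I2)
      fix x
      show "norm (norm (f x - ?P n (f x))) \<le> 2 * norm (f x)"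
        using norm_triangle_ineq4[of "f x" "?P n (f x)"] norm_P[of n "f x"] by simp
    qed
  qed (use f meas in auto)
  then have "\<forall>\<^sub>F n in sequentially. (\<integral>x. norm (f x - ?P n (f x)) \<partial>unit_leb) < \<epsilon> / 2"
    using \<open>\<epsilon> > 0\<close> by (intro order_tendstoD) auto
  then obtain n where n: "(\<integral>x. norm (f x - ?P n (f x)) \<partial>unit_leb) < \<epsilon> / 2"
    by (auto dest: eventually_happens)
  have bound: "norm (?P n (f x)) \<le> real n" for x
    using closest_point_in_set[OF ball(2,3), of n "f x"] by simp
  obtain \<phi> \<phi>' where \<phi>: "\<And>k. vector_test_function (\<phi> k) (\<phi>' k)"
    and \<phi>_bound: "\<And>k x. x \<in> {0..1} \<Longrightarrow> norm (\<phi> k x) \<le> real n + 1"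
    and \<phi>_lim: "AE x in unit_leb. (\<lambda>k. \<phi> k x) \<longlonglongrightarrow> ?P n (f x)"
    by (rule bounded_measurable_approx_test_function[OF meas bound]) blast
  have \<phi>_int: "integrable unit_leb (\<phi> k)" for k
    using \<phi> by (intro integrable_unit_continuous continuous_on_vector_test_function)
  have P_int: "integrable unit_leb (\<lambda>x. ?P n (f x))"
    using norm_P by (intro Bochner_Integration.integrable_bound[OF f meas]) auto
  have "(\<lambda>k. \<integral>x. norm (?P n (f x) - \<phi> k x) \<partial>unit_leb) \<longlonglongrightarrow> (\<integral>x. 0 \<partial>unit_leb)"
  \<comment> \<open>The constant adds the bound n of the truncated function and the bound n + 1 of
    the approximants.\<close>
  proof (rule integral_dominated_convergence[where w = "\<lambda>x. 2 * real n + 1"])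
    show "AE x in unit_leb. (\<lambda>k. norm (?P n (f x) - \<phi> k x)) \<longlonglongrightarrow> 0"
      using \<phi>_lim
    proof eventually_elim
      case (elim x)
      have "(\<lambda>k. norm (?P n (f x) - \<phi> k x)) \<longlonglongrightarrow> norm (?P n (f x) - ?P n (f x))"
        by (intro tendsto_intros elim)
      then show ?case by simp
    qed
    show "AE x in unit_leb. norm (norm (?P n (f x) - \<phi> k x)) \<le> 2 * real n + 1" for k
    proof (rule AE_I2)
      fix x assume "x \<in> space unit_leb"
      then show "norm (norm (?P n (f x) - \<phi> k x)) \<le> 2 * real n + 1"
        using norm_triangle_ineq4[of "?P n (f x)" "\<phi> k x"] bound[of x] \<phi>_bound[of x k] by simp
    qed
    show "integrable unit_leb (\<lambda>x. 2 * real n + 1)" by (intro integrable_unit_continuous continuous_intros)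
  qed (use meas \<phi>_int in auto)
  then have "\<forall>\<^sub>F k in sequentially. (\<integral>x. norm (?P n (f x) - \<phi> k x) \<partial>unit_leb) < \<epsilon> / 2"
    using \<open>\<epsilon> > 0\<close> by (intro order_tendstoD) auto
  then obtain k where k: "(\<integral>x. norm (?P n (f x) - \<phi> k x) \<partial>unit_leb) < \<epsilon> / 2"
    by (auto dest: eventually_happens)
  have "(\<integral>x. norm (f x - \<phi> k x) \<partial>unit_leb)
      \<le> (\<integral>x. norm (f x - ?P n (f x)) + norm (?P n (f x) - \<phi> k x) \<partial>unit_leb)"
  proof (rule integral_mono)
    show "norm (f x - \<phi> k x) \<le> norm (f x - ?P n (f x)) + norm (?P n (f x) - \<phi> k x)" for x
      using norm_triangle_ineq[of "f x - ?P n (f x)" "?P n (f x) - \<phi> k x"] by simp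
  qed (use f P_int \<phi>_int in auto)
  also have "\<dots> = (\<integral>x. norm (f x - ?P n (f x)) \<partial>unit_leb) + (\<integral>x. norm (?P n (f x) - \<phi> k x) \<partial>unit_leb)"
    using f P_int \<phi>_int by (intro Bochner_Integration.integral_add) auto
  finally show ?thesis using n k that[OF \<phi>[of k]] by simp
qed

section \<open>Weak derivatives\<close>

lemma integrable_scaleR_continuous:
  fixes g :: "real \<Rightarrow> 'b::euclidean_space"
  assumes h: "continuous_on {0..1} h" and g: "integrable unit_leb g"
  shows "integrable unit_leb (\<lambda>x. h x *\<^sub>R g x)"
proof -
  have "bounded (h ` {0..1})"
    by (intro compact_imp_bounded compact_continuous_image h) simp
  then obtain B where B: "\<And>x. x \<in> {0..1} \<Longrightarrow> \<bar>h x\<bar> \<le> B" unfolding bounded_iff by fastforce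
  show ?thesis
  proof (rule Bochner_Integration.integrable_bound)
    show "integrable unit_leb (\<lambda>x. B *\<^sub>R norm (g x))" using g by auto
    show "(\<lambda>x. h x *\<^sub>R g x) \<in> borel_measurable unit_leb"
      using borel_measurable_integrable[OF g] measurable_unit_continuous[OF h] by (rule borel_measurable_scaleR[rotated])
    show "AE x in unit_leb. norm (h x *\<^sub>R g x) \<le> norm (B *\<^sub>R norm (g x))"
    proof (rule AE_I2)
      fix x assume "x \<in> space unit_leb"
      then have "\<bar>h x\<bar> \<le> \<bar>B\<bar>" using B[of x] by simp
      then show "norm (h x *\<^sub>R g x) \<le> norm (B *\<^sub>R norm (g x))"
        by (simp add: abs_mult mult_right_mono)
    qed
  qed
qed

text \<open>Approximate \<open>sgn g\<close> by test functions \<open>\<phi>\<^sub>n\<close>, so that \<open>0 = \<integral> \<phi>\<^sub>n \<bullet> g \<longlonglongrightarrow> \<integral> norm g\<close>.\<close>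

lemma AE_zero_if_test_integrals_zero:
  fixes g :: "real \<Rightarrow> 'b::euclidean_space"
  assumes g: "integrable unit_leb g"
    and zero: "\<And>\<phi> \<phi>'. test_function \<phi> \<phi>' \<Longrightarrow> (\<integral>x. \<phi> x *\<^sub>R g x \<partial>unit_leb) = 0"
  shows "AE x in unit_leb. g x = 0"
proof -
  have g_meas: "g \<in> borel_measurable unit_leb" using g by auto
  have sgn_meas: "(\<lambda>x. sgn (g x)) \<in> borel_measurable unit_leb"
    unfolding sgn_div_norm using g_meas by simp
  obtain \<phi> \<phi>' where \<phi>: "\<And>k. vector_test_function (\<phi> k) (\<phi>' k)"
    and bound: "\<And>k x. x \<in> {0..1} \<Longrightarrow> norm (\<phi> k x) \<le> 1 + 1"
    and lim: "AE x in unit_leb. (\<lambda>k. \<phi> k x) \<longlonglongrightarrow> sgn (g x)"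
    by (rule bounded_measurable_approx_test_function[OF sgn_meas, of 1]) (simp add: norm_sgn, blast)
  have \<phi>_cont: "continuous_on {0..1} (\<phi> k)" for k
    using \<phi> by (rule continuous_on_vector_test_function)
  \<comment> \<open>The hypothesis speaks of real test functions only. Each coordinate \<phi> k x
    \<bullet> b is one, and the inner product with g is the sum of the b-coordinates of the vectors
    obtained by scaling g with them.\<close>
  have zero': "(\<integral>x. \<phi> k x \<bullet> g x \<partial>unit_leb) = 0" for k
  proof -
    have int: "integrable unit_leb (\<lambda>x. (\<phi> k x \<bullet> b) *\<^sub>R g x)" for b
      by (intro integrable_scaleR_continuous continuous_intros \<phi>_cont g)
    have comp: "test_function (\<lambda>x. \<phi> k x \<bullet> b) (\<lambda>x. \<phi>' k x \<bullet> b)" for b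
      using \<phi>[of k] unfolding test_function_iff_vector_test_function vector_test_function_def
      by (auto intro!: bounded_linear.has_vector_derivative[OF bounded_linear_inner_left] continuous_intros)
    have "(\<integral>x. \<phi> k x \<bullet> g x \<partial>unit_leb) = (\<integral>x. (\<Sum>b\<in>Basis. ((\<phi> k x \<bullet> b) *\<^sub>R g x) \<bullet> b) \<partial>unit_leb)"
      by (subst euclidean_inner) simp
    also have "\<dots> = (\<Sum>b\<in>Basis. \<integral>x. ((\<phi> k x \<bullet> b) *\<^sub>R g x) \<bullet> b \<partial>unit_leb)"
      using int by (intro Bochner_Integration.integral_sum integrable_inner_left)
    also have "\<dots> = 0"
    proof (rule sum.neutral, rule ballI)
      fix b :: 'b
      show "(\<integral>x. ((\<phi> k x \<bullet> b) *\<^sub>R g x) \<bullet> b \<partial>unit_leb) = 0"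
        using zero[OF comp] by (subst integral_inner_left) (auto intro: int)
    qed
    finally show ?thesis .
  qed
  have "(\<lambda>k. \<integral>x. \<phi> k x \<bullet> g x \<partial>unit_leb) \<longlonglongrightarrow> (\<integral>x. sgn (g x) \<bullet> g x \<partial>unit_leb)"
  proof (rule integral_dominated_convergence[where w = "\<lambda>x. 2 * norm (g x)"])
    show "AE x in unit_leb. (\<lambda>k. \<phi> k x \<bullet> g x) \<longlonglongrightarrow> sgn (g x) \<bullet> g x"
      using lim by eventually_elim (intro tendsto_intros)
    show "AE x in unit_leb. norm (\<phi> k x \<bullet> g x) \<le> 2 * norm (g x)" for k
    proof (rule AE_I2)
      fix x assume "x \<in> space unit_leb"
      then have "norm (\<phi> k x) * norm (g x) \<le> 2 * norm (g x)"
        using bound[of x k] by (intro mult_right_mono) auto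
      then show "norm (\<phi> k x \<bullet> g x) \<le> 2 * norm (g x)"
        using Cauchy_Schwarz_ineq2[of "\<phi> k x" "g x"] by simp
    qed
    show "(\<lambda>x. \<phi> k x \<bullet> g x) \<in> borel_measurable unit_leb" for k
      using g_meas measurable_unit_continuous[OF \<phi>_cont] by simp
  qed (use g g_meas sgn_meas in auto)
  then have "(\<integral>x. sgn (g x) \<bullet> g x \<partial>unit_leb) = 0"
    unfolding zero' by (simp add: LIMSEQ_const_iff)
  moreover have "sgn z \<bullet> z = norm z" for z :: 'b
    by (cases "z = 0") (simp_all add: sgn_div_norm dot_square_norm power2_eq_square)
  ultimately have "(\<integral>x. norm (g x) \<partial>unit_leb) = 0" by simp
  then have "AE x in unit_leb. norm (g x) = 0"
    using g by (subst (asm) integral_nonneg_eq_0_iff_AE) auto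
  then show ?thesis by simp
qed

lemma has_weak_derivative_unique:
  assumes "has_weak_derivative u g" "has_weak_derivative u h"
  shows "g = h"
proof -
  obtain v where v: "integrable unit_leb v" "u = abs_L1 v" by (rule L1_cases)
  obtain g' where g: "integrable unit_leb g'" "g = abs_L1 g'" by (rule L1_cases)
  obtain h' where h: "integrable unit_leb h'" "h = abs_L1 h'" by (rule L1_cases)
  have "AE x in unit_leb. g' x - h' x = 0"
  proof (rule AE_zero_if_test_integrals_zero)
    show "integrable unit_leb (\<lambda>x. g' x - h' x)" using g h by auto
    fix \<phi> \<phi>' assume \<phi>: "test_function \<phi> \<phi>'"
    then have "continuous_on {0..1} \<phi>"
      unfolding test_function_iff_vector_test_function by (rule continuous_on_vector_test_function)
    then have "integrable unit_leb (\<lambda>x. \<phi> x *\<^sub>R g' x)" "integrable unit_leb (\<lambda>x. \<phi> x *\<^sub>R h' x)"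
      using g h by (auto intro: integrable_scaleR_continuous)
    moreover have "(\<integral>x. \<phi> x *\<^sub>R g' x \<partial>unit_leb) = (\<integral>x. \<phi> x *\<^sub>R h' x \<partial>unit_leb)"
      using assms \<phi> v g h by (auto simp: has_weak_derivative_abs_L1)
    ultimately show "(\<integral>x. \<phi> x *\<^sub>R (g' x - h' x) \<partial>unit_leb) = 0"
      by (simp add: scaleR_diff_right)
  qed
  then show ?thesis using g h by (simp add: abs_L1_eq_iff)
qed

lemma weak_derivative_eqI: "has_weak_derivative u g \<Longrightarrow> weak_derivative u = g"
  unfolding weak_derivative_def by (rule the_equality) (auto dest: has_weak_derivative_unique)

text \<open>The kernels are nonnegative, vanish outside \<open>{a..a + \<eta> n}\<close> and have
  mass one, since the step completes its rise within the unit interval: an approximate identity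
  acting from the right of a.\<close>

lemma tendsto_integral_smooth_step_deriv:
  fixes v :: "real \<Rightarrow> 'b::euclidean_space"
  assumes v: "continuous_on {0..1} v" and a: "0 \<le> a" "a < 1"
    and \<eta>: "\<And>n. 0 < \<eta> n" "\<And>n. a + \<eta> n \<le> 1" and \<eta>_lim: "\<eta> \<longlonglongrightarrow> 0"
  shows "(\<lambda>n. \<integral>x. (smooth_step_deriv ((x - a) / \<eta> n) / \<eta> n) *\<^sub>R v x \<partial>unit_leb) \<longlonglongrightarrow> v a"
proof (rule tendstoI)
  fix e :: real assume "e > 0"
  with v a obtain d where "d > 0" and d: "\<And>x. x \<in> {0..1} \<Longrightarrow> dist x a < d \<Longrightarrow> dist (v x) (v a) < e / 2"
    unfolding continuous_on_iff by (drule_tac bspec[of _ _ a], simp, drule_tac spec[of _ "e / 2"]) auto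
  define k where "k n x = smooth_step_deriv ((x - a) / \<eta> n) / \<eta> n" for n x
  have k_cont: "continuous_on S (k n)" for n S
    unfolding k_def using \<eta>(1)[of n] by (intro continuous_intros) auto
  have k_nonneg: "0 \<le> k n x" for n x
    unfolding k_def using \<eta>(1)[of n] by (simp add: smooth_step_deriv_nonneg)
  have k_int: "(\<integral>x. k n x \<partial>unit_leb) = 1" for n
  proof -
    have "(k n has_integral (smooth_step ((1 - a) / \<eta> n) - smooth_step ((0 - a) / \<eta> n))) {0..1}"
    proof (rule fundamental_theorem_of_calculus)
      show "((\<lambda>x. smooth_step ((x - a) / \<eta> n)) has_vector_derivative k n x) (at x within {0..1})" for x
        unfolding has_real_derivative_iff_has_vector_derivative[symmetric]
        by (rule DERIV_subset[of _ _ _ UNIV]) (use \<eta>(1)[of n] in \<open>auto intro!: derivative_eq_intros simp: k_def\<close>)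
    qed simp
    moreover have "(1 - a) / \<eta> n \<ge> 1" "(0 - a) / \<eta> n \<le> 0"
      using \<eta>[of n] a by (auto simp: field_simps)
    ultimately have "(k n has_integral 1) {0..1}" by (simp add: smooth_step_0 smooth_step_1)
    then show ?thesis
      by (simp add: integral_unit_leb integrable_unit_continuous k_cont integral_unique)
  qed
  have "\<forall>\<^sub>F n in sequentially. \<eta> n < d"
    using \<eta>_lim \<open>d > 0\<close> by (rule order_tendstoD)
  then show "\<forall>\<^sub>F n in sequentially.
      dist (\<integral>x. (smooth_step_deriv ((x - a) / \<eta> n) / \<eta> n) *\<^sub>R v x \<partial>unit_leb) (v a) < e"
    unfolding k_def[symmetric]
  proof eventually_elim
    case (elim n)
    have int: "integrable unit_leb (k n)" "integrable unit_leb (\<lambda>x. k n x *\<^sub>R v x)"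
      "integrable unit_leb (\<lambda>x. k n x *\<^sub>R v a)"
      by (intro integrable_unit_continuous continuous_intros k_cont v)+
    have "(\<integral>x. k n x *\<^sub>R v x \<partial>unit_leb) - v a = (\<integral>x. k n x *\<^sub>R v x - k n x *\<^sub>R v a \<partial>unit_leb)"
      using int by (subst Bochner_Integration.integral_diff) (auto simp: k_int)
    also have "norm \<dots> \<le> (\<integral>x. norm (k n x *\<^sub>R v x - k n x *\<^sub>R v a) \<partial>unit_leb)"
      by (rule integral_norm_bound)
    also have "\<dots> \<le> (\<integral>x. k n x * (e / 2) \<partial>unit_leb)"
    proof (rule integral_mono)
      fix x assume "x \<in> space unit_leb"
      then have x: "x \<in> {0..1}" by simp
      show "norm (k n x *\<^sub>R v x - k n x *\<^sub>R v a) \<le> k n x * (e / 2)"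
      proof (cases "k n x = 0")
        case False
        then have "0 < (x - a) / \<eta> n" "(x - a) / \<eta> n < 1"
          using smooth_step_deriv_0[of "(x - a) / \<eta> n"] unfolding k_def by fastforce+
        then have "dist x a < d" using \<eta>(1)[of n] elim by (auto simp: field_simps dist_real_def)
        from d[OF x this] have "norm (v x - v a) \<le> e / 2" by (simp add: dist_norm)
        then have "k n x * norm (v x - v a) \<le> k n x * (e / 2)" by (intro mult_left_mono k_nonneg)
        then show ?thesis using k_nonneg by (simp flip: scaleR_diff_right)
      qed simp
    qed (use int in auto)
    also have "\<dots> = e / 2" using int by (simp add: k_int)
    finally show ?case using \<open>e > 0\<close> by (simp add: dist_norm)
  qed
qed

text \<open>Testing with cutoffs of \<open>{a..b}\<close> whose ramps shrink turns the left side
  into v a - v b and the right side into minus the integral of g from a to b. This reaches only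
  interior points; continuity of v and of the indefinite integral carries the identity to the end
  points.\<close>

lemma weak_fundamental_theorem_of_calculus:
  fixes v g :: "real \<Rightarrow> 'b::euclidean_space"
  assumes v: "continuous_on {0..1} v" and g: "integrable unit_leb g"
    and weak: "\<And>\<phi> \<phi>'. test_function \<phi> \<phi>' \<Longrightarrow>
      (\<integral>x. \<phi>' x *\<^sub>R v x \<partial>unit_leb) = - (\<integral>x. \<phi> x *\<^sub>R g x \<partial>unit_leb)"
    and x: "x \<in> {0..1}"
  shows "v x = v 0 + integral {0..x} g"
proof -
  have g_on: "g integrable_on {0..1}" using g by (rule integrable_on_lebesgue_on) simp
  have inner: "v b - v a = integral {a..b} g" if ab: "0 < a" "a \<le> b" "b < 1" for a b
  proof -
    \<comment> \<open>The second factor is strictly below 1, so the falling ramp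
      \<open>{b..b + \<eta> n}\<close> stays inside the open unit interval.\<close>
    define \<eta> where "\<eta> n = (1 - b) * inverse (real (n + 2))" for n
    have inv: "0 < inverse (real (n + 2))" "inverse (real (n + 2)) < 1" for n
      by (auto simp: field_simps)
    have \<eta>: "0 < \<eta> n" "b + \<eta> n < 1" "a + \<eta> n < 1" for n
    proof -
      have "0 < \<eta> n" "\<eta> n < 1 - b"
        using mult_strict_left_mono[OF inv(2)[of n], of "1 - b"] mult_pos_pos[OF _ inv(1)[of n], of "1 - b"] ab
        unfolding \<eta>_def by simp_all
      then show "0 < \<eta> n" "b + \<eta> n < 1" "a + \<eta> n < 1" using ab by simp_all
    qed
    have "\<eta> \<longlonglongrightarrow> (1 - b) * 0"
      unfolding \<eta>_def using LIMSEQ_ignore_initial_segment[OF lim_inverse_n, of 2] by (intro tendsto_intros) simp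
    then have \<eta>_lim: "\<eta> \<longlonglongrightarrow> 0" by simp
    define \<phi> where "\<phi> n x = smooth_step ((x - a) / \<eta> n) - smooth_step ((x - b) / \<eta> n)" for n x
    define \<phi>' where "\<phi>' n x = smooth_step_deriv ((x - a) / \<eta> n) / \<eta> n
        - smooth_step_deriv ((x - b) / \<eta> n) / \<eta> n" for n x
    have \<phi>: "test_function (\<phi> n) (\<phi>' n)" for n
      unfolding \<phi>_def[abs_def] \<phi>'_def[abs_def] using \<eta>[of n] ab by (intro test_function_cutoff) auto
    have \<phi>_cont: "continuous_on S (\<phi> n)" for n S
      using \<phi>[of n] unfolding test_function_iff_vector_test_function
      by (rule continuous_on_vector_test_function)
    have \<phi>_bound: "\<bar>\<phi> n x\<bar> \<le> 1" for n x
      using smooth_step_nonneg[of "(x - a) / \<eta> n"] smooth_step_le_1[of "(x - a) / \<eta> n"]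
        smooth_step_nonneg[of "(x - b) / \<eta> n"] smooth_step_le_1[of "(x - b) / \<eta> n"]
      by (auto simp: \<phi>_def)
    \<comment> \<open>At x = r every term is \<open>smooth_step 0 = 0\<close>; this is why the
      limits are indicators of intervals open on the left.\<close>
    have step_lim: "(\<lambda>n. smooth_step ((x - r) / \<eta> n)) \<longlonglongrightarrow> indicator {r<..} x" for x r
    proof (cases "r < x")
      case True
      then have "\<forall>\<^sub>F n in sequentially. \<eta> n < x - r" by (intro order_tendstoD[OF \<eta>_lim]) simp
      then have "\<forall>\<^sub>F n in sequentially. smooth_step ((x - r) / \<eta> n) = 1"
        by eventually_elim (rule smooth_step_1, use \<eta>(1) in \<open>simp add: field_simps\<close>)
      then show ?thesis using True by (auto intro: tendsto_eventually)
    next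
      case False
      then have "smooth_step ((x - r) / \<eta> n) = 0" for n
        using \<eta>(1)[of n] by (intro smooth_step_0) (simp add: divide_nonpos_pos)
      then show ?thesis using False by simp
    qed
    have lim1: "(\<lambda>n. \<integral>x. \<phi> n x *\<^sub>R g x \<partial>unit_leb) \<longlonglongrightarrow> (\<integral>x. indicator {a<..b} x *\<^sub>R g x \<partial>unit_leb)"
    proof (rule integral_dominated_convergence[where w = "\<lambda>x. norm (g x)"])
      show "AE x in unit_leb. (\<lambda>n. \<phi> n x *\<^sub>R g x) \<longlonglongrightarrow> indicator {a<..b} x *\<^sub>R g x"
      proof (rule AE_I2)
        fix x
        have "(\<lambda>n. \<phi> n x) \<longlonglongrightarrow> indicator {a<..} x - indicator {b<..} x"
          unfolding \<phi>_def by (intro tendsto_diff step_lim)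
        also have "indicator {a<..} x - indicator {b<..} x = (indicator {a<..b} x :: real)"
          using ab by (auto simp: indicator_def)
        finally show "(\<lambda>n. \<phi> n x *\<^sub>R g x) \<longlonglongrightarrow> indicator {a<..b} x *\<^sub>R g x" by (intro tendsto_intros)
      qed
      show "AE x in unit_leb. norm (\<phi> n x *\<^sub>R g x) \<le> norm (g x)" for n
        using mult_right_mono[OF \<phi>_bound] by (auto intro!: AE_I2 dest: spec simp: mult_left_le_one_le \<phi>_bound)
      show "(\<lambda>x. \<phi> n x *\<^sub>R g x) \<in> borel_measurable unit_leb" for n
        using g measurable_unit_continuous[OF \<phi>_cont] by auto
      have "(indicator {a<..b} :: real \<Rightarrow> real) \<in> borel_measurable unit_leb"
        by (intro borel_measurable_indicator) (use ab in \<open>auto simp: sets_restrict_space image_iff intro!: bexI[of _ "{a<..b}"]\<close>)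
      then show "(\<lambda>x. indicator {a<..b} x *\<^sub>R g x) \<in> borel_measurable unit_leb"
        using g by auto
    qed (use g in auto)
    have "(\<integral>x. indicator {a<..b} x *\<^sub>R g x \<partial>unit_leb) = integral {0..1} (\<lambda>x. indicator {a<..b} x *\<^sub>R g x)"
    proof (rule integral_unit_leb)
      have "(indicator {a<..b} :: real \<Rightarrow> real) \<in> borel_measurable unit_leb"
        by (intro borel_measurable_indicator) (use ab in \<open>auto simp: sets_restrict_space image_iff intro!: bexI[of _ "{a<..b}"]\<close>)
      then have "(\<lambda>x. indicator {a<..b} x *\<^sub>R g x) \<in> borel_measurable unit_leb"
        using g by auto
      then show "integrable unit_leb (\<lambda>x. indicator {a<..b} x *\<^sub>R g x)"
        by (rule Bochner_Integration.integrable_bound[OF g]) (auto simp: indicator_def)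
    qed
    also have "\<dots> = integral {0..1} (\<lambda>x. if x \<in> {a<..b} then g x else 0)"
      by (rule integral_cong) (simp add: indicator_def)
    also have "\<dots> = integral ({a<..b} \<inter> {0..1}) g" by (rule integral_restrict_Int)
    also have "{a<..b} \<inter> {0..1} = {a<..b}" using ab by auto
    also have "integral {a<..b} g = integral {a..b} g"
      by (rule integral_spike_set; rule negligible_subset[of "{a}"]; auto)
    finally have eq: "(\<integral>x. indicator {a<..b} x *\<^sub>R g x \<partial>unit_leb) = integral {a..b} g" .
    have split: "(\<integral>x. \<phi>' n x *\<^sub>R v x \<partial>unit_leb)
       = (\<integral>x. (smooth_step_deriv ((x - a) / \<eta> n) / \<eta> n) *\<^sub>R v x \<partial>unit_leb)
         - (\<integral>x. (smooth_step_deriv ((x - b) / \<eta> n) / \<eta> n) *\<^sub>R v x \<partial>unit_leb)" for n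
      unfolding \<phi>'_def scaleR_diff_left using \<eta>(1)[of n]
      by (intro Bochner_Integration.integral_diff integrable_unit_continuous continuous_intros v) auto
    have "(\<lambda>n. \<integral>x. \<phi>' n x *\<^sub>R v x \<partial>unit_leb) \<longlonglongrightarrow> v a - v b"
      unfolding split using ab \<eta> \<eta>_lim
      by (intro tendsto_diff tendsto_integral_smooth_step_deriv v) (auto intro: less_imp_le)
    moreover have "(\<lambda>n. \<integral>x. \<phi>' n x *\<^sub>R v x \<partial>unit_leb) \<longlonglongrightarrow> - integral {a..b} g"
      unfolding weak[OF \<phi>] eq[symmetric] by (intro tendsto_minus lim1)
    ultimately have "v a - v b = - integral {a..b} g" by (rule LIMSEQ_unique)
    then show ?thesis by (simp add: algebra_simps)
  qed
  \<comment> \<open>The interior identity says that V is constant on the open interval; being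
    continuous, it is constant on the closed one.\<close>
  define V where "V x = v x - integral {0..x} g" for x
  have V_cont: "continuous_on (closure {0<..<1}) V"
    unfolding V_def using v indefinite_integral_continuous_1[OF g_on]
    by (auto intro!: continuous_intros)
  have V_const: "V y = V (1/2)" if "y \<in> {0<..<1}" for y
  proof -
    have *: "V b = V a" if "0 < a" "a \<le> b" "b < 1" for a b
    proof -
      have "integral {0..a} g + integral {a..b} g = integral {0..b} g"
        using that by (intro Henstock_Kurzweil_Integration.integral_combine integrable_on_subinterval[OF g_on]) auto
      then show ?thesis using inner[OF that] by (simp add: V_def algebra_simps)
    qed
    show ?thesis
      using *[of y "1/2"] *[of "1/2" y] that by (cases "y \<le> 1/2") auto
  qed
  have "V y = V (1/2)" if "y \<in> {0..1}" for y
    by (rule continuous_constant_on_closure[OF V_cont V_const]) (use that in auto)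
  from this[OF x] this[of 0] have "V x = V 0" by simp
  then show ?thesis by (simp add: V_def algebra_simps)
qed

text \<open>Integration by parts; the boundary terms vanish because the support of a test function
  avoids 0 and 1.\<close>

lemma has_weak_derivative_C1:
  fixes v v' :: "real \<Rightarrow> complex^'e::finite"
  assumes v: "\<And>x. (v has_vector_derivative v' x) (at x)" and v': "continuous_on UNIV v'"
  shows "has_weak_derivative (abs_L1 v) (abs_L1 v')"
proof -
  have cont: "continuous_on S v" "continuous_on S v'" for S
    using v continuous_on_subset[OF v', of S]
    by (auto intro!: continuous_at_imp_continuous_on has_vector_derivative_continuous)
  then have int: "integrable unit_leb v" "integrable unit_leb v'"
    by (auto intro: integrable_unit_continuous)
  have "(\<integral>x. \<phi>' x *\<^sub>R v x \<partial>unit_leb) = - (\<integral>x. \<phi> x *\<^sub>R v' x \<partial>unit_leb)" if \<phi>: "test_function \<phi> \<phi>'" for \<phi> \<phi>'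
  proof -
    obtain K where K: "compact K" "K \<subseteq> {0<..<1}" "\<And>x. x \<notin> K \<Longrightarrow> \<phi> x = 0"
      using \<phi> by (auto simp: test_function_def)
    then have ends: "\<phi> 0 = 0" "\<phi> 1 = 0" by (meson greaterThanLessThan_iff less_irrefl subsetD)+
    have \<phi>_cont: "continuous_on {0..1} \<phi>" "continuous_on {0..1} \<phi>'"
      using \<phi> continuous_on_vector_test_function[of \<phi> \<phi>' "{0..1}"]
      by (auto simp: test_function_iff_vector_test_function vector_test_function_def intro: continuous_on_subset)
    have int2: "integrable unit_leb (\<lambda>x. \<phi> x *\<^sub>R v' x)" "integrable unit_leb (\<lambda>x. \<phi>' x *\<^sub>R v x)"
      using \<phi>_cont int by (auto intro: integrable_scaleR_continuous)
    have "((\<lambda>x. \<phi> x *\<^sub>R v' x + \<phi>' x *\<^sub>R v x) has_integral (\<phi> 1 *\<^sub>R v 1 - \<phi> 0 *\<^sub>R v 0)) {0..1}"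
      by (rule fundamental_theorem_of_calculus)
         (use \<phi> v in \<open>auto simp: test_function_def intro!: has_vector_derivative_scaleR
            intro: has_vector_derivative_at_within DERIV_subset\<close>)
    then have "(\<integral>x. \<phi> x *\<^sub>R v' x + \<phi>' x *\<^sub>R v x \<partial>unit_leb) = 0"
      using int2 ends by (subst integral_unit_leb) (auto intro: integral_unique)
    then show ?thesis using int2 by (simp add: eq_neg_iff_add_eq_0 add.commute)
  qed
  then show ?thesis using int by (simp add: has_weak_derivative_abs_L1)
qed

section \<open>Dissipativity of the transport operator\<close>

text \<open>Differentiate the regularised norm \<open>sqrt (v \<bullet> v + \<epsilon>\<^sup>2)\<close>.\<close>

lemma integral_norm_dissipative_C1:
  fixes v v' :: "real \<Rightarrow> 'b::euclidean_space"
  assumes v: "\<And>x. x \<in> {0..1} \<Longrightarrow> (v has_vector_derivative v' x) (at x within {0..1})"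
    and v': "continuous_on {0..1} v'" and "\<kappa> \<ge> 0"
  shows "(\<integral>x. norm (v x) \<partial>unit_leb) + \<kappa> * (norm (v 0) - norm (v 1))
    \<le> (\<integral>x. norm (v x - \<kappa> *\<^sub>R v' x) \<partial>unit_leb)"
proof -
  have v_cont: "continuous_on {0..1} v"
    unfolding continuous_on_eq_continuous_within by (blast intro: v has_vector_derivative_continuous)
  define p where "p x = v x - \<kappa> *\<^sub>R v' x" for x
  have p_cont: "continuous_on {0..1} p"
    unfolding p_def by (intro continuous_intros v_cont v')
  \<comment> \<open>One \<epsilon> is lost in the pointwise estimate below, and \<kappa> *
    \<epsilon> in replacing the regularised norm at 1 by the norm.\<close>
  have main: "(\<integral>x. norm (v x) \<partial>unit_leb) + \<kappa> * (norm (v 0) - norm (v 1))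
      \<le> (\<integral>x. norm (p x) \<partial>unit_leb) + (1 + \<kappa>) * \<epsilon>" if "\<epsilon> > 0" for \<epsilon>
  proof -
    define E where "E x = sqrt (v x \<bullet> v x + \<epsilon>\<^sup>2)" for x
    have pos: "v x \<bullet> v x + \<epsilon>\<^sup>2 > 0" for x
      using \<open>\<epsilon> > 0\<close> by (intro add_nonneg_pos) auto
    have E_sq: "E x * E x = v x \<bullet> v x + \<epsilon>\<^sup>2" for x
      using pos[of x] by (simp add: E_def)
    have E_ge: "E x \<ge> \<epsilon>" "E x \<ge> norm (v x)" for x
      unfolding E_def by (rule real_le_rsqrt; simp add: dot_square_norm)+
    have E_le: "E x \<le> norm (v x) + \<epsilon>" for x
      unfolding E_def using \<open>\<epsilon> > 0\<close>
      by (intro real_le_lsqrt) (auto simp: dot_square_norm power2_sum)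
    have dE: "((\<lambda>x. \<kappa> * E x) has_vector_derivative \<kappa> * ((v x \<bullet> v' x) / E x)) (at x within {0..1})"
      if "x \<in> {0..1}" for x
    proof -
      have "((\<lambda>x. v x \<bullet> v x + \<epsilon>\<^sup>2) has_real_derivative 2 * (v x \<bullet> v' x)) (at x within {0..1})"
      proof -
        have "((\<lambda>x. v x \<bullet> v x + \<epsilon>\<^sup>2) has_derivative
            (\<lambda>h. (v x \<bullet> (h *\<^sub>R v' x) + (h *\<^sub>R v' x) \<bullet> v x) + 0)) (at x within {0..1})"
          using v[OF that] unfolding has_vector_derivative_def
          by (intro has_derivative_add has_derivative_inner has_derivative_const)
        also have "(\<lambda>h. (v x \<bullet> (h *\<^sub>R v' x) + (h *\<^sub>R v' x) \<bullet> v x) + 0) = (*) (2 * (v x \<bullet> v' x))"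
          by (simp add: fun_eq_iff inner_commute)
        finally show ?thesis unfolding has_field_derivative_def .
      qed
      from DERIV_chain2[OF DERIV_real_sqrt[OF pos] this]
      have "(E has_real_derivative ((v x \<bullet> v' x) / E x)) (at x within {0..1})"
        by (simp add: E_def[abs_def] divide_simps)
      then show ?thesis
        unfolding has_real_derivative_iff_has_vector_derivative[symmetric] by (rule DERIV_cmult)
    qed
    have int: "((\<lambda>x. \<kappa> * ((v x \<bullet> v' x) / E x)) has_integral (\<kappa> * E 1 - \<kappa> * E 0)) {0..1}"
      by (rule fundamental_theorem_of_calculus[OF _ dE]) auto
    \<comment> \<open>Cauchy-Schwarz bounds v x \<bullet> p x by \<open>E x * norm (p x)\<close>,
      while v x \<bullet> v x is the square of E x minus that of \<epsilon>. Dividing by E x leaves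
      the square of \<epsilon> over E x, which is at most \<epsilon> because E x \<ge>
      \<epsilon>.\<close>
    have ptw: "norm (v x) - norm (p x) - \<epsilon> \<le> \<kappa> * ((v x \<bullet> v' x) / E x)" for x
    proof -
      have "(v x \<bullet> p x) \<le> norm (v x) * norm (p x)" by (rule norm_cauchy_schwarz)
      also have "\<dots> \<le> E x * norm (p x)" by (intro mult_right_mono E_ge) simp
      finally have "v x \<bullet> p x \<le> E x * norm (p x)" .
      moreover have "v x \<bullet> p x = v x \<bullet> v x - \<kappa> * (v x \<bullet> v' x)"
        by (simp add: p_def inner_diff_right)
      moreover have "\<epsilon>\<^sup>2 \<le> E x * \<epsilon>"
        using E_ge(1)[of x] \<open>\<epsilon> > 0\<close> by (simp add: power2_eq_square mult_right_mono)
      ultimately have "E x * (E x - norm (p x) - \<epsilon>) \<le> \<kappa> * (v x \<bullet> v' x)"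
        using E_sq[of x] by (simp add: algebra_simps)
      moreover have "E x > 0" using E_ge(1)[of x] \<open>\<epsilon> > 0\<close> by simp
      ultimately have "E x - norm (p x) - \<epsilon> \<le> \<kappa> * (v x \<bullet> v' x) / E x"
        by (simp add: field_simps)
      then show ?thesis using E_ge(2)[of x] by simp
    qed
    have i: "integrable unit_leb (\<lambda>x. norm (v x) - norm (p x) - \<epsilon>)"
      by (intro integrable_unit_continuous continuous_intros v_cont p_cont)
    have "(\<integral>x. norm (v x) - norm (p x) - \<epsilon> \<partial>unit_leb) \<le> \<kappa> * E 1 - \<kappa> * E 0"
      by (rule has_integral_le[OF has_integral_unit_leb[OF i] int]) (rule ptw)
    also have "\<kappa> * E 1 - \<kappa> * E 0 \<le> \<kappa> * (norm (v 1) + \<epsilon>) - \<kappa> * norm (v 0)"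
      by (intro diff_mono mult_left_mono E_le E_ge \<open>\<kappa> \<ge> 0\<close>)
    also have "(\<integral>x. norm (v x) - norm (p x) - \<epsilon> \<partial>unit_leb)
       = (\<integral>x. norm (v x) \<partial>unit_leb) - (\<integral>x. norm (p x) \<partial>unit_leb) - \<epsilon>"
    proof -
      have "integrable unit_leb v" "integrable unit_leb p" "integrable unit_leb (\<lambda>_. \<epsilon>)"
        using v_cont p_cont by (auto intro: integrable_unit_continuous)
      moreover have "measure unit_leb {0..1} = 1" by (simp add: measure_restrict_space)
      ultimately show ?thesis by simp
    qed
    finally show ?thesis by (simp add: algebra_simps)
  qed
  show ?thesis
    unfolding p_def[symmetric]
  proof (rule field_le_epsilon)
    fix e :: real assume "e > 0"
    then show "(\<integral>x. norm (v x) \<partial>unit_leb) + \<kappa> * (norm (v 0) - norm (v 1))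
      \<le> (\<integral>x. norm (p x) \<partial>unit_leb) + e"
      using main[of "e / (1 + \<kappa>)"] \<open>\<kappa> \<ge> 0\<close> by simp
  qed
qed

text \<open>Reduction to the differentiable case: replace g by a test function \<phi> that is close
  in the mean and v by the antiderivative q of \<phi> with the same value at 0. Then q is uniformly
  close to v, so every term of the inequality changes little.\<close>

lemma integral_norm_dissipative:
  fixes v g :: "real \<Rightarrow> 'b::euclidean_space"
  assumes v: "continuous_on {0..1} v" and g: "integrable unit_leb g"
    and ftc: "\<And>x. x \<in> {0..1} \<Longrightarrow> v x = v 0 + integral {0..x} g" and "\<kappa> \<ge> 0"
  shows "(\<integral>x. norm (v x) \<partial>unit_leb) + \<kappa> * (norm (v 0) - norm (v 1))
    \<le> (\<integral>x. norm (v x - \<kappa> *\<^sub>R g x) \<partial>unit_leb)"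
proof -
  \<comment> \<open>The error collects e from the integral of \<open>norm (v x)\<close>, \<kappa> *
    e from the value at 1, and e + \<kappa> * e from the integral on the right.\<close>
  have main: "(\<integral>x. norm (v x) \<partial>unit_leb) + \<kappa> * (norm (v 0) - norm (v 1))
    \<le> (\<integral>x. norm (v x - \<kappa> *\<^sub>R g x) \<partial>unit_leb) + (2 + 2 * \<kappa>) * e" if "e > 0" for e
  proof -
    obtain \<phi> \<phi>' where \<phi>: "vector_test_function \<phi> \<phi>'" and close: "(\<integral>x. norm (g x - \<phi> x) \<partial>unit_leb) < e"
      by (rule integrable_approx_test_function[OF g \<open>e > 0\<close>])
    have \<phi>_cont: "continuous_on S \<phi>" for S using \<phi> by (rule continuous_on_vector_test_function)
    then have \<phi>_int: "integrable unit_leb \<phi>" by (intro integrable_unit_continuous)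
    have gi: "g integrable_on {0..1}" using g by (rule integrable_on_lebesgue_on) simp
    have \<phi>i: "\<phi> integrable_on {0..1}" using \<phi>_int by (rule integrable_on_lebesgue_on) simp
    have di: "integrable unit_leb (\<lambda>x. norm (g x - \<phi> x))" using g \<phi>_int by auto
    then have di': "(\<lambda>x. norm (g x - \<phi> x)) integrable_on {0..1}" by (rule integrable_on_lebesgue_on) simp
    define q where "q x = v 0 + integral {0..x} \<phi>" for x
    have dq: "(q has_vector_derivative \<phi> x) (at x within {0..1})" if "x \<in> {0..1}" for x
      unfolding q_def using integral_has_vector_derivative[OF \<phi>_cont that]
      by (auto intro!: derivative_eq_intros)
    have q_cont: "continuous_on {0..1} q"
      unfolding continuous_on_eq_continuous_within by (blast intro: dq has_vector_derivative_continuous)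
    have vq: "norm (v x - q x) \<le> e" if x: "x \<in> {0..1}" for x
    proof -
      have sub: "g integrable_on {0..x}" "\<phi> integrable_on {0..x}" "(\<lambda>x. norm (g x - \<phi> x)) integrable_on {0..x}"
        using x gi \<phi>i di' by (auto intro: integrable_on_subinterval)
      have "v x - q x = integral {0..x} (\<lambda>x. g x - \<phi> x)"
        using sub by (simp add: ftc[OF x] q_def Henstock_Kurzweil_Integration.integral_diff)
      also have "norm \<dots> \<le> integral {0..x} (\<lambda>x. norm (g x - \<phi> x))"
        using sub by (intro Henstock_Kurzweil_Integration.integral_norm_bound_integral integrable_diff) auto
      also have "\<dots> \<le> integral {0..1} (\<lambda>x. norm (g x - \<phi> x))"
        using sub di' x by (intro integral_subset_le) auto
      finally show ?thesis using close integral_unit_leb[OF di] by simp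
    qed
    have int: "integrable unit_leb v" "integrable unit_leb q" "integrable unit_leb (\<lambda>x. v x - q x)"
      using v q_cont by (auto intro!: integrable_unit_continuous continuous_intros)
    have e_int: "integrable unit_leb (\<lambda>_. e)" by (auto intro!: integrable_unit_continuous)
    have meas: "measure unit_leb {0..1} = 1" by (simp add: measure_restrict_space)
    have "(\<integral>x. norm (v x) \<partial>unit_leb) \<le> (\<integral>x. norm (q x) + e \<partial>unit_leb)"
    proof (rule integral_mono)
      fix x assume "x \<in> space unit_leb"
      then show "norm (v x) \<le> norm (q x) + e"
        using vq[of x] norm_triangle_ineq[of "q x" "v x - q x"] by simp
    qed (use int e_int in auto)
    then have 1: "(\<integral>x. norm (v x) \<partial>unit_leb) \<le> (\<integral>x. norm (q x) \<partial>unit_leb) + e"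
      using int e_int by (simp add: meas)
    have "norm (q 1) \<le> norm (v 1) + e"
      using vq[of 1] norm_triangle_ineq4[of "v 1" "v 1 - q 1"] by simp
    then have 2: "\<kappa> * norm (q 1) \<le> \<kappa> * norm (v 1) + \<kappa> * e"
      using \<open>\<kappa> \<ge> 0\<close> mult_left_mono[of "norm (q 1)" "norm (v 1) + e" \<kappa>] by (simp add: algebra_simps)
    have "(\<integral>x. norm (q x - \<kappa> *\<^sub>R \<phi> x) \<partial>unit_leb)
      \<le> (\<integral>x. norm (v x - \<kappa> *\<^sub>R g x) + e + \<kappa> * norm (g x - \<phi> x) \<partial>unit_leb)"
    proof (rule integral_mono)
      fix x assume "x \<in> space unit_leb"
      then have x: "x \<in> {0..1}" by simp
      have "q x - \<kappa> *\<^sub>R \<phi> x = (v x - \<kappa> *\<^sub>R g x) - (v x - q x) + \<kappa> *\<^sub>R (g x - \<phi> x)"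
        by (simp add: algebra_simps)
      also have "norm \<dots> \<le> norm (v x - \<kappa> *\<^sub>R g x) + norm (v x - q x) + norm (\<kappa> *\<^sub>R (g x - \<phi> x))"
        using norm_triangle_ineq4[of "v x - \<kappa> *\<^sub>R g x" "v x - q x"]
          norm_triangle_ineq[of "(v x - \<kappa> *\<^sub>R g x) - (v x - q x)" "\<kappa> *\<^sub>R (g x - \<phi> x)"] by simp
      also have "\<dots> \<le> norm (v x - \<kappa> *\<^sub>R g x) + e + \<kappa> * norm (g x - \<phi> x)"
        using vq[OF x] \<open>\<kappa> \<ge> 0\<close> by simp
      finally show "norm (q x - \<kappa> *\<^sub>R \<phi> x) \<le> norm (v x - \<kappa> *\<^sub>R g x) + e + \<kappa> * norm (g x - \<phi> x)" .
    qed (use int g \<phi>_int di e_int in auto)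
    also have "\<dots> = (\<integral>x. norm (v x - \<kappa> *\<^sub>R g x) \<partial>unit_leb) + e + \<kappa> * (\<integral>x. norm (g x - \<phi> x) \<partial>unit_leb)"
    proof -
      have "integrable unit_leb (\<lambda>x. norm (v x - \<kappa> *\<^sub>R g x))" using int g by auto
      then show ?thesis using e_int di by (simp add: meas)
    qed
    also have "\<dots> \<le> (\<integral>x. norm (v x - \<kappa> *\<^sub>R g x) \<partial>unit_leb) + e + \<kappa> * e"
      using close \<open>\<kappa> \<ge> 0\<close> by (intro add_left_mono mult_left_mono) auto
    finally have 3: "(\<integral>x. norm (q x - \<kappa> *\<^sub>R \<phi> x) \<partial>unit_leb)
        \<le> (\<integral>x. norm (v x - \<kappa> *\<^sub>R g x) \<partial>unit_leb) + e + \<kappa> * e" .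
    have "(\<integral>x. norm (q x) \<partial>unit_leb) + \<kappa> * (norm (q 0) - norm (q 1))
      \<le> (\<integral>x. norm (q x - \<kappa> *\<^sub>R \<phi> x) \<partial>unit_leb)"
      by (rule integral_norm_dissipative_C1[OF dq \<phi>_cont \<open>\<kappa> \<ge> 0\<close>])
    moreover have "q 0 = v 0" by (simp add: q_def)
    ultimately show ?thesis using 1 2 3 by (simp add: algebra_simps)
  qed
  show ?thesis
  proof (rule field_le_epsilon)
    fix e :: real assume "e > 0"
    then show "(\<integral>x. norm (v x) \<partial>unit_leb) + \<kappa> * (norm (v 0) - norm (v 1))
      \<le> (\<integral>x. norm (v x - \<kappa> *\<^sub>R g x) \<partial>unit_leb) + e"
      using main[of "e / (2 + 2 * \<kappa>)"] \<open>\<kappa> \<ge> 0\<close> by simp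
  qed
qed

section \<open>Boundary conditions in flux form and the resulting dissipativity\<close>

text \<open>As \<open>matrix_inv\<close> is defined by choice, the diagonal matrix of reciprocals is
  first exhibited as a two-sided inverse and then identified with it.\<close>

lemma weighted_adjacency_nth:
  assumes pos: "\<And>j. c j t > 0"
  shows "weighted_adjacency G w c t $ i $ j = line_adjacency G w $ i $ j * c j t / c i t"
proof -
  let ?D = "velocity_matrix c t" and ?I = "(\<chi> i j. if i = j then inverse (c i t) else 0) :: real^'a^'a"
  have mult: "?D ** ?I = mat 1" "?I ** ?D = mat 1"
    using pos less_imp_neq[OF pos]
    by (auto simp: velocity_matrix_def matrix_matrix_mult_def mat_def vec_eq_iff if_distrib[of "\<lambda>x. x * _"]
        sum.delta cong: if_cong)
  have "matrix_inv ?D ** ?D = mat 1"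
    using someI_ex[of "\<lambda>A'. ?D ** A' = mat 1 \<and> A' ** ?D = mat 1"] mult unfolding matrix_inv_def by blast
  then have "?I = matrix_inv ?D ** ?D ** ?I" by simp
  also have "\<dots> = matrix_inv ?D" by (simp add: mult flip: matrix_mul_assoc)
  finally have inv: "matrix_inv ?D = ?I" ..
  have "(?I ** M) $ i $ j = inverse (c i t) * M $ i $ j" for M :: "real^'a^'a"
    by (simp add: matrix_matrix_mult_def if_distrib[of "\<lambda>x. x * _"] sum.delta cong: if_cong)
  moreover have "(M ** ?D) $ i $ j = M $ i $ j * c j t" for M :: "real^'a^'a"
    by (simp add: velocity_matrix_def matrix_matrix_mult_def if_distrib[of "\<lambda>x. _ * x"] sum.delta' cong: if_cong)
  ultimately show ?thesis
    by (simp add: weighted_adjacency_def inv divide_inverse mult_ac)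
qed

text \<open>Multiplying row i by \<open>c i t\<close> removes the inverse matrix: the fluxes
  entering at the tails are the fixed matrix \<open>line_adjacency G w\<close> applied to the fluxes
  leaving at the heads. All later arguments use the condition in this form.\<close>

lemma boundary_condition_iff:
  assumes pos: "\<And>j. c j t > 0"
  shows "u1 = map_matrix complex_of_real (weighted_adjacency G w c t) *v u0 \<longleftrightarrow>
    (\<forall>i. c i t *\<^sub>R u1 $ i = (\<Sum>j\<in>UNIV. line_adjacency G w $ i $ j *\<^sub>R c j t *\<^sub>R u0 $ j))"
proof -
  have "u1 $ i = (map_matrix complex_of_real (weighted_adjacency G w c t) *v u0) $ i \<longleftrightarrow>
      c i t *\<^sub>R u1 $ i = (\<Sum>j\<in>UNIV. line_adjacency G w $ i $ j *\<^sub>R c j t *\<^sub>R u0 $ j)" for i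
  proof -
    have "c i t *\<^sub>R (map_matrix complex_of_real (weighted_adjacency G w c t) *v u0) $ i
        = (\<Sum>j\<in>UNIV. line_adjacency G w $ i $ j *\<^sub>R c j t *\<^sub>R u0 $ j)"
      using pos[of i] unfolding matrix_vector_mult_def
      by (simp add: weighted_adjacency_nth[of c t, OF pos] scaleR_conv_of_real mult.assoc flip: sum_divide_distrib)
    then show ?thesis using pos[of i] by (metis less_irrefl scaleR_cancel_left)
  qed
  then show ?thesis by (simp add: vec_eq_iff)
qed

lemma line_adjacency_nonneg:
  "(\<And>i j. 0 \<le> w $ i $ j) \<Longrightarrow> 0 \<le> line_adjacency G w $ i $ j"
  by (simp add: line_adjacency_def)

text \<open>Column j is the row of w that belongs to the vertex \<open>head G j\<close>, because w
  vanishes on edges that do not start at that vertex.\<close>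

lemma line_adjacency_column_sum:
  assumes "\<And>i. (\<Sum>j\<in>UNIV. w $ i $ j) = 1"
    and "\<And>i j. incidence_minus G $ i $ j = 0 \<Longrightarrow> w $ i $ j = 0"
  shows "(\<Sum>i\<in>UNIV. line_adjacency G w $ i $ j) = 1"
proof -
  have "line_adjacency G w $ i $ j = w $ head G j $ i" for i
    using assms(2)[of "head G j" i] by (auto simp: line_adjacency_def incidence_minus_def)
  then show ?thesis using assms(1) by simp
qed

text \<open>For fixed j, the transmission condition at the vertex \<open>tail G j\<close> is the
  j-th component of the flux condition; at every other vertex both sides are zero.\<close>

lemma network_dom_eq_transport_dom:
  assumes pos: "\<And>j. c j t > 0"
    and w0: "\<And>i j. incidence_minus G $ i $ j = 0 \<Longrightarrow> w $ i $ j = 0"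
  shows "network_dom G w c t = transport_dom G w c t"
proof -
  have "(\<forall>i j. complex_of_real (incidence_minus G $ i $ j * c j t) * u1 $ j =
           complex_of_real (w $ i $ j) *
             (\<Sum>k\<in>UNIV. complex_of_real (incidence_plus G $ i $ k * c k t) * u0 $ k))
     \<longleftrightarrow> u1 = map_matrix complex_of_real (weighted_adjacency G w c t) *v u0" (is "?L \<longleftrightarrow> _") for u0 u1
  proof -
    have sum: "complex_of_real (w $ tail G j $ j) *
             (\<Sum>k\<in>UNIV. complex_of_real (incidence_plus G $ tail G j $ k * c k t) * u0 $ k)
        = (\<Sum>k\<in>UNIV. line_adjacency G w $ j $ k *\<^sub>R c k t *\<^sub>R u0 $ k)" for j
      unfolding sum_distrib_left
      by (rule sum.cong) (auto simp: incidence_plus_def line_adjacency_def scaleR_conv_of_real)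
    have "?L \<longleftrightarrow> (\<forall>j. complex_of_real (c j t) * u1 $ j = complex_of_real (w $ tail G j $ j) *
             (\<Sum>k\<in>UNIV. complex_of_real (incidence_plus G $ tail G j $ k * c k t) * u0 $ k))"
    proof (intro iffI allI)
      fix j assume ?L
      then show "complex_of_real (c j t) * u1 $ j = complex_of_real (w $ tail G j $ j) *
             (\<Sum>k\<in>UNIV. complex_of_real (incidence_plus G $ tail G j $ k * c k t) * u0 $ k)"
        by (auto dest!: spec[of _ "tail G j"] spec[of _ j] simp: incidence_minus_def)
    next
      fix i j
      assume *: "\<forall>j. complex_of_real (c j t) * u1 $ j = complex_of_real (w $ tail G j $ j) *
             (\<Sum>k\<in>UNIV. complex_of_real (incidence_plus G $ tail G j $ k * c k t) * u0 $ k)"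
      show "complex_of_real (incidence_minus G $ i $ j * c j t) * u1 $ j =
           complex_of_real (w $ i $ j) *
             (\<Sum>k\<in>UNIV. complex_of_real (incidence_plus G $ i $ k * c k t) * u0 $ k)"
      proof (cases "tail G j = i")
        case True
        with *[rule_format, of j] show ?thesis by (simp add: incidence_minus_def)
      next
        case False
        then have "incidence_minus G $ i $ j = 0" by (simp add: incidence_minus_def)
        with w0[OF this] show ?thesis by simp
      qed
    qed
    then show ?thesis
      unfolding boundary_condition_iff[of c t, OF pos] sum by (simp only: scaleR_conv_of_real)
  qed
  then show ?thesis by (simp add: network_dom_def transport_dom_def)
qed

text \<open>Provides a single continuous representative that carries the boundary values and is at
  the same time an antiderivative of the weak derivative.\<close>

lemma transport_domE:
  assumes "u \<in> transport_dom G w c t" and pos: "\<And>j. c j t > 0"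
  obtains v g where "continuous_on {0..1} v" "integrable unit_leb g" "u = abs_L1 v"
    "has_weak_derivative u (abs_L1 g)"
    "\<And>x. x \<in> {0..1} \<Longrightarrow> v x = v 0 + integral {0..x} g"
    "\<And>i. c i t *\<^sub>R v 1 $ i = (\<Sum>j\<in>UNIV. line_adjacency G w $ i $ j *\<^sub>R c j t *\<^sub>R v 0 $ j)"
    "transport_op c t u = abs_L1 (\<lambda>x. \<chi> j. c j t * g x $ j)"
proof -
  from assms(1) obtain v g' where v: "continuous_on {0..1} v" "represents v u"
    and weak: "has_weak_derivative u g'"
    and bc: "v 1 = map_matrix complex_of_real (weighted_adjacency G w c t) *v v 0"
    by (auto simp: transport_dom_def W11_def has_boundary_values_def)
  obtain g where g: "integrable unit_leb g" "g' = abs_L1 g" by (rule L1_cases)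
  obtain f where f: "integrable unit_leb f" "u = abs_L1 f" by (rule L1_cases)
  have v_int: "integrable unit_leb v" using v(1) by (rule integrable_unit_continuous)
  have u: "u = abs_L1 v"
    using v(2) f v_int by (simp add: represents_abs_L1 abs_L1_eq_iff eq_commute)
  show ?thesis
  proof (rule that[OF v(1) g(1) u])
    show weak': "has_weak_derivative u (abs_L1 g)" using weak g by simp
    show "v x = v 0 + integral {0..x} g" if "x \<in> {0..1}" for x
      using weak' v_int g that unfolding u
      by (intro weak_fundamental_theorem_of_calculus v) (auto simp: has_weak_derivative_abs_L1)
    show "c i t *\<^sub>R v 1 $ i = (\<Sum>j\<in>UNIV. line_adjacency G w $ i $ j *\<^sub>R c j t *\<^sub>R v 0 $ j)" for i
      using bc boundary_condition_iff[of c t, OF pos] by blast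
    show "transport_op c t u = abs_L1 (\<lambda>x. \<chi> j. c j t * g x $ j)"
      unfolding transport_op_def weak_derivative_eqI[OF weak'] using g by (simp add: comp_scale_abs_L1)
  qed
qed

text \<open>Each component satisfies the scalar estimate with \<kappa> equal to
  \<open>h * c j t\<close>. The boundary terms add up to h times the total flux leaving at the heads
  minus the total flux entering at the tails; by the triangle inequality and the unit column sums
  this is nonnegative.\<close>

lemma transport_op_dissipative:
  fixes w :: "real^'e::finite^'v::finite"
  assumes u: "u \<in> transport_dom G w c t" and pos: "\<And>j. c j t > 0" and "h \<ge> 0"
    and B_nonneg: "\<And>i j. 0 \<le> line_adjacency G w $ i $ j"
    and B_sum: "\<And>j. (\<Sum>i\<in>UNIV. line_adjacency G w $ i $ j) = 1"
  shows "norm u \<le> norm (u - h *\<^sub>R transport_op c t u)"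
proof -
  obtain v g where v: "continuous_on {0..1} v" and g: "integrable unit_leb g" and u_eq: "u = abs_L1 v"
    and "has_weak_derivative u (abs_L1 g)"
    and ftc: "\<And>x. x \<in> {0..1} \<Longrightarrow> v x = v 0 + integral {0..x} g"
    and bc: "\<And>i. c i t *\<^sub>R v 1 $ i = (\<Sum>j\<in>UNIV. line_adjacency G w $ i $ j *\<^sub>R c j t *\<^sub>R v 0 $ j)"
    and op: "transport_op c t u = abs_L1 (\<lambda>x. \<chi> j. c j t * g x $ j)"
    by (rule transport_domE[OF u pos]) blast
  have v_int: "integrable unit_leb v" using v by (rule integrable_unit_continuous)
  have gi: "g integrable_on {0..1}" using g by (rule integrable_on_lebesgue_on) simp
  have "(\<Sum>i\<in>UNIV. c i t * norm (v 1 $ i))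
      \<le> (\<Sum>i\<in>UNIV. \<Sum>j\<in>UNIV. line_adjacency G w $ i $ j * (c j t * norm (v 0 $ j)))"
  proof (rule sum_mono)
    fix i
    have "c i t * norm (v 1 $ i) = norm (c i t *\<^sub>R v 1 $ i)" using pos[of i] by simp
    also have "\<dots> \<le> (\<Sum>j\<in>UNIV. norm (line_adjacency G w $ i $ j *\<^sub>R c j t *\<^sub>R v 0 $ j))"
      unfolding bc by (rule norm_sum)
    also have "\<dots> = (\<Sum>j\<in>UNIV. line_adjacency G w $ i $ j * (c j t * norm (v 0 $ j)))"
      using B_nonneg pos by (simp add: less_imp_le mult.assoc)
    finally show "c i t * norm (v 1 $ i) \<le> (\<Sum>j\<in>UNIV. line_adjacency G w $ i $ j * (c j t * norm (v 0 $ j)))" .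
  qed
  also have "\<dots> = (\<Sum>j\<in>UNIV. (\<Sum>i\<in>UNIV. line_adjacency G w $ i $ j) * (c j t * norm (v 0 $ j)))"
    by (subst sum.swap) (simp add: sum_distrib_right)
  finally have flux: "(\<Sum>i\<in>UNIV. c i t * norm (v 1 $ i)) \<le> (\<Sum>j\<in>UNIV. c j t * norm (v 0 $ j))"
    by (simp add: B_sum)
  have comp: "(\<integral>x. norm (v x $ j) \<partial>unit_leb) + (h * c j t) * (norm (v 0 $ j) - norm (v 1 $ j))
      \<le> (\<integral>x. norm (v x $ j - (h * c j t) *\<^sub>R g x $ j) \<partial>unit_leb)" for j
  proof (rule integral_norm_dissipative)
    show "continuous_on {0..1} (\<lambda>x. v x $ j)" using v by (intro continuous_intros)
    show "integrable unit_leb (\<lambda>x. g x $ j)" using g by (rule integrable_vec_nth)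
    show "v x $ j = v 0 $ j + integral {0..x} (\<lambda>x. g x $ j)" if x: "x \<in> {0..1}" for x
    proof -
      have "g integrable_on {0..x}" using x gi by (auto intro: integrable_on_subinterval)
      from integral_linear[OF this bounded_linear_vec_nth[of j]]
      show ?thesis using ftc[OF x] by (simp add: o_def)
    qed
    show "0 \<le> h * c j t" using \<open>h \<ge> 0\<close> pos[of j] by simp
  qed
  have "norm u \<le> norm u + h * ((\<Sum>j\<in>UNIV. c j t * norm (v 0 $ j)) - (\<Sum>i\<in>UNIV. c i t * norm (v 1 $ i)))"
    using flux \<open>h \<ge> 0\<close> by simp
  also have "\<dots> = (\<Sum>j\<in>UNIV. (\<integral>x. norm (v x $ j) \<partial>unit_leb) + (h * c j t) * (norm (v 0 $ j) - norm (v 1 $ j)))"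
    by (simp add: u_eq norm_abs_L1[OF v_int] sum.distrib sum_distrib_left sum_subtractf right_diff_distrib mult.assoc)
  also have "\<dots> \<le> (\<Sum>j\<in>UNIV. \<integral>x. norm (v x $ j - (h * c j t) *\<^sub>R g x $ j) \<partial>unit_leb)"
    by (rule sum_mono) (rule comp)
  also have "\<dots> = norm (u - h *\<^sub>R transport_op c t u)"
  proof -
    have i: "integrable unit_leb (\<lambda>x. \<chi> j. complex_of_real (c j t) * g x $ j)" by (rule integrable_comp_scale[OF g])
    then have "u - h *\<^sub>R transport_op c t u = abs_L1 (\<lambda>x. v x - h *\<^sub>R (\<chi> j. complex_of_real (c j t) * g x $ j))"
      unfolding op using u_eq v_int by (simp add: scaleR_abs_L1 diff_abs_L1)
    moreover have "integrable unit_leb (\<lambda>x. v x - h *\<^sub>R (\<chi> j. complex_of_real (c j t) * g x $ j))"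
      using i v_int by auto
    moreover have "(h * c j t) *\<^sub>R z = h *\<^sub>R (complex_of_real (c j t) * z)" for j z
      by (simp add: scaleR_conv_of_real)
    ultimately show ?thesis by (simp add: norm_abs_L1)
  qed
  finally show ?thesis .
qed

section \<open>Transport along characteristics\<close>

text \<open>The guard \<open>\<forall>k. l k > 0\<close> makes the recursion terminate for every \<open>l\<close>.\<close>

function delay_extension ::
  "('e::finite \<Rightarrow> real) \<Rightarrow> ('e \<Rightarrow> 'e \<Rightarrow> real) \<Rightarrow> ('e \<Rightarrow> real \<Rightarrow> 'b::real_normed_vector) \<Rightarrow> 'e \<Rightarrow> real \<Rightarrow> 'b"
  where
  "delay_extension l M f j t =
     (if (\<forall>k. l k > 0) \<and> l j < t then \<Sum>k\<in>UNIV. M j k *\<^sub>R delay_extension l M f k (t - l j) else f j t)"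
  by pat_completeness auto
termination
\<comment> \<open>The measure counts how many times the shortest delay fits into t, rounded up. A
  recursive call subtracts at least that delay and occurs only for t > 0, so the count drops and is
  positive beforehand.\<close>
proof (relation "Wellfounded.measure (\<lambda>(l, M, f, j, t). nat \<lceil>t / Min (range l)\<rceil>)")
  fix l :: "'e::finite \<Rightarrow> real" and M :: "'e \<Rightarrow> 'e \<Rightarrow> real" and f :: "'e \<Rightarrow> real \<Rightarrow> 'b" and j k :: 'e and t :: real
  assume *: "(\<forall>k. 0 < l k) \<and> l j < t"
  let ?m = "Min (range l)"
  have m: "0 < ?m" "?m \<le> l j" using * by auto
  have "1 \<le> l j / ?m" using m by (simp add: le_divide_eq del: Min_gr_iff Min.bounded_iff)
  then have "\<lceil>(t - l j) / ?m\<rceil> \<le> \<lceil>t / ?m - 1\<rceil>"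
    by (intro ceiling_mono) (simp add: diff_divide_distrib)
  also have "\<dots> < \<lceil>t / ?m\<rceil>" by simp
  finally have "\<lceil>(t - l j) / ?m\<rceil> < \<lceil>t / ?m\<rceil>" .
  moreover have "0 < \<lceil>t / ?m\<rceil>"
    unfolding zero_less_ceiling using * by (intro divide_pos_pos m(1)) (meson less_trans)
  ultimately show "((l, M, f, k, t - l j), (l, M, f, j, t)) \<in> Wellfounded.measure (\<lambda>(l, M, f, j, t). nat \<lceil>t / Min (range l)\<rceil>)"
    by simp
qed (rule wf_measure)

declare delay_extension.simps [simp del]

lemma delay_extension_initial: "t \<le> l j \<Longrightarrow> delay_extension l M f j t = f j t"
  by (subst delay_extension.simps) simp

lemma delay_extension_eq_If:
  fixes l :: "'e::finite \<Rightarrow> real" and M :: "'e \<Rightarrow> 'e \<Rightarrow> real" and f :: "'e \<Rightarrow> real \<Rightarrow> 'b::real_normed_vector"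
  assumes "\<And>k. l k > 0"
  shows "delay_extension l M f j =
    (\<lambda>t. if t \<in> {..l j} then f j t else \<Sum>k\<in>UNIV. M j k *\<^sub>R delay_extension l M f k (t - l j))"
proof
  fix t
  show "delay_extension l M f j t =
    (if t \<in> {..l j} then f j t else \<Sum>k\<in>UNIV. M j k *\<^sub>R delay_extension l M f k (t - l j))"
    by (subst delay_extension.simps) (simp add: assms not_less)
qed

text \<open>For t > 0 this is the recursion itself. At t = 0 the argument \<open>l j\<close> still
  falls into the initial branch, and the equation is the compatibility of the initial
  functions.\<close>

lemma delay_extension_shift:
  fixes l :: "'e::finite \<Rightarrow> real" and M :: "'e \<Rightarrow> 'e \<Rightarrow> real" and f :: "'e \<Rightarrow> real \<Rightarrow> 'b::real_normed_vector"
  assumes pos: "\<And>k. l k > 0" and compat: "f j (l j) = (\<Sum>k\<in>UNIV. M j k *\<^sub>R f k 0)" and "t \<ge> 0"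
  shows "delay_extension l M f j (t + l j) = (\<Sum>k\<in>UNIV. M j k *\<^sub>R delay_extension l M f k t)"
proof (cases "t = 0")
  case True
  then show ?thesis using compat pos by (simp add: delay_extension_initial less_imp_le)
next
  case False
  with \<open>t \<ge> 0\<close> show ?thesis by (subst delay_extension_eq_If) (auto simp: pos)
qed

text \<open>Each step back in time has at least the length m of the shortest delay, so induction on
  n with t \<le> n * m suffices; for t \<le> 0 the premise of \<open>step\<close> is
  vacuous.\<close>

lemma delay_induct:
  fixes l :: "'e::finite \<Rightarrow> real"
  assumes pos: "\<And>k. l k > 0"
    and step: "\<And>j t. (\<And>k. l j < t \<Longrightarrow> P k (t - l j)) \<Longrightarrow> P j t"
  shows "P j t"
proof -
  obtain m where m: "0 < m" and m_le: "\<And>j. m \<le> l j"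
  proof
    show "0 < Min (range l)" using pos by simp
    show "Min (range l) \<le> l j" for j by simp
  qed
  have bounded: "t \<le> real n * m \<Longrightarrow> P j t" for n j t
  proof (induction n arbitrary: j t)
    case 0
    show ?case
    proof (rule step)
      assume "l j < t"
      with 0 pos[of j] have False by simp
      then show "P k (t - l j)" for k ..
    qed
  next
    case (Suc n)
    show ?case
    proof (rule step)
      fix k
      assume "l j < t"
      have "t - l j \<le> real n * m" using Suc.prems m_le[of j] by (simp add: algebra_simps)
      then show "P k (t - l j)" by (rule Suc.IH)
    qed
  qed
  obtain n :: nat where "t / m \<le> real n" using real_arch_simple by blast
  with m have "t \<le> real n * m" by (simp add: pos_divide_le_eq)
  then show ?thesis by (rule bounded)
qed

text \<open>By induction along the delays both branches of the recursion are continuous;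
  compatibility makes them agree at the junction \<open>l j\<close>.\<close>

lemma continuous_delay_extension:
  fixes l :: "'e::finite \<Rightarrow> real" and M :: "'e \<Rightarrow> 'e \<Rightarrow> real" and f :: "'e \<Rightarrow> real \<Rightarrow> 'b::real_normed_vector"
  assumes pos: "\<And>k. l k > 0" and f: "\<And>j. continuous_on UNIV (f j)"
    and compat: "\<And>j. f j (l j) = (\<Sum>k\<in>UNIV. M j k *\<^sub>R f k 0)"
  shows "continuous_on UNIV (delay_extension l M f j)"
proof -
  have "isCont (delay_extension l M f j) t" for j t
  proof (rule delay_induct[of l "\<lambda>j t. isCont (delay_extension l M f j) t", OF pos])
    fix j t
    assume IH: "\<And>k. l j < t \<Longrightarrow> isCont (delay_extension l M f k) (t - l j)"
    define g where "g s = (\<Sum>k\<in>UNIV. M j k *\<^sub>R delay_extension l M f k (s - l j))" for s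
    have f_cont: "isCont (f j) t" for j t using f by (simp add: continuous_on_eq_continuous_at)
    \<comment> \<open>At the junction t = \<open>l j\<close> the shifted argument is 0, which the
      induction hypothesis does not reach. There the extension coincides locally with the initial
      function, because all delays are positive and that function is used for negative times
      too.\<close>
    have start: "isCont (delay_extension l M f k) 0" for k
    proof -
      have "\<forall>\<^sub>F s in nhds 0. delay_extension l M f k s = f k s"
      proof (rule eventually_mono)
        show "\<forall>\<^sub>F s in nhds 0. s \<in> {..<l k}"
          by (rule eventually_nhds_in_open) (simp_all add: pos)
        show "delay_extension l M f k s = f k s" if "s \<in> {..<l k}" for s
          using that by (intro delay_extension_initial) simp
      qed
      from isCont_cong[OF this] show ?thesis using f_cont[where j = k and t = 0] by simp
    qed
    have g_cont: "isCont g t" if "l j \<le> t"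
    proof -
      have "isCont (\<lambda>s. delay_extension l M f k (s - l j)) t" for k
      proof (rule isCont_o2[where f = "\<lambda>s. s - l j" and g = "delay_extension l M f k"])
        show "isCont (\<lambda>s. s - l j) t" by (intro continuous_intros)
        show "isCont (delay_extension l M f k) (t - l j)"
          using that IH[of k] start[of k] by (cases "l j = t") auto
      qed
      then show ?thesis unfolding g_def by (intro continuous_intros)
    qed
    have g_l: "g (l j) = f j (l j)"
      using pos by (simp add: g_def compat delay_extension_initial less_imp_le)
    have eq: "delay_extension l M f j = (\<lambda>s. if s \<in> {..l j} then f j s else g s)"
      unfolding g_def by (rule delay_extension_eq_If) (rule pos)
    have "((\<lambda>s. if s \<in> {..l j} then f j s else g s) \<longlongrightarrow> (if t \<in> {..l j} then f j t else g t))
        (at t within {..l j} \<union> {l j<..})"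
    proof (rule tendsto_If_within_closures[where l = "\<lambda>t. if t \<in> {..l j} then f j t else g t"])
      assume "t \<in> {..l j} \<union> (closure {..l j} \<inter> closure {l j<..})"
      then have "t \<in> {..l j}" by auto
      then show "(f j \<longlongrightarrow> (if t \<in> {..l j} then f j t else g t))
          (at t within {..l j} \<union> (closure {..l j} \<inter> closure {l j<..}))"
        using tendsto_within_subset[OF f_cont[unfolded isCont_def] subset_UNIV] by simp
    next
      assume "t \<in> {l j<..} \<union> (closure {..l j} \<inter> closure {l j<..})"
      then have t: "l j \<le> t" by auto
      then have "(if t \<in> {..l j} then f j t else g t) = g t" using g_l by auto
      then show "(g \<longlongrightarrow> (if t \<in> {..l j} then f j t else g t))
          (at t within {l j<..} \<union> (closure {..l j} \<inter> closure {l j<..}))"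
        using tendsto_within_subset[OF g_cont[OF t, unfolded isCont_def] subset_UNIV] by simp
    qed auto
    moreover have "{..l j} \<union> {l j<..} = UNIV" by auto
    ultimately show "isCont (delay_extension l M f j) t" unfolding eq isCont_def by simp
  qed
  then show ?thesis by (simp add: continuous_on_eq_continuous_at)
qed

text \<open>Differentiating the delay equation gives the same equation for the derivatives. The
  first compatibility condition joins the values at the junction, the second one the slopes.\<close>

lemma has_vector_derivative_delay_extension:
  fixes l :: "'e::finite \<Rightarrow> real" and M :: "'e \<Rightarrow> 'e \<Rightarrow> real" and f :: "'e \<Rightarrow> real \<Rightarrow> 'b::real_normed_vector"
  assumes pos: "\<And>k. l k > 0" and f: "\<And>j t. (f j has_vector_derivative f' j t) (at t)"
    and compat: "\<And>j. f j (l j) = (\<Sum>k\<in>UNIV. M j k *\<^sub>R f k 0)"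
    and compat': "\<And>j. f' j (l j) = (\<Sum>k\<in>UNIV. M j k *\<^sub>R f' k 0)"
  shows "(delay_extension l M f j has_vector_derivative delay_extension l M f' j t) (at t)"
proof (rule delay_induct[of l "\<lambda>j t. (delay_extension l M f j has_vector_derivative delay_extension l M f' j t) (at t)", OF pos])
  fix j t
  assume IH: "\<And>k. l j < t \<Longrightarrow> (delay_extension l M f k has_vector_derivative delay_extension l M f' k (t - l j)) (at (t - l j))"
  define g where "g s = (\<Sum>k\<in>UNIV. M j k *\<^sub>R delay_extension l M f k (s - l j))" for s
  define g' where "g' s = (\<Sum>k\<in>UNIV. M j k *\<^sub>R delay_extension l M f' k (s - l j))" for s
  have start: "(delay_extension l M f k has_vector_derivative delay_extension l M f' k 0) (at 0)" for k
    by (rule has_vector_derivative_transform_within_open[of "f k" _ _ "{..<l k}"])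
       (use pos f[of k 0] in \<open>auto simp: delay_extension_initial less_imp_le\<close>)
  have dg: "(g has_vector_derivative g' t) (at t)" if "l j \<le> t"
  proof -
    have "((\<lambda>s. delay_extension l M f k (s - l j)) has_vector_derivative delay_extension l M f' k (t - l j)) (at t)" for k
    proof -
      have *: "(delay_extension l M f k has_vector_derivative delay_extension l M f' k (t - l j)) (at (t - l j))"
        using that IH[of k] start[of k] by (cases "l j = t") auto
      have "((\<lambda>s. s - l j) has_vector_derivative 1) (at t)"
        by (auto intro!: derivative_eq_intros)
      from vector_diff_chain_at[OF this *] show ?thesis by (simp add: o_def)
    qed
    then show ?thesis
      unfolding g_def[abs_def] g'_def
      by (intro has_vector_derivative_sum bounded_linear.has_vector_derivative[OF bounded_linear_scaleR_right])
  qed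
  have g_l: "g (l j) = f j (l j)" "g' (l j) = f' j (l j)"
    using pos by (simp_all add: g_def g'_def compat compat' delay_extension_initial less_imp_le)
  have eq: "delay_extension l M f j = (\<lambda>s. if s \<in> {..l j} then f j s else g s)"
    "delay_extension l M f' j = (\<lambda>s. if s \<in> {..l j} then f' j s else g' s)"
    unfolding g_def g'_def by (rule delay_extension_eq_If, rule pos)+
  show "(delay_extension l M f j has_vector_derivative delay_extension l M f' j t) (at t)"
    unfolding eq
  proof (rule has_vector_derivative_If_within_closures)
    assume "t \<in> {l j<..} \<union> (closure {..l j} \<inter> closure {l j<..})"
    then show "(g has_vector_derivative g' t) (at t within {l j<..} \<union> (closure {..l j} \<inter> closure {l j<..}))"
      by (auto intro!: has_vector_derivative_at_within[OF dg])
  qed (use f g_l in \<open>auto intro: has_vector_derivative_at_within\<close>)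
qed

section \<open>Differentiable curves in the space of integrable classes\<close>

lemma has_vector_derivative_vec_lambda:
  fixes f :: "'i::finite \<Rightarrow> real \<Rightarrow> 'b::real_normed_vector"
  assumes "\<And>j. (f j has_vector_derivative f' j) (at t within S)"
  shows "((\<lambda>x. \<chi> j. f j x) has_vector_derivative (\<chi> j. f' j)) (at t within S)"
  unfolding has_vector_derivative_def has_derivative_within
proof (intro conjI vec_tendstoI)
  show "bounded_linear (\<lambda>x. x *\<^sub>R (\<chi> j. f' j))" by (rule bounded_linear_scaleR_left)
  show "((\<lambda>x. ((1 / norm (x - t)) *\<^sub>R ((\<chi> j. f j x) - ((\<chi> j. f j t) + (x - t) *\<^sub>R (\<chi> j. f' j)))) $ i)
      \<longlongrightarrow> 0 $ i) (at t within S)" for i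
    using assms[of i] by (simp add: has_vector_derivative_def has_derivative_within)
qed

lemma continuous_on_slice:
  assumes "continuous_on UNIV (\<lambda>p. v (fst p) (snd p))"
  shows "continuous_on S (v s)"
proof -
  have "continuous_on S (\<lambda>x. (s, x))" by (intro continuous_on_Pair continuous_on_const continuous_on_id)
  from continuous_on_compose2[OF assms this] show ?thesis by simp
qed

text \<open>Joint continuity is uniform on the compact strip of times within distance 1 of t; hence
  the radius \<open>min d 1\<close>.\<close>

lemma uniformly_close_on_unit_interval:
  fixes v' :: "real \<Rightarrow> real \<Rightarrow> 'b::real_normed_vector" and t :: real
  assumes v': "continuous_on UNIV (\<lambda>p. v' (fst p) (snd p))" and "\<epsilon> > 0"
  obtains d where "d > 0" "\<And>s x::real. \<bar>s - t\<bar> < d \<Longrightarrow> x \<in> {0..1} \<Longrightarrow> norm (v' s x - v' t x) \<le> \<epsilon>"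
proof -
  let ?K = "{t - 1..t + 1} \<times> {0..1::real}"
  have "uniformly_continuous_on ?K (\<lambda>p. v' (fst p) (snd p))"
    by (intro compact_uniformly_continuous continuous_on_subset[OF v'] compact_Times) auto
  with \<open>\<epsilon> > 0\<close> obtain d where "d > 0"
    and d: "\<And>p q. p \<in> ?K \<Longrightarrow> q \<in> ?K \<Longrightarrow> dist q p < d \<Longrightarrow> dist (v' (fst q) (snd q)) (v' (fst p) (snd p)) < \<epsilon>"
    unfolding uniformly_continuous_on_def by meson
  show ?thesis
  proof (rule that[of "min d 1"])
    fix s x :: real assume "\<bar>s - t\<bar> < min d 1" "x \<in> {0..1}"
    then show "norm (v' s x - v' t x) \<le> \<epsilon>"
      using d[of "(t, x)" "(s, x)"] by (auto simp: dist_Pair_Pair dist_real_def dist_norm less_imp_le abs_le_iff)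
  qed (use \<open>d > 0\<close> in auto)
qed

lemma continuous_on_abs_L1:
  fixes v :: "real \<Rightarrow> real \<Rightarrow> complex^'e::finite"
  assumes v: "continuous_on UNIV (\<lambda>p. v (fst p) (snd p))"
  shows "continuous_on S (\<lambda>t. abs_L1 (v t))"
  unfolding continuous_on_iff
proof (intro ballI allI impI)
  fix t and e :: real assume "e > 0"
  \<comment> \<open>Passing from a pointwise bound to the norm costs the number of components; the
    factor 2 makes the final inequality strict.\<close>
  define \<epsilon> where "\<epsilon> = e / (2 * real CARD('e))"
  have \<epsilon>: "\<epsilon> > 0" using \<open>e > 0\<close> by (simp add: \<epsilon>_def)
  obtain d where "d > 0" and d: "\<And>s x. \<bar>s - t\<bar> < d \<Longrightarrow> x \<in> {0..1} \<Longrightarrow> norm (v s x - v t x) \<le> \<epsilon>"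
    by (rule uniformly_close_on_unit_interval[OF v \<epsilon>]) blast
  have int: "integrable unit_leb (v s)" for s
    by (intro integrable_unit_continuous continuous_on_slice[OF v])
  show "\<exists>d>0. \<forall>s\<in>S. dist s t < d \<longrightarrow> dist (abs_L1 (v s)) (abs_L1 (v t)) < e"
  proof (intro exI[of _ d] conjI ballI impI)
    fix s assume "dist s t < d"
    then have "norm (abs_L1 (\<lambda>x. v s x - v t x)) \<le> real CARD('e) * \<epsilon>"
      using d[of s] int by (intro norm_abs_L1_le) (auto simp: dist_real_def)
    also have "\<dots> < e" using \<open>e > 0\<close> by (simp add: \<epsilon>_def)
    finally show "dist (abs_L1 (v s)) (abs_L1 (v t)) < e" using int by (simp add: dist_norm diff_abs_L1)
  qed (rule \<open>d > 0\<close>)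
qed

text \<open>For each x the mean value inequality bounds the linearisation error by the oscillation
  of the time derivative. That oscillation is small uniformly in x, so the bound survives
  integration.\<close>

lemma has_vector_derivative_abs_L1:
  fixes v v' :: "real \<Rightarrow> real \<Rightarrow> complex^'e::finite"
  assumes v: "\<And>s. continuous_on {0..1} (v s)"
    and dv: "\<And>s x. ((\<lambda>s. v s x) has_vector_derivative v' s x) (at s)"
    and v': "continuous_on UNIV (\<lambda>p. v' (fst p) (snd p))"
  shows "((\<lambda>t. abs_L1 (v t)) has_vector_derivative abs_L1 (v' t)) (at t)"
  unfolding has_vector_derivative_def has_derivative_within_alt
proof (intro conjI allI impI)
  show "bounded_linear (\<lambda>x. x *\<^sub>R abs_L1 (v' t))" by (rule bounded_linear_scaleR_left)
  fix e :: real assume "e > 0"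
  define \<epsilon> where "\<epsilon> = e / real CARD('e)"
  have \<epsilon>: "\<epsilon> > 0" using \<open>e > 0\<close> by (simp add: \<epsilon>_def)
  obtain d where "d > 0" and d: "\<And>s x. \<bar>s - t\<bar> < d \<Longrightarrow> x \<in> {0..1} \<Longrightarrow> norm (v' s x - v' t x) \<le> \<epsilon>"
    by (rule uniformly_close_on_unit_interval[OF v' \<epsilon>]) blast
  have int: "integrable unit_leb (v s)" "integrable unit_leb (v' s)" for s
    by (intro integrable_unit_continuous continuous_on_slice[OF v'] v)+
  show "\<exists>d>0. \<forall>s\<in>UNIV. norm (s - t) < d \<longrightarrow>
      norm (abs_L1 (v s) - abs_L1 (v t) - (s - t) *\<^sub>R abs_L1 (v' t)) \<le> e * norm (s - t)"
  proof (intro exI[of _ d] conjI ballI impI)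
    fix s assume s: "norm (s - t) < d"
    have bound: "norm (v s x - v t x - (s - t) *\<^sub>R v' t x) \<le> \<bar>s - t\<bar> * \<epsilon>" if x: "x \<in> {0..1}" for x
    proof -
      have "norm (v s x - v t x - (s - t) *\<^sub>R v' t x) \<le> norm (s - t) * \<epsilon>"
      proof (rule vector_differentiable_bound_linearization[where S = "closed_segment t s"
            and f = "\<lambda>s. v s x" and f' = "\<lambda>s. v' s x" and a = t and b = s and ?x0.0 = t])
        show "((\<lambda>s. v s x) has_vector_derivative v' r x) (at r within closed_segment t s)" for r
          by (rule has_vector_derivative_at_within[OF dv])
        show "norm (v' r x - v' t x) \<le> \<epsilon>" if "r \<in> closed_segment t s" for r
        proof -
          have "\<bar>r - t\<bar> \<le> \<bar>s - t\<bar>"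
            using that by (auto simp: closed_segment_eq_real_ivl split: if_splits)
          then show ?thesis using s d[OF _ x, of r] by simp
        qed
      qed auto
      then show ?thesis by simp
    qed
    have "norm (abs_L1 (\<lambda>x. v s x - v t x - (s - t) *\<^sub>R v' t x)) \<le> real CARD('e) * (\<bar>s - t\<bar> * \<epsilon>)"
      using bound int by (intro norm_abs_L1_le) auto
    also have "\<dots> = e * norm (s - t)" by (simp add: \<epsilon>_def)
    finally show "norm (abs_L1 (v s) - abs_L1 (v t) - (s - t) *\<^sub>R abs_L1 (v' t)) \<le> e * norm (s - t)"
      using int by (simp add: diff_abs_L1 scaleR_abs_L1)
  qed (rule \<open>d > 0\<close>)
qed

section \<open>Velocity ratios and smooth solutions\<close>

text \<open>The integral of the continuous function \<open>norm (v x - w x)\<close> vanishes, hence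
  so does the function, end points included. Boundary values are thus determined by the
  class.\<close>

lemma abs_L1_eq_imp_eq_on:
  fixes v w :: "real \<Rightarrow> complex^'e::finite"
  assumes v: "continuous_on {0..1} v" and w: "continuous_on {0..1} w"
    and eq: "abs_L1 v = abs_L1 w" and x: "x \<in> {0..1}"
  shows "v x = w x"
proof -
  have int: "integrable unit_leb v" "integrable unit_leb w"
    using v w by (auto intro: integrable_unit_continuous)
  have cont: "continuous_on {0..1} (\<lambda>x. norm (v x - w x))" by (intro continuous_intros v w)
  have "AE x in unit_leb. v x = w x" using eq int by (simp add: abs_L1_eq_iff)
  then have "(\<integral>x. norm (v x - w x) \<partial>unit_leb) = 0" by (intro integral_eq_zero_AE) auto
  then have "integral {0..1} (\<lambda>x. norm (v x - w x)) = 0"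
    using integral_unit_leb[OF integrable_unit_continuous[OF cont]] by simp
  then have "\<forall>x\<in>{0..1}. norm (v x - w x) = 0"
    using cont by (subst (asm) integral_eq_0_iff) auto
  then show ?thesis using x by simp
qed

lemma C1_in_transport_dom:
  fixes v v' :: "real \<Rightarrow> complex^'e::finite"
  assumes v: "\<And>x. (v has_vector_derivative v' x) (at x)" and v': "continuous_on UNIV v'"
    and pos: "\<And>j. c j t > 0"
    and bc: "\<And>i. c i t *\<^sub>R v 1 $ i = (\<Sum>j\<in>UNIV. line_adjacency G w $ i $ j *\<^sub>R c j t *\<^sub>R v 0 $ j)"
  shows "abs_L1 v \<in> transport_dom G w c t"
    and "transport_op c t (abs_L1 v) = abs_L1 (\<lambda>x. \<chi> j. c j t * v' x $ j)"
proof -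
  have weak: "has_weak_derivative (abs_L1 v) (abs_L1 v')"
    by (rule has_weak_derivative_C1[OF v v'])
  have v_cont: "continuous_on {0..1} v"
    by (intro continuous_at_imp_continuous_on ballI has_vector_derivative_continuous[OF v])
  then have "has_boundary_values (abs_L1 v) (v 0) (v 1)"
    unfolding has_boundary_values_def
    by (intro exI[of _ v]) (simp add: represents_abs_L1 integrable_unit_continuous)
  moreover have "v 1 = map_matrix complex_of_real (weighted_adjacency G w c t) *v v 0"
    using bc boundary_condition_iff[of c t, OF pos] by blast
  ultimately show "abs_L1 v \<in> transport_dom G w c t"
    using weak unfolding transport_dom_def W11_def by blast
  have "integrable unit_leb v'"
    using v' by (intro integrable_unit_continuous) (rule continuous_on_subset, auto)
  then show "transport_op c t (abs_L1 v) = abs_L1 (\<lambda>x. \<chi> j. c j t * v' x $ j)"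
    by (simp add: transport_op_def weak_derivative_eqI[OF weak] comp_scale_abs_L1)
qed

text \<open>Test the equality of the domains on the affine function whose value at \<open>0\<close> is the \<open>j\<close>-th
  unit vector.\<close>

lemma velocity_ratio_eq_if_adjacent:
  fixes w :: "real^'e::finite^'v::finite"
  assumes pos: "\<And>j t. c j t > 0" and dom: "transport_dom G w c t = transport_dom G w c 0"
    and adj: "line_adjacency G w $ i $ j \<noteq> 0"
  shows "c i t / c i 0 = c j t / c j 0"
proof -
  define u0 :: "complex^'e" where "u0 = axis j 1"
  \<comment> \<open>This is column j of the weighted adjacency matrix at time 0, so the affine
    function from \<open>u0\<close> to \<open>u1\<close> satisfies the boundary condition at time
    0.\<close>
  define u1 :: "complex^'e" where "u1 = (\<chi> i. of_real (line_adjacency G w $ i $ j * c j 0 / c i 0))"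
  define v where "v x = u0 + x *\<^sub>R (u1 - u0)" for x :: real
  have sum: "(\<Sum>k\<in>UNIV. line_adjacency G w $ i $ k *\<^sub>R c k t *\<^sub>R u0 $ k)
      = of_real (line_adjacency G w $ i $ j * c j t)" for i t
  proof -
    have "line_adjacency G w $ i $ k *\<^sub>R c k t *\<^sub>R u0 $ k
        = (if k = j then of_real (line_adjacency G w $ i $ j * c j t) else 0)" for k
      by (simp add: u0_def axis_def scaleR_conv_of_real)
    then show ?thesis by simp
  qed
  have dv: "(v has_vector_derivative (u1 - u0)) (at x)" for x
    unfolding v_def by (auto intro!: derivative_eq_intros)
  have "abs_L1 v \<in> transport_dom G w c 0"
  proof (rule C1_in_transport_dom(1)[OF dv])
    show "c i 0 *\<^sub>R v 1 $ i = (\<Sum>k\<in>UNIV. line_adjacency G w $ i $ k *\<^sub>R c k 0 *\<^sub>R v 0 $ k)" for i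
      using pos[of i 0] sum[of i 0] by (simp add: v_def u1_def scaleR_conv_of_real)
  qed (use pos in auto)
  then have "abs_L1 v \<in> transport_dom G w c t" using dom by simp
  then obtain v2 g where v2: "continuous_on {0..1} v2" and "integrable unit_leb g" and eq: "abs_L1 v = abs_L1 v2"
    and "has_weak_derivative (abs_L1 v) (abs_L1 g)"
    and "\<And>x. x \<in> {0..1} \<Longrightarrow> v2 x = v2 0 + integral {0..x} g"
    and bc: "\<And>i. c i t *\<^sub>R v2 1 $ i = (\<Sum>j\<in>UNIV. line_adjacency G w $ i $ j *\<^sub>R c j t *\<^sub>R v2 0 $ j)"
    by (rule transport_domE[of _ G w c t, OF _ pos]) blast
  have "continuous_on {0..1} v"
    by (intro continuous_at_imp_continuous_on ballI has_vector_derivative_continuous[OF dv])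
  from abs_L1_eq_imp_eq_on[OF this v2 eq, of 0] abs_L1_eq_imp_eq_on[OF this v2 eq, of 1]
  have ends: "v2 0 = u0" "v2 1 = u1"
    by (simp_all add: v_def)
  have "c i t *\<^sub>R u1 $ i = of_real (line_adjacency G w $ i $ j * c j t)"
    using bc[of i] unfolding ends sum .
  then have "of_real (c i t * (line_adjacency G w $ i $ j * c j 0 / c i 0))
      = (of_real (line_adjacency G w $ i $ j * c j t) :: complex)"
    by (simp add: u1_def scaleR_conv_of_real)
  then have "c i t * (line_adjacency G w $ i $ j * c j 0 / c i 0) = line_adjacency G w $ i $ j * c j t"
    unfolding of_real_eq_iff .
  then have "line_adjacency G w $ i $ j * (c i t * c j 0) = line_adjacency G w $ i $ j * (c j t * c i 0)"
    using pos[of i 0] by (simp add: field_simps)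
  then have "c i t * c j 0 = c j t * c i 0" using adj by simp
  then show ?thesis using pos[of i 0] pos[of j 0] by (simp add: frac_eq_eq less_imp_neq[symmetric])
qed

text \<open>The edges with the same ratio as j form a nonempty set S. Adjacent edges have equal
  ratios, so every matrix entry with row outside S and column in S vanishes; irreducibility leaves
  only S = UNIV.\<close>

lemma velocity_ratio_eq:
  fixes w :: "real^'e::finite^'v::finite"
  assumes pos: "\<And>j t. c j t > 0" and dom: "transport_dom G w c t = transport_dom G w c 0"
    and irr: "irreducible_matrix (line_adjacency G w)"
  shows "c i t / c i 0 = c j t / c j 0"
proof -
  define S where "S = {k. c k t / c k 0 = c j t / c j 0}"
  have "j \<in> S" by (simp add: S_def)
  moreover have "line_adjacency G w $ k $ m = 0" if "k \<notin> S" "m \<in> S" for k m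
    using velocity_ratio_eq_if_adjacent[of c G w t k m] pos dom that by (auto simp: S_def)
  ultimately have "S = UNIV" using irr unfolding irreducible_matrix_def by blast
  then show ?thesis unfolding S_def by blast
qed

section \<open>A dense subspace of smooth data, and its solutions\<close>

text \<open>The weights are kept arbitrary so that the same condition can be imposed on the boundary
  values and, with squared weights, on the boundary derivatives.\<close>

definition flux_condition ::
  "('v::finite, 'e::finite) pre_digraph \<Rightarrow> real^'e^'v \<Rightarrow> ('e \<Rightarrow> real) \<Rightarrow> complex^'e \<Rightarrow> complex^'e \<Rightarrow> bool" where
  "flux_condition G w a u0 u1 \<longleftrightarrow>
     (\<forall>i. a i *\<^sub>R u1 $ i = (\<Sum>j\<in>UNIV. line_adjacency G w $ i $ j *\<^sub>R a j *\<^sub>R u0 $ j))"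

text \<open>The second flux condition, with weights \<open>a\<^sub>j\<^sup>2\<close>, says that \<open>(a\<^sub>j v'\<^sub>j)\<^sub>j\<close> satisfies the first one.\<close>

definition smooth_dom ::
  "('v::finite, 'e::finite) pre_digraph \<Rightarrow> real^'e^'v \<Rightarrow> ('e \<Rightarrow> real) \<Rightarrow> 'e L1 set" where
  "smooth_dom G w a = {abs_L1 v | v v'. (\<forall>x. (v has_vector_derivative v' x) (at x)) \<and>
     continuous_on UNIV v' \<and> flux_condition G w a (v 0) (v 1) \<and>
     flux_condition G w (\<lambda>j. (a j)\<^sup>2) (v' 0) (v' 1)}"

lemma smooth_domI:
  assumes "\<And>x. (v has_vector_derivative v' x) (at x)" "continuous_on UNIV v'"
    "flux_condition G w a (v 0) (v 1)" "flux_condition G w (\<lambda>j. (a j)\<^sup>2) (v' 0) (v' 1)"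
  shows "abs_L1 v \<in> smooth_dom G w a"
  using assms unfolding smooth_dom_def by blast

lemma smooth_domE:
  assumes "u \<in> smooth_dom G w a"
  obtains v v' where "u = abs_L1 v" "\<And>x. (v has_vector_derivative v' x) (at x)" "continuous_on UNIV v'"
    "flux_condition G w a (v 0) (v 1)" "flux_condition G w (\<lambda>j. (a j)\<^sup>2) (v' 0) (v' 1)"
  using assms unfolding smooth_dom_def by blast

lemma flux_condition_0: "flux_condition G w a 0 0"
  by (simp add: flux_condition_def)

lemma flux_condition_add:
  "flux_condition G w a u0 u1 \<Longrightarrow> flux_condition G w a v0 v1 \<Longrightarrow> flux_condition G w a (u0 + v0) (u1 + v1)"
  by (simp add: flux_condition_def scaleR_add_right sum.distrib)

lemma flux_condition_scale:
  assumes "flux_condition G w a u0 u1"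
  shows "flux_condition G w a (\<chi> j. z * u0 $ j) (\<chi> j. z * u1 $ j)"
proof -
  have "a i *\<^sub>R (z * u1 $ i) = (\<Sum>j\<in>UNIV. line_adjacency G w $ i $ j *\<^sub>R a j *\<^sub>R (z * u0 $ j))" for i
  proof -
    have "a i *\<^sub>R (z * u1 $ i) = z * (a i *\<^sub>R u1 $ i)" by simp
    also have "\<dots> = (\<Sum>j\<in>UNIV. line_adjacency G w $ i $ j *\<^sub>R a j *\<^sub>R (z * u0 $ j))"
      using assms by (simp add: flux_condition_def sum_distrib_left)
    finally show ?thesis .
  qed
  then show ?thesis by (simp add: flux_condition_def)
qed

lemma subspace_smooth_dom: "module.subspace scaleC_L1 (smooth_dom G w a)"
proof -
  interpret vector_space "scaleC_L1 :: complex \<Rightarrow> 'a L1 \<Rightarrow> 'a L1" by (rule vector_space_scaleC_L1)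
  have int: "integrable unit_leb v" if "\<And>x. (v has_vector_derivative v' x) (at x)"
    for v v' :: "real \<Rightarrow> complex^'a"
    by (intro integrable_unit_continuous continuous_at_imp_continuous_on ballI
        has_vector_derivative_continuous[OF that])
  show ?thesis
  proof (rule subspaceI)
    have "abs_L1 (\<lambda>_. 0) \<in> smooth_dom G w a"
      by (rule smooth_domI[where v' = "\<lambda>_. 0"]) (auto simp: flux_condition_0)
    then show "0 \<in> smooth_dom G w a" by (simp add: zero_L1_def)
  next
    fix u1 u2 assume "u1 \<in> smooth_dom G w a" "u2 \<in> smooth_dom G w a"
    then obtain v v' q q' where v: "u1 = abs_L1 v" "\<And>x. (v has_vector_derivative v' x) (at x)" "continuous_on UNIV v'"
      "flux_condition G w a (v 0) (v 1)" "flux_condition G w (\<lambda>j. (a j)\<^sup>2) (v' 0) (v' 1)"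
      and q: "u2 = abs_L1 q" "\<And>x. (q has_vector_derivative q' x) (at x)" "continuous_on UNIV q'"
      "flux_condition G w a (q 0) (q 1)" "flux_condition G w (\<lambda>j. (a j)\<^sup>2) (q' 0) (q' 1)"
      by (elim smooth_domE) blast
    have "abs_L1 (\<lambda>x. v x + q x) \<in> smooth_dom G w a"
      by (rule smooth_domI[where v' = "\<lambda>x. v' x + q' x"])
         (intro has_vector_derivative_add continuous_intros flux_condition_add v q)+
    then show "u1 + u2 \<in> smooth_dom G w a"
      using int[OF v(2)] int[OF q(2)] by (simp add: v(1) q(1) add_abs_L1)
  next
    fix z u assume "u \<in> smooth_dom G w a"
    then obtain v v' where v: "u = abs_L1 v" "\<And>x. (v has_vector_derivative v' x) (at x)" "continuous_on UNIV v'"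
      "flux_condition G w a (v 0) (v 1)" "flux_condition G w (\<lambda>j. (a j)\<^sup>2) (v' 0) (v' 1)"
      by (elim smooth_domE) blast
    have "abs_L1 (\<lambda>x. \<chi> j. z * v x $ j) \<in> smooth_dom G w a"
    proof (rule smooth_domI[where v' = "\<lambda>x. \<chi> j. z * v' x $ j"])
      show "((\<lambda>x. \<chi> j. z * v x $ j) has_vector_derivative (\<chi> j. z * v' x $ j)) (at x)" for x
        by (intro has_vector_derivative_vec_lambda bounded_linear.has_vector_derivative[OF bounded_linear_mult_right]
            bounded_linear.has_vector_derivative[OF bounded_linear_vec_nth] v)
    qed (intro flux_condition_scale continuous_intros v)+
    then show "scaleC_L1 z u \<in> smooth_dom G w a"
      using int[OF v(2)] by (simp add: v(1) scaleC_L1_def comp_scale_abs_L1)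
  qed
qed

text \<open>A test function vanishes near both end points together with its derivative, so both flux
  conditions hold trivially, and test functions are dense.\<close>

lemma closure_smooth_dom:
  fixes w :: "real^'e::finite^'v::finite"
  shows "closure (smooth_dom G w a) = UNIV"
proof -
  have "u \<in> closure (smooth_dom G w a)" for u
    unfolding closure_approachable
  proof (intro allI impI)
    fix e :: real assume "e > 0"
    obtain f where f: "integrable unit_leb f" "u = abs_L1 f" by (rule L1_cases)
    have "e / real CARD('e) > 0" using \<open>e > 0\<close> by simp
    then obtain \<phi> \<phi>' where \<phi>: "vector_test_function \<phi> \<phi>'"
      and close: "(\<integral>x. norm (f x - \<phi> x) \<partial>unit_leb) < e / real CARD('e)"
      by (rule integrable_approx_test_function[OF f(1)])
    obtain K where K: "compact K" "K \<subseteq> {0<..<1}" "\<And>x. x \<notin> K \<Longrightarrow> \<phi> x = 0"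
      using \<phi> by (auto simp: vector_test_function_def)
    have zero: "\<phi> x = 0 \<and> \<phi>' x = 0" if "x \<notin> K" for x
    proof
      show "\<phi> x = 0" by (rule K(3)[OF that])
      have "open (- K)" using K(1) by (intro open_Compl compact_imp_closed)
      then have "(\<phi> has_vector_derivative 0) (at x)"
        by (rule has_vector_derivative_transform_within_open[OF has_vector_derivative_const[of 0]])
           (use that K(3) in auto)
      moreover have "(\<phi> has_vector_derivative \<phi>' x) (at x)" using \<phi> by (simp add: vector_test_function_def)
      ultimately show "\<phi>' x = 0" by (rule vector_derivative_unique_at[symmetric])
    qed
    have "0 \<notin> K" "1 \<notin> K" using K(2) by auto
    then have "abs_L1 \<phi> \<in> smooth_dom G w a"
      using \<phi> zero by (intro smooth_domI[of \<phi> \<phi>']) (auto simp: vector_test_function_def flux_condition_0)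
    moreover have "dist (abs_L1 \<phi>) u < e"
    proof -
      have int: "integrable unit_leb \<phi>"
        by (intro integrable_unit_continuous continuous_on_vector_test_function[OF \<phi>])
      have "dist (abs_L1 \<phi>) u = dist u (abs_L1 \<phi>)" by (rule dist_commute)
      also have "\<dots> = norm (abs_L1 (\<lambda>x. f x - \<phi> x))"
        using int f by (simp add: dist_norm diff_abs_L1)
      also have "\<dots> \<le> real CARD('e) * (\<integral>x. norm (f x - \<phi> x) \<partial>unit_leb)"
        using int f by (intro norm_abs_L1_le_integral_norm) auto
      also have "\<dots> < e" using close by (simp add: field_simps)
      finally show ?thesis .
    qed
    ultimately show "\<exists>y\<in>smooth_dom G w a. dist y u < e" by blast
  qed
  then show ?thesis by blast
qed

text \<open>The fluxes built from the delay equation are differentiable on the whole line. The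
  derivative of the solution is therefore two-sided even at time 0, which allows the plain chain
  rule for a time change.\<close>

lemma smooth_dom_solution:
  fixes w :: "real^'e::finite^'v::finite"
  assumes x: "x \<in> smooth_dom G w (\<lambda>j. c j t\<^sub>0)" and pos: "\<And>j. c j t\<^sub>0 > 0"
  obtains u where "u 0 = x" "\<And>t. t \<ge> 0 \<Longrightarrow> u t \<in> smooth_dom G w (\<lambda>j. c j t\<^sub>0)"
    "\<And>t. t \<ge> 0 \<Longrightarrow> (u has_vector_derivative transport_op c t\<^sub>0 (u t)) (at t)"
    "continuous_on {0..} (\<lambda>t. transport_op c t\<^sub>0 (u t))"
proof -
  define a where "a j = c j t\<^sub>0" for j
  have a: "a j > 0" for j using pos by (simp add: a_def)
  have a0: "a j \<noteq> 0" for j using a[of j] by simp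
  obtain v v' where v: "x = abs_L1 v" "\<And>x. (v has_vector_derivative v' x) (at x)" "continuous_on UNIV v'"
    "flux_condition G w a (v 0) (v 1)" "flux_condition G w (\<lambda>j. (a j)\<^sup>2) (v' 0) (v' 1)"
    using x unfolding a_def by (rule smooth_domE) blast
  \<comment> \<open>The time needed to travel along edge j.\<close>
  define l where "l j = 1 / a j" for j
  define B where "B i j = line_adjacency G w $ i $ j" for i j
  \<comment> \<open>The initial flux, parametrised by the time at which it arrives at the head of
    the edge. Each derivative in this time brings down a factor \<open>a j\<close>, hence the square
    in \<open>F'\<close>.\<close>
  define F where "F j s = a j *\<^sub>R v (a j * s) $ j" for j s
  define F' where "F' j s = (a j)\<^sup>2 *\<^sub>R v' (a j * s) $ j" for j s
  define P where "P = delay_extension l B F"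
  define Q where "Q = delay_extension l B F'"
  have l: "l j > 0" for j using a by (simp add: l_def)
  have dF: "(F j has_vector_derivative F' j s) (at s)" for j s
  proof -
    have "((\<lambda>s. a j * s) has_vector_derivative a j) (at s)"
      by (auto intro!: derivative_eq_intros)
    from vector_diff_chain_at[OF this v(2)]
    have "((\<lambda>s. v (a j * s)) has_vector_derivative a j *\<^sub>R v' (a j * s)) (at s)" by (simp add: o_def)
    then have "((\<lambda>s. a j *\<^sub>R v (a j * s) $ j) has_vector_derivative a j *\<^sub>R (a j *\<^sub>R v' (a j * s)) $ j) (at s)"
      by (intro bounded_linear.has_vector_derivative[OF bounded_linear_scaleR_right]
            bounded_linear.has_vector_derivative[OF bounded_linear_vec_nth])
    then show ?thesis by (simp add: F_def[abs_def] F'_def power2_eq_square)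
  qed
  have F'_cont: "continuous_on UNIV (F' j)" for j
    unfolding F'_def
    by (intro continuous_intros continuous_on_compose2[OF v(3)]) auto
  \<comment> \<open>These are the two flux conditions defining the smooth data, since time
    \<open>l j\<close> corresponds to the tail and time 0 to the head.\<close>
  have compat: "F j (l j) = (\<Sum>k\<in>UNIV. B j k *\<^sub>R F k 0)" "F' j (l j) = (\<Sum>k\<in>UNIV. B j k *\<^sub>R F' k 0)" for j
    using v(4,5) a0 by (simp_all add: F_def F'_def l_def B_def flux_condition_def)
  have dP: "(P j has_vector_derivative Q j s) (at s)" for j s
    unfolding P_def Q_def by (rule has_vector_derivative_delay_extension[of l F F' B, OF l dF compat])
  have Q_cont: "continuous_on UNIV (Q j)" for j
    unfolding Q_def by (rule continuous_delay_extension[of l F' B, OF l F'_cont compat(2)])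
  have P_shift: "P j (t + l j) = (\<Sum>k\<in>UNIV. B j k *\<^sub>R P k t)"
    and Q_shift: "Q j (t + l j) = (\<Sum>k\<in>UNIV. B j k *\<^sub>R Q k t)" if "t \<ge> 0" for j t
    unfolding P_def Q_def using that
    by (auto intro!: delay_extension_shift[of l, OF l] compat)
  define V where "V t y = (\<chi> j. l j *\<^sub>R P j (t + y * l j))" for t y
  \<comment> \<open>\<open>V'\<close> is the time derivative and \<open>W\<close> the space
    derivative of \<open>V\<close>. They differ by the factor \<open>l j\<close> in each component,
    which is the transport equation.\<close>
  define V' where "V' t y = (\<chi> j. l j *\<^sub>R Q j (t + y * l j))" for t y
  define W where "W t y = (\<chi> j. (l j)\<^sup>2 *\<^sub>R Q j (t + y * l j))" for t y
  have dV: "((\<lambda>t. V t y) has_vector_derivative V' t y) (at t)" for t y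
  proof -
    have "((\<lambda>t. P j (t + y * l j)) has_vector_derivative Q j (t + y * l j)) (at t)" for j
    proof -
      have "((\<lambda>t. t + y * l j) has_vector_derivative 1) (at t)"
        by (auto intro!: derivative_eq_intros)
      from vector_diff_chain_at[OF this dP] show ?thesis by (simp add: o_def)
    qed
    then show ?thesis
      unfolding V_def V'_def
      by (intro has_vector_derivative_vec_lambda bounded_linear.has_vector_derivative[OF bounded_linear_scaleR_right])
  qed
  have dW: "(V t has_vector_derivative W t y) (at y)" for t y
  proof -
    have "((\<lambda>y. P j (t + y * l j)) has_vector_derivative l j *\<^sub>R Q j (t + y * l j)) (at y)" for j
    proof -
      have "((\<lambda>y. t + y * l j) has_vector_derivative l j) (at y)"
        by (auto intro!: derivative_eq_intros)
      from vector_diff_chain_at[OF this dP] show ?thesis by (simp add: o_def)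
    qed
    then have "((\<lambda>y. \<chi> j. l j *\<^sub>R P j (t + y * l j)) has_vector_derivative
        (\<chi> j. l j *\<^sub>R (l j *\<^sub>R Q j (t + y * l j)))) (at y)"
      by (intro has_vector_derivative_vec_lambda bounded_linear.has_vector_derivative[OF bounded_linear_scaleR_right])
    then show ?thesis by (simp add: V_def[abs_def] W_def power2_eq_square)
  qed
  have V'_cont: "continuous_on UNIV (\<lambda>p. V' (fst p) (snd p))"
    unfolding V'_def by (intro continuous_intros continuous_on_compose2[OF Q_cont]) auto
  have W_cont: "continuous_on UNIV (W t)" for t
    unfolding W_def by (intro continuous_intros continuous_on_compose2[OF Q_cont]) auto
  have V_cont: "continuous_on {0..1} (V t)" for t
    by (intro continuous_at_imp_continuous_on ballI has_vector_derivative_continuous[OF dW])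
  have flux: "flux_condition G w a (V t 0) (V t 1)" if "t \<ge> 0" for t
    using P_shift[OF that] a0 by (simp add: flux_condition_def V_def l_def B_def)
  have flux': "flux_condition G w (\<lambda>j. (a j)\<^sup>2) (W t 0) (W t 1)" if "t \<ge> 0" for t
    using Q_shift[OF that] a0 by (simp add: flux_condition_def W_def l_def B_def power2_eq_square)
  have op: "transport_op c t\<^sub>0 (abs_L1 (V t)) = abs_L1 (V' t)" if "t \<ge> 0" for t
  proof -
    have "transport_op c t\<^sub>0 (abs_L1 (V t)) = abs_L1 (\<lambda>y. \<chi> j. c j t\<^sub>0 * W t y $ j)"
      by (rule C1_in_transport_dom(2)[where v = "V t" and v' = "W t" and c = c and t = t\<^sub>0, OF dW W_cont pos])
         (use flux[OF that] in \<open>simp add: flux_condition_def a_def\<close>)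
    also have "(\<lambda>y. \<chi> j. c j t\<^sub>0 * W t y $ j) = V' t"
      using a0 by (simp add: fun_eq_iff vec_eq_iff W_def V'_def l_def a_def[symmetric] power2_eq_square scaleR_conv_of_real)
    finally show ?thesis .
  qed
  show ?thesis
  proof (rule that[of "\<lambda>t. abs_L1 (V t)"])
    \<comment> \<open>Only for y \<le> 1 does the argument of the flux stay in the initial branch;
      agreement on the unit interval is enough for equality of the classes.\<close>
    have "V 0 y = v y" if "y \<in> {0..1}" for y
    proof -
      have "y * l j \<le> l j" for j using that l[of j] by simp
      then have "P j (y * l j) = F j (y * l j)" for j unfolding P_def by (rule delay_extension_initial)
      then show ?thesis using a0 by (simp add: V_def F_def l_def vec_eq_iff)
    qed
    moreover have "integrable unit_leb v"
      by (intro integrable_unit_continuous continuous_at_imp_continuous_on ballI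
          has_vector_derivative_continuous[OF v(2)])
    moreover have "integrable unit_leb (V 0)" by (intro integrable_unit_continuous V_cont)
    ultimately show "abs_L1 (V 0) = x"
      unfolding v(1) by (subst abs_L1_eq_iff) (auto intro!: AE_I2)
    show "abs_L1 (V t) \<in> smooth_dom G w (\<lambda>j. c j t\<^sub>0)" if "t \<ge> 0" for t
      using smooth_domI[OF dW W_cont flux[OF that] flux'[OF that]] by (simp add: a_def[abs_def])
    show "((\<lambda>t. abs_L1 (V t)) has_vector_derivative transport_op c t\<^sub>0 (abs_L1 (V t))) (at t)" if "t \<ge> 0" for t
      unfolding op[OF that] by (rule has_vector_derivative_abs_L1[OF V_cont dV V'_cont])
    have "continuous_on {0..} (\<lambda>t. abs_L1 (V' t))" by (rule continuous_on_abs_L1[OF V'_cont])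
    then show "continuous_on {0..} (\<lambda>t. transport_op c t\<^sub>0 (abs_L1 (V t)))"
      by (rule continuous_on_eq) (simp add: op)
  qed
qed

section \<open>Well-posedness\<close>

lemma smooth_dom_subset_transport_dom:
  assumes "\<And>j. c j t > 0"
  shows "smooth_dom G w (\<lambda>j. c j t) \<subseteq> transport_dom G w c t"
proof
  fix u assume "u \<in> smooth_dom G w (\<lambda>j. c j t)"
  then obtain v v' where v: "u = abs_L1 v" "\<And>x. (v has_vector_derivative v' x) (at x)" "continuous_on UNIV v'"
    "flux_condition G w (\<lambda>j. c j t) (v 0) (v 1)" by (rule smooth_domE) blast
  then show "u \<in> transport_dom G w c t"
    unfolding v(1) using assms by (intro C1_in_transport_dom(1)[OF v(2,3)]) (auto simp: flux_condition_def)
qed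

text \<open>The linearity needed to apply dissipativity to the difference of two solutions.\<close>

lemma transport_dom_diff:
  fixes w :: "real^'e::finite^'v::finite"
  assumes u: "u1 \<in> transport_dom G w c t" "u2 \<in> transport_dom G w c t" and pos: "\<And>j. c j t > 0"
  shows "u1 - u2 \<in> transport_dom G w c t"
    and "transport_op c t (u1 - u2) = transport_op c t u1 - transport_op c t u2"
proof -
  obtain v g where v: "continuous_on {0..1} v" and g: "integrable unit_leb g" and u1: "u1 = abs_L1 v"
    and weak1: "has_weak_derivative u1 (abs_L1 g)"
    and ftc1: "\<And>x. x \<in> {0..1} \<Longrightarrow> v x = v 0 + integral {0..x} g"
    and bc1: "\<And>i. c i t *\<^sub>R v 1 $ i = (\<Sum>j\<in>UNIV. line_adjacency G w $ i $ j *\<^sub>R c j t *\<^sub>R v 0 $ j)"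
    and op1: "transport_op c t u1 = abs_L1 (\<lambda>x. \<chi> j. c j t * g x $ j)"
    by (rule transport_domE[OF u(1) pos]) blast
  obtain q k where q: "continuous_on {0..1} q" and k: "integrable unit_leb k" and u2: "u2 = abs_L1 q"
    and weak2: "has_weak_derivative u2 (abs_L1 k)"
    and ftc2: "\<And>x. x \<in> {0..1} \<Longrightarrow> q x = q 0 + integral {0..x} k"
    and bc2: "\<And>i. c i t *\<^sub>R q 1 $ i = (\<Sum>j\<in>UNIV. line_adjacency G w $ i $ j *\<^sub>R c j t *\<^sub>R q 0 $ j)"
    and op2: "transport_op c t u2 = abs_L1 (\<lambda>x. \<chi> j. c j t * k x $ j)"
    by (rule transport_domE[OF u(2) pos]) blast
  have int: "integrable unit_leb v" "integrable unit_leb q"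
    using v q by (auto intro: integrable_unit_continuous)
  have diff: "u1 - u2 = abs_L1 (\<lambda>x. v x - q x)" unfolding u1 u2 by (rule diff_abs_L1[OF int])
  have dq_cont: "continuous_on {0..1} (\<lambda>x. v x - q x)" by (intro continuous_intros v q)
  have weak: "has_weak_derivative (u1 - u2) (abs_L1 (\<lambda>x. g x - k x))"
    unfolding diff
  proof (subst has_weak_derivative_abs_L1)
    show "integrable unit_leb (\<lambda>x. v x - q x)" "integrable unit_leb (\<lambda>x. g x - k x)"
      using int g k by auto
    show "\<forall>\<phi> \<phi>'. test_function \<phi> \<phi>' \<longrightarrow>
       (\<integral>x. \<phi>' x *\<^sub>R (v x - q x) \<partial>unit_leb) = - (\<integral>x. \<phi> x *\<^sub>R (g x - k x) \<partial>unit_leb)"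
    proof (intro allI impI)
      fix \<phi> \<phi>' assume \<phi>: "test_function \<phi> \<phi>'"
      then have cont: "continuous_on {0..1} \<phi>" "continuous_on {0..1} \<phi>'"
        using continuous_on_vector_test_function[of \<phi> \<phi>' "{0..1}"]
        by (auto simp: test_function_iff_vector_test_function vector_test_function_def intro: continuous_on_subset)
      have i: "integrable unit_leb (\<lambda>x. \<phi>' x *\<^sub>R v x)" "integrable unit_leb (\<lambda>x. \<phi>' x *\<^sub>R q x)"
        "integrable unit_leb (\<lambda>x. \<phi> x *\<^sub>R g x)" "integrable unit_leb (\<lambda>x. \<phi> x *\<^sub>R k x)"
        by (intro integrable_scaleR_continuous cont int g k)+
      have "(\<integral>x. \<phi>' x *\<^sub>R v x \<partial>unit_leb) = - (\<integral>x. \<phi> x *\<^sub>R g x \<partial>unit_leb)"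
        "(\<integral>x. \<phi>' x *\<^sub>R q x \<partial>unit_leb) = - (\<integral>x. \<phi> x *\<^sub>R k x \<partial>unit_leb)"
        using weak1 weak2 \<phi> int g k unfolding u1 u2 by (auto simp: has_weak_derivative_abs_L1)
      then show "(\<integral>x. \<phi>' x *\<^sub>R (v x - q x) \<partial>unit_leb) = - (\<integral>x. \<phi> x *\<^sub>R (g x - k x) \<partial>unit_leb)"
        using i by (simp add: scaleR_diff_right)
    qed
  qed
  have "has_boundary_values (u1 - u2) (v 0 - q 0) (v 1 - q 1)"
    unfolding has_boundary_values_def diff
    using dq_cont by (intro exI[of _ "\<lambda>x. v x - q x"]) (simp add: represents_abs_L1 integrable_unit_continuous)
  moreover have "v 1 - q 1 = map_matrix complex_of_real (weighted_adjacency G w c t) *v (v 0 - q 0)"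
    unfolding boundary_condition_iff[of c t, OF pos] using bc1 bc2
    by (simp add: scaleR_diff_right sum_subtractf)
  ultimately show "u1 - u2 \<in> transport_dom G w c t"
    using weak unfolding transport_dom_def W11_def by blast
  have "(\<lambda>x. (\<chi> j. complex_of_real (c j t) * g x $ j) - (\<chi> j. complex_of_real (c j t) * k x $ j))
      = (\<lambda>x. \<chi> j. complex_of_real (c j t) * (g x - k x) $ j)"
    by (simp add: fun_eq_iff vec_eq_iff right_diff_distrib)
  then show "transport_op c t (u1 - u2) = transport_op c t u1 - transport_op c t u2"
    unfolding op1 op2 unfolding transport_op_def weak_derivative_eqI[OF weak]
    using g k by (simp add: comp_scale_abs_L1 diff_abs_L1 integrable_comp_scale)
qed

text \<open>The difference of two solutions solves the same equation, and the operator is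
  dissipative at every frozen time. The function \<tau> covers the autonomous problem (constant
  \<tau>) and the non-autonomous one (\<tau> t = t) together.\<close>

lemma transport_solution_contraction:
  fixes w :: "real^'e::finite^'v::finite"
  assumes pos: "\<And>j t. c j t > 0"
    and B_nonneg: "\<And>i j. 0 \<le> line_adjacency G w $ i $ j"
    and B_sum: "\<And>j. (\<Sum>i\<in>UNIV. line_adjacency G w $ i $ j) = 1"
    and u: "\<And>t. t \<ge> s \<Longrightarrow> u t \<in> transport_dom G w c (\<tau> t)"
      "\<And>t. t \<ge> s \<Longrightarrow> (u has_vector_derivative transport_op c (\<tau> t) (u t)) (at t within {s..})"
    and v: "\<And>t. t \<ge> s \<Longrightarrow> v t \<in> transport_dom G w c (\<tau> t)"
      "\<And>t. t \<ge> s \<Longrightarrow> (v has_vector_derivative transport_op c (\<tau> t) (v t)) (at t within {s..})"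
    and "s \<le> t"
  shows "norm (u t - v t) \<le> norm (u s - v s)"
proof (rule norm_le_initial_if_dissipative[of s "\<lambda>t. u t - v t" "\<lambda>t. transport_op c (\<tau> t) (u t - v t)", OF _ _ \<open>s \<le> t\<close>])
  fix t assume t: "s \<le> t"
  show "((\<lambda>t. u t - v t) has_vector_derivative transport_op c (\<tau> t) (u t - v t)) (at t within {s..})"
    unfolding transport_dom_diff(2)[of "u t" G w c "\<tau> t" "v t", OF u(1)[OF t] v(1)[OF t] pos]
    by (intro has_vector_derivative_diff u v t)
  show "norm (u t - v t) \<le> norm (u t - v t - h *\<^sub>R transport_op c (\<tau> t) (u t - v t))" if "h \<ge> 0" for h
    by (rule transport_op_dissipative[OF transport_dom_diff(1)[OF u(1)[OF t] v(1)[OF t] pos] pos that B_nonneg B_sum])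
qed

lemma continuous_antiderivative_exists:
  fixes f :: "real \<Rightarrow> real"
  assumes f: "continuous_on UNIV f"
  obtains F where "\<And>x. (F has_real_derivative f x) (at x)"
proof
  fix x :: real
  \<comment> \<open>This puts x in the interior of the interval, so the derivative within the
    interval is a full derivative. The oriented integral from 0 serves negative x as well.\<close>
  define N where "N = \<bar>x\<bar> + 1"
  have "((\<lambda>u. LBINT y=ereal 0..ereal u. f y) has_vector_derivative f x) (at x within {-N..N})"
  proof (rule interval_integral_FTC2)
    show "continuous_on {-N..N} f" by (rule continuous_on_subset[OF f]) simp
  qed (auto simp: N_def)
  moreover have "at x within {-N..N} = at x"
    by (rule at_within_interior) (auto simp: N_def)
  ultimately show "((\<lambda>u. LBINT y=ereal 0..ereal u. f y) has_real_derivative f x) (at x)"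
    by (simp add: has_real_derivative_iff_has_vector_derivative)
qed

lemma transport_well_posed:
  fixes w :: "real^'e::finite^'v::finite"
  assumes pos: "\<And>j t. c j t > 0"
    and B_nonneg: "\<And>i j. 0 \<le> line_adjacency G w $ i $ j"
    and B_sum: "\<And>j. (\<Sum>i\<in>UNIV. line_adjacency G w $ i $ j) = 1"
    and dom: "\<And>t. transport_dom G w c t = transport_dom G w c 0"
    and \<gamma>: "\<And>j t. c j t = \<gamma> t * c j 0" and \<gamma>_cont: "continuous_on UNIV \<gamma>"
  shows "well_posed (transport_op c) (transport_dom G w c)"
proof -
  have \<gamma>_pos: "\<gamma> t > 0" for t
    using pos[of undefined t] pos[of undefined 0] \<gamma>[of undefined t] by (simp add: zero_less_mult_iff)
  obtain \<Gamma> where d\<Gamma>: "\<And>t. (\<Gamma> has_real_derivative \<gamma> t) (at t)"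
    by (rule continuous_antiderivative_exists[OF \<gamma>_cont]) blast
  have \<Gamma>_mono: "\<Gamma> s \<le> \<Gamma> t" if "s \<le> t" for s t
    by (rule DERIV_nonneg_imp_nondecreasing[OF that]) (use d\<Gamma> \<gamma>_pos in \<open>auto intro: less_imp_le\<close>)
  have \<Gamma>_cont: "continuous_on S \<Gamma>" for S
    using d\<Gamma> by (auto intro!: continuous_at_imp_continuous_on DERIV_isCont)
  have op: "transport_op c t u = \<gamma> t *\<^sub>R transport_op c 0 u" for t u
  proof -
    obtain g where g: "integrable unit_leb g" "weak_derivative u = abs_L1 g" by (rule L1_cases)
    have "(\<lambda>x. \<chi> j. complex_of_real (c j t) * g x $ j) = (\<lambda>x. \<gamma> t *\<^sub>R (\<chi> j. complex_of_real (c j 0) * g x $ j))"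
      by (simp add: fun_eq_iff vec_eq_iff \<gamma>[of _ t] scaleR_conv_of_real[where 'a = complex])
    then show ?thesis
      unfolding transport_op_def g(2) using g(1)
      by (simp add: comp_scale_abs_L1 scaleR_abs_L1 integrable_comp_scale)
  qed
  define Y where "Y = smooth_dom G w (\<lambda>j. c j 0)"
  have Y_dom: "Y \<subseteq> transport_dom G w c t" for t
    unfolding dom[of t] Y_def by (rule smooth_dom_subset_transport_dom) (rule pos)
  define sol where "sol x u \<longleftrightarrow> u 0 = x \<and> (\<forall>t\<ge>0. u t \<in> Y) \<and>
      (\<forall>t\<ge>0. (u has_vector_derivative transport_op c 0 (u t)) (at t)) \<and>
      continuous_on {0..} (\<lambda>t. transport_op c 0 (u t))" for x u
  \<comment> \<open>An arbitrary choice of autonomous solution for each initial value; consistency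
    between choices comes from the contraction estimate.\<close>
  define S where "S x = (SOME u. sol x u)" for x
  have S: "sol x (S x)" if x: "x \<in> Y" for x
    unfolding S_def
  proof (rule someI_ex[of "sol x"])
    show "\<exists>u. sol x u"
    proof (rule smooth_dom_solution[of x G w c 0, OF x[unfolded Y_def] pos])
      fix u
      assume "u 0 = x" "\<And>t. t \<ge> 0 \<Longrightarrow> u t \<in> smooth_dom G w (\<lambda>j. c j 0)"
        "\<And>t. t \<ge> 0 \<Longrightarrow> (u has_vector_derivative transport_op c 0 (u t)) (at t)"
        "continuous_on {0..} (\<lambda>t. transport_op c 0 (u t))"
      then have "sol x u" by (simp add: sol_def Y_def)
      then show ?thesis by (rule exI[of _ u])
    qed
  qed
  have S0: "S x 0 = x" if "x \<in> Y" for x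
    using S[OF that] by (simp add: sol_def)
  have SY: "S x t \<in> Y" if "x \<in> Y" "t \<ge> 0" for x t
    using S[OF that(1)] that(2) by (simp add: sol_def)
  have dS: "(S x has_vector_derivative transport_op c 0 (S x t)) (at t)" if "x \<in> Y" "t \<ge> 0" for x t
    using S[OF that(1)] that(2) by (simp add: sol_def)
  have S_cont: "continuous_on {0..} (\<lambda>t. transport_op c 0 (S x t))" if "x \<in> Y" for x
    using S[OF that] by (simp add: sol_def)
  \<comment> \<open>Compares a time-shifted solution with another one. Taking h = 0 gives Lipschitz
    dependence on the initial value, and taking y = x bounds increments in time by the increment
    over a time h starting at 0.\<close>
  have S_contraction: "norm (S x (h + t) - S y t) \<le> norm (S x h - y)"
    if xy: "x \<in> Y" "y \<in> Y" and ht: "0 \<le> h" "0 \<le> t" for x y h t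
  proof -
    have "norm (S x (h + t) - S y t) \<le> norm (S x (h + 0) - S y 0)"
    proof (rule transport_solution_contraction[of c G w 0 "\<lambda>t. S x (h + t)" "\<lambda>_. 0" "S y"])
      show "((\<lambda>t. S x (h + t)) has_vector_derivative transport_op c 0 (S x (h + t))) (at t within {0..})"
        if "t \<ge> 0" for t
      proof -
        have "((\<lambda>t. h + t) has_vector_derivative 1) (at t)"
          by (auto intro!: derivative_eq_intros)
        from vector_diff_chain_at[OF this dS[OF xy(1)]]
        show ?thesis using ht that by (simp add: o_def has_vector_derivative_at_within)
      qed
      show "(S y has_vector_derivative transport_op c 0 (S y t)) (at t within {0..})" if "t \<ge> 0" for t
        by (rule has_vector_derivative_at_within[OF dS[OF xy(2) that]])
      show "S x (h + t) \<in> transport_dom G w c 0" "S y t \<in> transport_dom G w c 0" if "t \<ge> 0" for t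
        by (rule subsetD[OF Y_dom SY[OF xy(1)]], use ht that in simp, rule subsetD[OF Y_dom SY[OF xy(2) that]])
    qed (use pos B_nonneg B_sum ht in auto)
    then show ?thesis using S0[OF xy(2)] by simp
  qed
  define U where "U t s x = S x (\<Gamma> t - \<Gamma> s)" for t s x
  have UY: "U t s x \<in> Y" if "x \<in> Y" "s \<le> t" for t s x
    unfolding U_def using \<Gamma>_mono[OF that(2)] by (intro SY that) simp
  have dU: "((\<lambda>t. U t s x) has_vector_derivative transport_op c t (U t s x)) (at t within {s..})"
    if "x \<in> Y" "s \<le> t" for t s x
  proof -
    have "((\<lambda>t. \<Gamma> t - \<Gamma> s) has_vector_derivative \<gamma> t) (at t)"
      using d\<Gamma>[of t] unfolding has_real_derivative_iff_has_vector_derivative[symmetric]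
      by (auto intro!: derivative_eq_intros)
    from vector_diff_chain_at[OF this dS[OF that(1)]] \<Gamma>_mono[OF that(2)]
    show ?thesis unfolding op[of t] U_def by (simp add: o_def has_vector_derivative_at_within)
  qed
  have U_solution: "classical_solution (transport_op c) (transport_dom G w c) s x (\<lambda>t. U t s x)" if x: "x \<in> Y" for s x
    unfolding classical_solution_def
  proof (intro conjI exI[of _ "\<lambda>t. transport_op c t (U t s x)"] allI impI)
    have "continuous_on {s..} (\<lambda>t. transport_op c 0 (S x (\<Gamma> t - \<Gamma> s)))"
      by (rule continuous_on_compose2[OF S_cont[OF x]]) (auto intro!: continuous_intros \<Gamma>_cont \<Gamma>_mono)
    then have "continuous_on {s..} (\<lambda>t. \<gamma> t *\<^sub>R transport_op c 0 (S x (\<Gamma> t - \<Gamma> s)))"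
      by (intro continuous_on_scaleR continuous_on_subset[OF \<gamma>_cont]) auto
    also have "(\<lambda>t. \<gamma> t *\<^sub>R transport_op c 0 (S x (\<Gamma> t - \<Gamma> s))) = (\<lambda>t. transport_op c t (U t s x))"
      unfolding U_def by (rule ext) (rule op[symmetric])
    finally show "continuous_on {s..} (\<lambda>t. transport_op c t (U t s x))" .
    show "U s s x = x" by (simp add: U_def S0[OF x])
    show "((\<lambda>t. U t s x) has_vector_derivative transport_op c t (U t s x)) (at t within {s..})"
      if "s \<le> t" for t by (rule dU[OF x that])
    show "U t s x \<in> transport_dom G w c t" if "s \<le> t" for t by (rule subsetD[OF Y_dom UY[OF x that]])
  qed simp
  have uniq: "v t = U t s x"
    if x: "x \<in> Y" and v: "classical_solution (transport_op c) (transport_dom G w c) s x v" and t: "s \<le> t" for s x v t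
  proof -
    from v have v_props: "\<And>t. t \<ge> s \<Longrightarrow> (v has_vector_derivative transport_op c t (v t)) (at t within {s..})"
      "\<And>t. t \<ge> s \<Longrightarrow> v t \<in> transport_dom G w c t" "v s = x"
      unfolding classical_solution_def by metis+
    have "norm (v t - U t s x) \<le> norm (v s - U s s x)"
    proof (rule transport_solution_contraction[of c G w s v "\<lambda>t. t" "\<lambda>t. U t s x", OF pos B_nonneg B_sum])
      show "U t s x \<in> transport_dom G w c t" if "s \<le> t" for t
        using UY[OF x that] Y_dom by blast
    qed (use v_props dU[OF x] t in auto)
    then show ?thesis using v_props(3) S0[OF x] by (simp add: U_def)
  qed
  have conv: "uniform_limit {a..b}
      (\<lambda>n t. if t \<ge> \<sigma> n then U t (\<sigma> n) (\<xi> n) else \<xi> n)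
      (\<lambda>t. if t \<ge> s then U t s x else x) sequentially"
    if x: "x \<in> Y" and \<xi>: "\<And>n. \<xi> n \<in> Y" and lims: "\<sigma> \<longlonglongrightarrow> s" "\<xi> \<longlonglongrightarrow> x" for s x \<sigma> \<xi> a b
  proof (rule uniform_limitI)
    fix e :: real assume "e > 0"
    \<comment> \<open>As \<Gamma> is nondecreasing, the solution extended by its initial value is
      the autonomous one at a clipped time, so no case distinction on the order of t, s and \<sigma>
      n remains.\<close>
    have eq: "(if t \<ge> s then U t s x else x) = S x (max 0 (\<Gamma> t - \<Gamma> s))" if "x \<in> Y" for t s x
      using \<Gamma>_mono[of s t] \<Gamma>_mono[of t s] S0[OF that] by (auto simp: U_def max_def)
    have "isCont (S x) 0"
      using has_vector_derivative_continuous[OF dS[OF x order_refl]] .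
    then obtain d where "d > 0" and d: "\<And>h. \<bar>h\<bar> < d \<Longrightarrow> norm (S x h - x) < e / 2"
      using \<open>e > 0\<close> S0[OF x] unfolding continuous_at_eps_delta dist_norm
      by (metis diff_zero half_gt_zero real_norm_def)
    \<comment> \<open>By the contraction estimate the continuity of \<open>S x\<close> at 0 becomes
      uniform continuity on all nonnegative times; this makes the convergence uniform in t.\<close>
    have close: "norm (S x p - S x q) < e / 2" if "0 \<le> p" "0 \<le> q" "\<bar>p - q\<bar> < d" for p q
    proof -
      have *: "norm (S x p - S x q) < e / 2" if "0 \<le> q" "q \<le> p" "\<bar>p - q\<bar> < d" for p q
        using S_contraction[OF x x, of "p - q" q] d[of "p - q"] that by simp
      show ?thesis
      proof (cases "q \<le> p")
        case True
        then show ?thesis using * that by blast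
      next
        case False
        then have "norm (S x q - S x p) < e / 2"
          using that by (intro *) auto
        then show ?thesis by (simp add: norm_minus_commute)
      qed
    qed
    have "(\<lambda>n. \<Gamma> (\<sigma> n)) \<longlonglongrightarrow> \<Gamma> s"
      using DERIV_isCont[OF d\<Gamma>] lims(1) by (rule isCont_tendsto_compose)
    then have "\<forall>\<^sub>F n in sequentially. dist (\<Gamma> (\<sigma> n)) (\<Gamma> s) < d"
      using \<open>d > 0\<close> by (rule tendstoD)
    moreover have "\<forall>\<^sub>F n in sequentially. dist (\<xi> n) x < e / 2"
      using lims(2) \<open>e > 0\<close> by (intro tendstoD) auto
    ultimately show "\<forall>\<^sub>F n in sequentially. \<forall>t\<in>{a..b}.
        dist (if t \<ge> \<sigma> n then U t (\<sigma> n) (\<xi> n) else \<xi> n) (if t \<ge> s then U t s x else x) < e"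
    proof eventually_elim
      case (elim n)
      show ?case
      proof
        fix t
        let ?p = "max 0 (\<Gamma> t - \<Gamma> (\<sigma> n))" and ?q = "max 0 (\<Gamma> t - \<Gamma> s)"
        have "norm (S (\<xi> n) ?p - S x ?p) \<le> norm (\<xi> n - x)"
          using S_contraction[OF \<xi> x, of 0 ?p n] S0[OF \<xi>] by simp
        moreover have "norm (S x ?p - S x ?q) < e / 2"
          using elim(1) by (intro close) (auto simp: dist_real_def)
        ultimately have "norm (S (\<xi> n) ?p - S x ?q) < e"
          using elim(2) norm_triangle_ineq[of "S (\<xi> n) ?p - S x ?p" "S x ?p - S x ?q"]
          by (simp add: dist_norm)
        then show "dist (if t \<ge> \<sigma> n then U t (\<sigma> n) (\<xi> n) else \<xi> n) (if t \<ge> s then U t s x else x) < e"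
          unfolding eq[OF x] eq[OF \<xi>] dist_norm .
      qed
    qed
  qed
  show ?thesis
    unfolding well_posed_def
  proof (intro exI[of _ "\<lambda>_. Y"] exI[of _ U] conjI allI ballI impI)
    show "module.subspace scaleC_L1 Y" "closure Y = UNIV"
      unfolding Y_def by (rule subspace_smooth_dom, rule closure_smooth_dom)
    show "Y \<subseteq> transport_dom G w c s" for s by (rule Y_dom)
  next
    fix s x assume "x \<in> Y"
    then show "classical_solution (transport_op c) (transport_dom G w c) s x (\<lambda>t. U t s x)"
      by (rule U_solution)
  next
    fix s t :: real and x assume "x \<in> Y" "s \<le> t"
    then show "U t s x \<in> Y" by (rule UY)
  next
    fix s t :: real and x v assume "x \<in> Y" "classical_solution (transport_op c) (transport_dom G w c) s x v" "s \<le> t"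
    then show "v t = U t s x" by (rule uniq)
  next
    fix s a b :: real and x \<sigma> \<xi>
    assume "x \<in> Y \<and> (\<forall>n. \<xi> n \<in> Y) \<and> \<sigma> \<longlonglongrightarrow> s \<and> \<xi> \<longlonglongrightarrow> x"
    then show "uniform_limit {a..b}
        (\<lambda>n t. if t \<ge> \<sigma> n then U t (\<sigma> n) (\<xi> n) else \<xi> n)
        (\<lambda>t. if t \<ge> s then U t s x else x) sequentially"
      by (intro conv) auto
  qed
qed

theorem proposition3p2:
  fixes G :: "('v::finite, 'e::finite) pre_digraph"
    and w :: "real^'e^'v"
    and c :: "'e \<Rightarrow> real \<Rightarrow> real"
    and c_min c_max :: real
  assumes "digraph G" and "Digraph_Component.connected G"
    and "verts G = UNIV" and "arcs G = UNIV"
    and "\<And>i j. 0 \<le> w $ i $ j \<and> w $ i $ j \<le> 1"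
    and "\<And>i. (\<Sum>j\<in>UNIV. w $ i $ j) = 1"
    and "\<And>i j. incidence_minus G $ i $ j = 0 \<Longrightarrow> w $ i $ j = 0"
    and "irreducible_matrix (line_adjacency G w)"
    and "0 < c_min" and "c_min \<le> c_max"
    and "\<And>j t. c_min \<le> c j t \<and> c j t \<le> c_max"
    and "\<And>t. transport_dom G w c t = transport_dom G w c 0"
    and "\<And>j. c j C1_differentiable_on UNIV"
  shows "well_posed (transport_op c) (network_dom G w c)
       \<and> well_posed (transport_op c) (transport_dom G w c)"
proof -
  have pos: "c j t > 0" for j t using assms(9) assms(11)[of j t] by linarith
  \<comment> \<open>Any edge may serve as reference, since all velocity ratios agree.\<close>
  define k :: 'e where "k = undefined"
  define \<gamma> where "\<gamma> t = c k t / c k 0" for t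
  have \<gamma>: "c j t = \<gamma> t * c j 0" for j t
    using velocity_ratio_eq[of c G w t j k, OF pos assms(12,8)] pos[of j 0] by (simp add: \<gamma>_def field_simps)
  have \<gamma>_cont: "continuous_on UNIV \<gamma>"
    unfolding \<gamma>_def using pos[of k 0]
    by (intro continuous_on_divide continuous_on_const C1_differentiable_imp_continuous_on assms(13)) simp
  have B_nonneg: "0 \<le> line_adjacency G w $ i $ j" for i j
    by (rule line_adjacency_nonneg) (use assms(5) in blast)
  have B_sum: "(\<Sum>i\<in>UNIV. line_adjacency G w $ i $ j) = 1" for j
    by (rule line_adjacency_column_sum) (rule assms(6), rule assms(7))
  have "well_posed (transport_op c) (transport_dom G w c)"
    by (rule transport_well_posed[of c G w \<gamma>, OF pos B_nonneg B_sum assms(12) \<gamma> \<gamma>_cont])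
  moreover have "network_dom G w c = transport_dom G w c"
    using network_dom_eq_transport_dom[of c _ G w, OF pos assms(7)] by (simp add: fun_eq_iff)
  ultimately show ?thesis by simp
qed

end
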